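(* Let $z,w\in\mathbb{C}$. For $a,b>0$ such that $ab=\pi^2$, $$\sqrt{a}\sum_{n=1}^{\infty}\sigma_{-z}(n)n^{z/2}e^{-\frac{w^2}{4}}K_{\frac{z}{2},iw}(2na)-\sqrt{b}\sum_{n=1}^{\infty}\sigma_{-z}(n)n^{z/2}e^{\frac{w^2}{4}}K_{\frac{z}{2},w}(2nb)$$ $$=\frac14\Gamma\left(\frac z2\right)\zeta(z)\left\{b^{\frac{1-z}{2}}\,{}_1F_1\left(\frac{1-z}{2};\frac12;\frac{w^2}{4}\right)-a^{\frac{1-z}{2}}\,{}_1F_1\left(\frac{1-z}{2};\frac12;-\frac{w^2}{4}\right)\right\}$$ $$\quad+\frac14\Gamma\left(-\frac z2\right)\zeta(-z)\left\{b^{\frac{1+z}{2}}\,{}_1F_1\left(\frac{1+z}{2};\frac12;\frac{w^2}{4}\right)-a^{\frac{1+z}{2}}\,{}_1F_1\left(\frac{1+z}{2};\frac12;-\frac{w^2}{4}\right)\right\}.$$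
   Context: The generalized modified Bessel function is defined, for $z,w\in\mathbb{C}$, by $$K_{z,w}(x):=\frac{1}{2\pi i}\int_{c-i\infty}^{c+i\infty}\Gamma\left(\tfrac{s-z}{2}\right)\Gamma\left(\tfrac{s+z}{2}\right)\,{}_1F_1\left(\tfrac{s-z}{2};\tfrac12;-\tfrac{w^2}{4}\right){}_1F_1\left(\tfrac{s+z}{2};\tfrac12;-\tfrac{w^2}{4}\right)2^{s-2}x^{-s}\,ds,$$ where $c=\mathrm{Re}(s)>|\mathrm{Re}(z)|$. Here ${}_1F_1(a;c;u)=\sum_{n\ge0}\frac{(a)_n u^n}{(c)_n n!}$ with $(a)_n=a(a+1)\cdots(a+n-1)$. $\zeta$ is the Riemann zeta function and $\sigma_{-z}(n)=\sum_{d\mid n}d^{-z}$. At the points $z$ where some factor on the right-hand side has a pole ($z=\pm1$ and the even integers), the singularity of the right-hand side is removable and the right-hand side is understood as its limit. *)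

theory Defs
  imports "HOL-Complex_Analysis.Complex_Analysis"
begin

text \<open>
  The Riemann zeta function, as the analytic continuation of its Dirichlet series to the plane
  punctured at 1. The value at the pole 1 is irrelevant; it is fixed (to 0) so that the
  describing property determines the function uniquely.
\<close>

definition riemann_zeta :: "complex \<Rightarrow> complex" where
  "riemann_zeta = (THE f. f holomorphic_on (- {1}) \<and>
      (\<forall>s. 1 < Re s \<longrightarrow> (\<lambda>n. of_nat (Suc n) powr (- s)) sums f s) \<and> f 1 = 0)"

definition divisor_sigma :: "complex \<Rightarrow> nat \<Rightarrow> complex" where
  "divisor_sigma z n = (\<Sum>d | d dvd n. of_nat d powr z)"

definition hyp1F1 :: "complex \<Rightarrow> complex \<Rightarrow> complex \<Rightarrow> complex" where
  "hyp1F1 a c u = (\<Sum>n. pochhammer a n * u ^ n / (pochhammer c n * fact n))"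

definition gen_bessel_integrand :: "complex \<Rightarrow> complex \<Rightarrow> real \<Rightarrow> complex \<Rightarrow> complex" where
  "gen_bessel_integrand z w x s =
     Gamma ((s - z) / 2) * Gamma ((s + z) / 2) *
     hyp1F1 ((s - z) / 2) (1 / 2) (- (w\<^sup>2 / 4)) *
     hyp1F1 ((s + z) / 2) (1 / 2) (- (w\<^sup>2 / 4)) *
     2 powr (s - 2) * of_real x powr (- s)"

text \<open>
  The integral of \<open>f\<close> over the upward vertical line with real part \<open>c\<close>, parametrised by
  \<open>s = c + i t\<close>, so that \<open>ds = i dt\<close>.
\<close>

definition has_vertical_integral :: "(complex \<Rightarrow> complex) \<Rightarrow> real \<Rightarrow> complex \<Rightarrow> bool" where
  "has_vertical_integral f c I \<longleftrightarrow>
     has_bochner_integral lborel (\<lambda>t. f (Complex c t) * \<i>) I"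

text \<open>
  The integral does not depend on the abscissa; \<open>gen_bessel_K z w x\<close> is the common value for
  all admissible ones. It is meant for \<open>x > 0\<close>.
\<close>

definition gen_bessel_K :: "complex \<Rightarrow> complex \<Rightarrow> real \<Rightarrow> complex" where
  "gen_bessel_K z w x = (THE v. \<forall>c > \<bar>Re z\<bar>.
     \<exists>I. has_vertical_integral (gen_bessel_integrand z w x) c I \<and> v = 1 / (2 * pi * \<i>) * I)"

definition rhs_expr :: "real \<Rightarrow> real \<Rightarrow> complex \<Rightarrow> complex \<Rightarrow> complex" where
  "rhs_expr a b w z =
     1 / 4 * Gamma (z / 2) * riemann_zeta z *
       (of_real b powr ((1 - z) / 2) * hyp1F1 ((1 - z) / 2) (1 / 2) (w\<^sup>2 / 4)
        - of_real a powr ((1 - z) / 2) * hyp1F1 ((1 - z) / 2) (1 / 2) (- (w\<^sup>2 / 4))) +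
     1 / 4 * Gamma (- (z / 2)) * riemann_zeta (- z) *
       (of_real b powr ((1 + z) / 2) * hyp1F1 ((1 + z) / 2) (1 / 2) (w\<^sup>2 / 4)
        - of_real a powr ((1 + z) / 2) * hyp1F1 ((1 + z) / 2) (1 / 2) (- (w\<^sup>2 / 4)))"

text \<open>
  The points where a factor of \<open>rhs_expr\<close> has a pole. There the total functions \<open>Gamma\<close> and
  \<open>riemann_zeta\<close> return junk values, so the value of \<open>rhs_expr\<close> has to be replaced by its limit.
\<close>

definition rhs_singular_points :: "complex set" where
  "rhs_singular_points = {1, -1} \<union> range (\<lambda>k::int. 2 * of_int k)"

end

theory Submission
  imports Defs "HOL-Probability.Probability"
begin

text \<open>
  Put \<open>\<phi>\<^sub>w(t) = exp(-t\<^sup>2) cos(wt)\<close>, a Gaussian with an oscillating factor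
  (\<open>gauss_cos\<close>). Its Mellin transform is
  \<open>\<Gamma>(s/2) \<^sub>1F\<^sub>1(s/2; 1/2; -w\<^sup>2/4) / 2\<close>, so the integrand of the generalized Bessel function is a product
  of two Mellin transforms, and Mellin inversion turns \<open>K\<close> into a multiplicative convolution:
  \<open>K\<^sub>z\<^sub>,\<^sub>w(2y)\<close> is \<open>y\<^sup>-\<^sup>z\<close> times the integral of \<open>\<phi>\<^sub>w(t) \<phi>\<^sub>w(y/t) t\<^sup>2\<^sup>z\<close> against \<open>dt/t\<close> over the half-line
  (\<open>gen_bessel_K_eq\<close>). With \<open>y = nb\<close> and \<open>n = de\<close>, the weight \<open>\<sigma>\<^sub>-\<^sub>z(n) n\<^sup>z\<^sup>/\<^sup>2\<close> is exactly what makes the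
  sum over \<open>n\<close> factor: writing \<open>\<Psi>\<^sub>w(t)\<close> for the sum of \<open>\<phi>\<^sub>w(nt)\<close> over \<open>n \<ge> 1\<close>
  (\<open>theta_sum\<close>), the series becomes the
  integral of \<open>\<Psi>\<^sub>w(\<surd>b t) \<Psi>\<^sub>w(\<surd>b/t) t\<^sup>z\<close> against \<open>dt/t\<close> (\<open>divisor_sum_integral\<close>).

  Poisson summation gives \<open>1 + 2\<Psi>\<^sub>w(t) = (\<surd>\<pi>/t) exp(-w\<^sup>2/4) (1 + 2\<Psi>\<^sub>i\<^sub>w(\<pi>/t))\<close> (\<open>theta_sum_transform\<close>).
  As \<open>ab = \<pi>\<^sup>2\<close>, it carries the product of \<open>1 + 2\<Psi>\<^sub>w\<close> at \<open>\<surd>b t\<close> and at \<open>\<surd>b/t\<close> to the corresponding product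
  for \<open>a\<close> and \<open>iw\<close>; with the weights \<open>\<surd>b exp(w\<^sup>2/4)\<close> and \<open>\<surd>a exp(-w\<^sup>2/4)\<close> the two products agree.
  Hence in the difference of the two series the quadratic terms in \<open>\<Psi>\<close> can be traded for linear ones,
  and four times the difference is \<open>G(z) + G(-z)\<close>, where \<open>G\<close> is the Mellin transform of
  \<open>h(t) = \<surd>b exp(w\<^sup>2/4) (1 + 2\<Psi>\<^sub>w(\<surd>b t)) - \<surd>a exp(-w\<^sup>2/4) (1 + 2\<Psi>\<^sub>i\<^sub>w(\<surd>a t))\<close> with its limit
  \<open>C\<close> at infinity subtracted for \<open>t \<ge> 1\<close> (\<open>gap_mellin_symmetrized\<close>). By Poisson summation again the
  leading terms of \<open>h\<close> at \<open>0\<close> cancel, so the corrected \<open>h\<close> decays faster than every power at both ends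
  and \<open>G\<close> is entire.

  For \<open>Re z > 1\<close>, integrating \<open>\<Psi>\<close> term by term produces \<open>\<zeta>(z)\<close>, and Kummer's transformation brings the
  result to the form \<open>G(z) = \<Gamma>(z/2) \<zeta>(z) {\<dots>} + C/z\<close>, with the first bracket of the right-hand side
  (\<open>gap_mellin_half_plane\<close>). Multiplied by \<open>1/\<Gamma>(z/2)\<close> both sides are holomorphic away from \<open>1\<close>, so
  the identity theorem extends this to all regular \<open>z\<close>. In \<open>G(z) + G(-z)\<close> the terms \<open>C/z\<close> cancel, and what
  remains is four times the right-hand side. At a singular point the value is the limit because \<open>G\<close> is
  continuous.

  The same method with \<open>w = 0\<close> and without cancellation yields the continuation of \<open>\<zeta>\<close> itself. All integrals
  over the half-line are taken in the variable \<open>v = ln t\<close>, where \<open>dt/t\<close> is Lebesgue measure and scalings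
  are translations.
\<close>

section \<open>Entire Laplace transforms\<close>

text \<open>
  In the variable \<open>v = ln t\<close> this says that a function of \<open>t\<close> decays faster than every power of
  \<open>t\<close> at \<open>0\<close> and at infinity, which is what convergence of its Mellin transform at every point requires.
\<close>

definition superexp_decay :: "(real \<Rightarrow> complex) \<Rightarrow> bool" where
  "superexp_decay f \<longleftrightarrow> f \<in> borel_measurable borel \<and>
     (\<forall>R\<ge>0. \<exists>C. \<forall>v. norm (f v) \<le> C * exp (- R * \<bar>v\<bar>))"

lemma integrable_exp_minus_abs:
  assumes "0 < (r::real)"
  shows "integrable lborel (\<lambda>v::real. exp (- r * \<bar>v\<bar>))"
proof -
  have 1: "integrable lborel (\<lambda>x. indicator {0<..} x *\<^sub>R exp (-(x * r)))"
    using integrable_I0i_exp_mscale[OF assms] by (simp add: set_integrable_def)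
  have 2: "integrable lborel (\<lambda>x. indicator {0<..} (-x) *\<^sub>R exp (-(-x * r)))"
    using lborel_integrable_real_affine[OF 1, of "-1" 0] by simp
  have "integrable lborel (\<lambda>x. indicator {0<..} x *\<^sub>R exp (-(x * r)) + indicator {0<..} (-x) *\<^sub>R exp (-(-x * r)))"
    by (rule Bochner_Integration.integrable_add[OF 1 2])
  moreover have "AE x in lborel. indicator {0<..} x *\<^sub>R exp (-(x * r)) + indicator {0<..} (-x) *\<^sub>R exp (-(-x * r)) = exp (- r * \<bar>x\<bar>)"
    by (rule AE_mp[OF AE_lborel_singleton[of 0]]) (auto simp: indicator_def abs_if mult_ac)
  ultimately show ?thesis
    by (subst (asm) integrable_cong_AE) auto
qed

lemma superexp_decay_integrable:
  assumes f: "superexp_decay f"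
  shows "integrable lborel (\<lambda>v. f v * exp (z * of_real v))"
    and "integrable lborel (\<lambda>v. norm (f v) * exp (R * \<bar>v\<bar>))"
proof -
  have [measurable]: "f \<in> borel_measurable borel" using f by (simp add: superexp_decay_def)
  have *: "integrable lborel (\<lambda>v. norm (f v) * exp (R * \<bar>v\<bar>))" for R
  proof -
    obtain C where C: "\<And>v. norm (f v) \<le> C * exp (- (\<bar>R\<bar> + 1) * \<bar>v\<bar>)"
      using f unfolding superexp_decay_def by (metis abs_ge_zero add_nonneg_nonneg zero_le_one)
    have C0: "C \<ge> 0" using order_trans[OF norm_ge_zero C[of 0]] by simp
    show ?thesis
    proof (rule Bochner_Integration.integrable_bound[where f="\<lambda>v. C * exp (- 1 * \<bar>v\<bar>)"])
      show "integrable lborel (\<lambda>v. C * exp (- 1 * \<bar>v\<bar>))"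
        by (intro integrable_mult_right integrable_exp_minus_abs) auto
      show "AE v in lborel. norm (norm (f v) * exp (R * \<bar>v\<bar>)) \<le> norm (C * exp (- 1 * \<bar>v\<bar>))"
      proof (rule AE_I2)
        fix v
        have "norm (f v) * exp (R * \<bar>v\<bar>) \<le> C * exp (- (\<bar>R\<bar> + 1) * \<bar>v\<bar>) * exp (\<bar>R\<bar> * \<bar>v\<bar>)"
          using C[of v] C0 by (intro mult_mono) (auto intro: mult_right_mono)
        also have "\<dots> = C * exp (- 1 * \<bar>v\<bar>)"
          by (simp add: mult.assoc flip: exp_add) (simp add: algebra_simps)
        finally show "norm (norm (f v) * exp (R * \<bar>v\<bar>)) \<le> norm (C * exp (- 1 * \<bar>v\<bar>))"
          using C0 by simp
      qed
    qed auto
  qed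
  show "integrable lborel (\<lambda>v. norm (f v) * exp (R * \<bar>v\<bar>))" by (rule *)
  show "integrable lborel (\<lambda>v. f v * exp (z * of_real v))"
  proof (rule Bochner_Integration.integrable_bound[OF *[of "norm z"]])
    show "AE v in lborel. norm (f v * exp (z * of_real v)) \<le> norm (norm (f v) * exp (norm z * \<bar>v\<bar>))"
    proof (rule AE_I2)
      fix v :: real
      have "norm (exp (z * of_real v)) \<le> exp (norm (z * of_real v))" by (rule norm_exp)
      thus "norm (f v * exp (z * of_real v)) \<le> norm (norm (f v) * exp (norm z * \<bar>v\<bar>))"
        by (simp add: norm_mult mult_left_mono)
    qed
  qed auto
qed

text \<open>
  Expanding the exponential and integrating term by term gives an everywhere convergent power series
  in \<open>z\<close>; the exchange is dominated by \<open>|f v| exp(|z| |v|)\<close>.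
\<close>

lemma superexp_decay_laplace_entire:
  assumes f: "superexp_decay f"
  shows "(\<lambda>z. LINT v|lborel. f v * exp (z * of_real v)) holomorphic_on A"
proof -
  have [measurable]: "f \<in> borel_measurable borel" using f by (simp add: superexp_decay_def)
  have sums: "(\<lambda>n. (LINT v|lborel. f v * (of_real v ^ n / fact n)) * (z - 0) ^ n) sums
                (LINT v|lborel. f v * exp (z * of_real v))" for z
  proof -
    let ?F = "\<lambda>n v. f v * (of_real v ^ n / fact n) * z ^ n"
    have exp_sums: "(\<lambda>n. r ^ n / fact n) sums exp r" for r :: real
      using exp_converges[of r] by (simp add: scaleR_conv_of_real field_simps)
    have nrm: "norm (?F n v) = norm (f v) * ((norm z * \<bar>v\<bar>) ^ n / fact n)" for n v
      by (simp add: norm_mult norm_divide norm_power power_mult_distrib)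
    have le: "(norm z * \<bar>v\<bar>) ^ n / fact n \<le> exp (norm z * \<bar>v\<bar>)" for n and v :: real
    proof -
      have "(\<Sum>k\<in>{n}. (norm z * \<bar>v\<bar>) ^ k / fact k) \<le> (\<Sum>k. (norm z * \<bar>v\<bar>) ^ k / fact k)"
        using exp_sums[of "norm z * \<bar>v\<bar>"] by (intro sum_le_suminf) (auto simp: sums_iff)
      also have "\<dots> = exp (norm z * \<bar>v\<bar>)" using exp_sums[of "norm z * \<bar>v\<bar>"] by (simp add: sums_iff)
      finally show ?thesis by simp
    qed
    have int: "integrable lborel (?F n)" for n
    proof (rule Bochner_Integration.integrable_bound[OF superexp_decay_integrable(2)[OF f, of "norm z"]])
      show "AE v in lborel. norm (?F n v) \<le> norm (norm (f v) * exp (norm z * \<bar>v\<bar>))"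
      proof (rule AE_I2)
        fix v
        have "norm (?F n v) \<le> norm (f v) * exp (norm z * \<bar>v\<bar>)"
          unfolding nrm by (intro mult_left_mono le) auto
        thus "norm (?F n v) \<le> norm (norm (f v) * exp (norm z * \<bar>v\<bar>))" by simp
      qed
    qed auto
    have "(\<lambda>n. integral\<^sup>L lborel (?F n)) sums (LINT v|lborel. (\<Sum>n. ?F n v))"
    proof (rule sums_integral[OF int])
      show "AE v in lborel. summable (\<lambda>n. norm (?F n v))"
        unfolding nrm using exp_sums by (intro AE_I2 summable_mult) (auto simp: sums_iff)
      show "summable (\<lambda>n. LINT v|lborel. norm (?F n v))"
      proof (rule summableI_nonneg_bounded[where x = "LINT v|lborel. norm (f v) * exp (norm z * \<bar>v\<bar>)"])
        fix N
        have "(\<Sum>n<N. LINT v|lborel. norm (?F n v)) = (LINT v|lborel. (\<Sum>n<N. norm (?F n v)))"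
          using int by (subst Bochner_Integration.integral_sum) auto
        also have "\<dots> \<le> (LINT v|lborel. norm (f v) * exp (norm z * \<bar>v\<bar>))"
        proof (rule integral_mono)
          show "integrable lborel (\<lambda>v. \<Sum>n<N. norm (?F n v))" using int by auto
          show "integrable lborel (\<lambda>v. norm (f v) * exp (norm z * \<bar>v\<bar>))"
            by (rule superexp_decay_integrable(2)[OF f])
          fix v
          have "(\<Sum>n<N. norm (?F n v)) = norm (f v) * (\<Sum>n<N. (norm z * \<bar>v\<bar>) ^ n / fact n)"
            unfolding nrm by (simp add: sum_distrib_left)
          also have "(\<Sum>n<N. (norm z * \<bar>v\<bar>) ^ n / fact n) \<le> (\<Sum>n. (norm z * \<bar>v\<bar>) ^ n / fact n)"
            using exp_sums[of "norm z * \<bar>v\<bar>"] by (intro sum_le_suminf) (auto simp: sums_iff)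
          also have "\<dots> = exp (norm z * \<bar>v\<bar>)" using exp_sums[of "norm z * \<bar>v\<bar>"] by (simp add: sums_iff)
          finally show "(\<Sum>n<N. norm (?F n v)) \<le> norm (f v) * exp (norm z * \<bar>v\<bar>)"
            by (simp add: mult_left_mono)
        qed
        finally show "(\<Sum>n<N. LINT v|lborel. norm (?F n v)) \<le> (LINT v|lborel. norm (f v) * exp (norm z * \<bar>v\<bar>))" .
      qed auto
    qed
    moreover have "(\<Sum>n. ?F n v) = f v * exp (z * of_real v)" for v
    proof -
      have "(\<lambda>n. f v * ((z * of_real v) ^ n / fact n)) sums (f v * exp (z * of_real v))"
        using exp_converges[of "z * of_real v"] by (intro sums_mult) (simp add: scaleR_conv_of_real field_simps)
      thus ?thesis by (simp add: sums_iff power_mult_distrib mult_ac)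
    qed
    moreover have "integral\<^sup>L lborel (?F n) = (LINT v|lborel. f v * (of_real v ^ n / fact n)) * (z - 0) ^ n" for n
      by simp
    ultimately show ?thesis by simp
  qed
  have "(\<lambda>z. LINT v|lborel. f v * exp (z * of_real v)) holomorphic_on ball 0 (norm w + 1)" for w :: complex
    using sums by (rule power_series_holomorphic)
  hence "(\<lambda>z. LINT v|lborel. f v * exp (z * of_real v)) field_differentiable at w" for w
    using holomorphic_on_imp_differentiable_at[of _ "ball 0 (norm w + 1)" w] by simp
  thus ?thesis
    using field_differentiable_at_within by (auto simp: holomorphic_on_def)
qed

section \<open>Confluent hypergeometric series with lower parameter one half\<close>

text \<open>
  The quotient of consecutive terms is \<open>O(1/n)\<close>.
\<close>

lemma hyp1F1_half_summable:
  fixes a u :: "'a :: {real_normed_field, banach}"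
  shows "summable (\<lambda>n. norm (pochhammer a n * u ^ n / (pochhammer (1/2) n * fact n)))"
proof -
  define T where "T = (\<lambda>n. pochhammer a n * u ^ n / (pochhammer (1/2) n * fact n) :: 'a)"
  have rec: "T (Suc n) = T n * ((a + of_nat n) * u / ((1/2 + of_nat n) * of_nat (Suc n)))" for n
    by (simp add: T_def pochhammer_Suc field_simps)
  \<comment> \<open>From this index on, the quotient of consecutive terms is at most \<open>1/2\<close>.\<close>
  obtain N where N: "real N \<ge> 8 * (norm a + 1) * norm u" using real_arch_simple by blast
  have "norm (norm (T (Suc n))) \<le> 1/2 * norm (norm (T n))" if n: "n \<ge> Suc N" for n
  proof -
    have n1: "real n \<ge> 1" using n by simp
    have "norm (1/2 + of_nat n :: 'a) = 1/2 + real n"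
    proof -
      have "(1/2 + of_nat n :: 'a) = of_real (1/2 + real n)" by simp
      hence "norm (1/2 + of_nat n :: 'a) = \<bar>1/2 + real n\<bar>" by (metis norm_of_real)
      thus ?thesis by simp
    qed
    hence eq: "norm (T (Suc n)) = norm (T n) * (norm (a + of_nat n) * norm u / ((1/2 + real n) * real (Suc n)))"
      by (simp add: rec norm_mult norm_divide del: of_nat_Suc)
    have "norm (a + of_nat n) \<le> norm a + real n" by (metis norm_triangle_ineq norm_of_nat)
    also have "\<dots> \<le> (norm a + 1) * (1/2 + real n)  * 2"
    proof -
      have "(norm a + 1) * (1/2 + real n) * 2 = norm a + 1 + 2 * (norm a * real n) + 2 * real n"
        by (simp add: algebra_simps)
      thus ?thesis using n1 mult_nonneg_nonneg[of "norm a" "real n"] norm_ge_zero[of a] by linarith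
    qed
    finally have "norm (a + of_nat n) * norm u \<le> (norm a + 1) * (1/2 + real n) * 2 * norm u"
      by (rule mult_right_mono) auto
    also have "\<dots> = (1/2 + real n) * (8 * (norm a + 1) * norm u) / 4" by simp
    also have "\<dots> \<le> (1/2 + real n) * real (Suc n) / 4"
      using N n by (intro divide_right_mono mult_left_mono) auto
    finally have "norm (a + of_nat n) * norm u / ((1/2 + real n) * real (Suc n)) \<le> 1/4"
      by (simp add: divide_simps mult_ac)
    hence "norm (a + of_nat n) * norm u / ((1/2 + real n) * real (Suc n)) \<le> 1/2" by linarith
    hence "norm (T (Suc n)) \<le> norm (T n) * (1/2)" unfolding eq by (rule mult_left_mono) simp
    thus ?thesis by simp
  qed
  hence "summable (\<lambda>n. norm (T n))" by (intro summable_ratio_test[of "1/2" "Suc N"]) auto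
  thus ?thesis by (simp add: T_def)
qed

lemma norm_pochhammer_le:
  fixes a :: "'a :: real_normed_field"
  assumes "norm a \<le> R"
  shows "norm (pochhammer a n) \<le> pochhammer R n"
proof -
  have R0: "0 \<le> R" using assms norm_ge_zero order_trans by blast
  have "norm (a + of_nat i) \<le> R + real i" for i
    using norm_triangle_ineq[of a "of_nat i"] assms by simp
  thus ?thesis unfolding pochhammer_prod prod_norm[symmetric]
    by (intro prod_mono) auto
qed

lemma norm_pochhammer_half: "norm (pochhammer (1/2) n :: complex) = pochhammer (1/2) n"
proof -
  have "(pochhammer (1/2) n :: complex) = of_real (pochhammer (1/2) n)"
    unfolding pochhammer_of_real[symmetric] by simp
  thus ?thesis using pochhammer_pos[of "1/2::real" n] by (metis abs_of_pos norm_of_real half_gt_zero_iff zero_less_one)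
qed

lemma hyp1F1_half_sums:
  "(\<lambda>n. pochhammer a n * u ^ n / (pochhammer (1/2) n * fact n)) sums hyp1F1 a (1/2) u"
  unfolding hyp1F1_def using summable_norm_cancel[OF hyp1F1_half_summable] by (rule summable_sums)

text \<open>
  The partial sums are polynomials in \<open>a\<close>, and on the unit disc about \<open>x\<close> they are dominated by the
  series with the real parameter \<open>|x| + 1\<close>.
\<close>

lemma hyp1F1_half_holomorphic: "(\<lambda>a. hyp1F1 a (1/2) u) holomorphic_on UNIV"
proof (rule holomorphic_uniform_sequence)
  show "open (UNIV :: complex set)" by simp
  show "(\<lambda>a. \<Sum>n<N. pochhammer a n * u ^ n / (pochhammer (1/2) n * fact n)) holomorphic_on UNIV" for N
    unfolding pochhammer_prod by (intro holomorphic_intros) (auto simp flip: pochhammer_prod, 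
        metis norm_pochhammer_half norm_zero less_irrefl pochhammer_pos half_gt_zero_iff zero_less_one)
  fix x :: complex
  have "uniform_limit (cball x 1) (\<lambda>N a. \<Sum>n<N. pochhammer a n * u ^ n / (pochhammer (1/2) n * fact n))
     (\<lambda>a. hyp1F1 a (1/2) u) sequentially"
    unfolding hyp1F1_def
  proof (rule Weierstrass_m_test)
    fix n and a :: complex assume "a \<in> cball x 1"
    hence "norm a \<le> norm x + 1" 
      by (metis (no_types, opaque_lifting) add.commute diff_le_eq dist_norm mem_cball norm_minus_commute norm_triangle_ineq2 order_trans)
    hence "norm (pochhammer a n) \<le> pochhammer (norm x + 1) n" by (rule norm_pochhammer_le)
    thus "norm (pochhammer a n * u ^ n / (pochhammer (1/2) n * fact n))
       \<le> norm (pochhammer (norm x + 1) n * (norm u) ^ n / (pochhammer (1/2) n * fact n))"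
      using pochhammer_pos[of "1/2::real" n] pochhammer_pos[of "norm x + 1" n]
      by (simp add: norm_mult norm_divide norm_power norm_pochhammer_half divide_right_mono mult_right_mono 
            abs_mult add_nonneg_pos)
  qed (rule hyp1F1_half_summable)
  thus "\<exists>d>0. cball x d \<subseteq> UNIV \<and> uniform_limit (cball x d) (\<lambda>N a. \<Sum>n<N. pochhammer a n * u ^ n / (pochhammer (1/2) n * fact n))
     (\<lambda>a. hyp1F1 a (1/2) u) sequentially" by (intro exI[of _ 1]) auto
qed

text \<open>
  Kummer's transformation for lower parameter \<open>1/2\<close>. The coefficients of the Cauchy product with the
  exponential series are evaluated by the Chu-Vandermonde identity \<open>pochhammer_binomial_sum\<close>, once the
  quotient of \<open>(1/2)\<^sub>n\<close> and \<open>(1/2)\<^sub>k\<close> is reflected into a rising factorial of \<open>1/2 - n\<close>.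
\<close>

lemma kummer_transformation:
  "exp u * hyp1F1 a (1/2) (- u) = hyp1F1 (1/2 - a) (1/2) u"
proof -
  have nz: "pochhammer (1/2) n \<noteq> (0::complex)" for n
    by (metis norm_pochhammer_half norm_zero less_irrefl pochhammer_pos half_gt_zero_iff zero_less_one)
  define A where "A = (\<lambda>n. pochhammer a n * (-u) ^ n / (pochhammer (1/2) n * fact n))"
  define B where "B = (\<lambda>n. u ^ n / fact n :: complex)"
  have Bsum: "B sums exp u" using exp_converges[of u] by (simp add: B_def scaleR_conv_of_real field_simps)
  have "(\<lambda>n. \<Sum>k\<le>n. A k * B (n - k)) sums ((\<Sum>k. A k) * (\<Sum>k. B k))"
  proof (rule Cauchy_product_sums)
    show "summable (\<lambda>k. norm (A k))" unfolding A_def by (rule hyp1F1_half_summable)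
    show "summable (\<lambda>k. norm (B k))" unfolding B_def
      using summable_norm_exp[of u] by (simp add: scaleR_conv_of_real field_simps norm_divide)
  qed
  moreover have "(\<Sum>k\<le>n. A k * B (n - k)) = pochhammer (1/2 - a) n * u ^ n / (pochhammer (1/2) n * fact n)" for n
  proof -
    have refl_half: "pochhammer (- (1/2) - of_nat n + 1 :: complex) (n - k) * pochhammer (1/2) k = (-1)^(n-k) * pochhammer (1/2) n"
      if "k \<le> n" for k
    proof -
      have "pochhammer (1/2 :: complex) n = pochhammer (1/2) k * pochhammer (1/2 + of_nat k) (n - k)"
        using that by (rule pochhammer_product)
      moreover have "pochhammer (- (1/2) - of_nat n + 1 :: complex) (n - k) = (-1)^(n-k) * pochhammer (1/2 + of_nat k) (n - k)"
        using pochhammer_minus'[of "1/2 + of_nat n - 1 :: complex" "n - k"] that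
        by (simp add: of_nat_diff pochhammer_minus algebra_simps)
      ultimately show ?thesis by simp
    qed
    have "pochhammer (1/2 - a) n = (-1)^n * pochhammer (a + (- (1/2) - of_nat n + 1)) n"
      using pochhammer_minus[of "a - 1/2" n] by (simp add: algebra_simps)
    also have "\<dots> = (-1)^n * (\<Sum>k\<le>n. of_nat (n choose k) * pochhammer a k * pochhammer (- (1/2) - of_nat n + 1) (n - k))"
      by (simp only: pochhammer_binomial_sum)
    also have "\<dots> = (\<Sum>k\<le>n. (-1)^k * of_nat (n choose k) * pochhammer a k * pochhammer (1/2) n / pochhammer (1/2) k)"
      unfolding sum_distrib_left
    proof (rule sum.cong[OF refl])
      fix k assume "k \<in> {..n}"
      hence k: "k \<le> n" by simp
      have "pochhammer (- (1/2) - of_nat n + 1 :: complex) (n - k) = (-1)^(n-k) * pochhammer (1/2) n / pochhammer (1/2) k"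
        using refl_half[OF k] nz[of k] by (simp add: field_simps)
      moreover have "(-1)^n * (-1)^(n-k) = ((-1)^k :: complex)"
        using k by (simp add: minus_one_power_iff flip: power_add) 
      ultimately show "(-1)^n * (of_nat (n choose k) * pochhammer a k * pochhammer (- (1/2) - of_nat n + 1) (n - k)) =
         (-1)^k * of_nat (n choose k) * pochhammer a k * pochhammer (1/2) n / pochhammer (1/2) k"
        by (simp add: mult_ac flip: power_add) 
    qed
    finally have 1: "pochhammer (1/2 - a) n = (\<Sum>k\<le>n. (-1)^k * of_nat (n choose k) * pochhammer a k * pochhammer (1/2) n / pochhammer (1/2) k)" .
    show ?thesis
      unfolding 1 sum_distrib_right sum_divide_distrib
    proof (rule sum.cong[OF refl])
      fix k assume "k \<in> {..n}"
      hence k: "k \<le> n" by simp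
      have "(- u) ^ k * u ^ (n - k) = (-1)^k * u ^ n"
        using k by (simp add: power_minus' power_minus[of u k] mult.assoc flip: power_add)
      thus "A k * B (n - k) = (-1)^k * of_nat (n choose k) * pochhammer a k * pochhammer (1/2) n / pochhammer (1/2) k * u ^ n / (pochhammer (1/2) n * fact n)"
        using nz[of n] nz[of k] by (simp add: A_def B_def binomial_fact[OF k] field_simps)
    qed
  qed
  moreover have "(\<Sum>k. A k) = hyp1F1 a (1/2) (- u)" by (simp add: A_def hyp1F1_def)
  moreover have "(\<Sum>k. B k) = exp u" using Bsum by (simp add: sums_iff)
  ultimately show ?thesis by (simp add: sums_iff hyp1F1_def[of "1/2 - a"] mult.commute)
qed

section \<open>The Mellin transform of the Gaussian cosine\<close>

text \<open>
  The parameter \<open>w\<close> is complex, so that \<open>w \<mapsto> iw\<close> turns the cosine into a hyperbolic cosine; Poisson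
  summation exchanges the two.
\<close>

definition gauss_cos :: "complex \<Rightarrow> real \<Rightarrow> complex" where
  "gauss_cos w t = exp (- (of_real t)\<^sup>2) * cos (w * of_real t)"

lemma gauss_cos_measurable [measurable]: "gauss_cos w \<in> borel_measurable borel"
  unfolding gauss_cos_def by (intro borel_measurable_continuous_onI continuous_intros)

text \<open>
  Euler's integral after the substitution \<open>t = exp v\<close>. The change of variables theorem for real
  functions is applied to the real and imaginary parts.
\<close>

lemma has_bochner_integral_Gamma_exp:
  assumes s: "Re s > 0"
  shows "has_bochner_integral lborel (\<lambda>v. of_real (exp (- exp v)) * exp (s * of_real v)) (Gamma s)"
proof -
  define h where "h = (\<lambda>t. complex_of_real t powr (s - 1) / of_real (exp t))"
  define f where "f = (\<lambda>v. of_real (exp (- exp v)) * exp (s * complex_of_real v))"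
  have meas: "f \<in> borel_measurable borel"
    unfolding f_def by (intro borel_measurable_continuous_onI continuous_intros)
  have hf: "exp v *\<^sub>R h (exp v) = f v" for v
  proof -
    have "h (exp v) = exp ((s - 1) * of_real v) * of_real (exp (- exp v))"
      by (simp add: h_def powr_def exp_minus field_simps Ln_of_real)
    also have "exp v *\<^sub>R \<dots> = of_real (exp (- exp v)) * (exp (of_real v) * exp ((s - 1) * of_real v))"
      by (simp add: scaleR_conv_of_real exp_of_real)
    also have "exp (of_real v) * exp ((s - 1) * of_real v) = exp (s * of_real v)"
      by (simp add: algebra_simps flip: exp_add)
    finally show ?thesis by (simp add: f_def)
  qed
  have h_int: "h absolutely_integrable_on {0<..}"
    unfolding h_def by (rule absolutely_integrable_Gamma_integral'[OF s])
  have h_val: "integral {0<..} h = Gamma s"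
    unfolding h_def using Gamma_integral_complex'[OF s] by (rule integral_unique)
  have key: "integrable lborel (\<lambda>v. L (f v)) \<and> (LINT v|lborel. L (f v)) = L (Gamma s)"
    if L: "bounded_linear L" for L :: "complex \<Rightarrow> real"
  proof -
    have "(\<lambda>x. L (h x)) absolutely_integrable_on {0<..}"
      using absolutely_integrable_linear[OF h_int L] by (simp add: o_def)
    moreover have "integral {0<..} (\<lambda>x. L (h x)) = L (Gamma s)"
      using integral_linear[OF _ L, of h "{0<..}"] h_int h_val
      by (simp add: o_def set_lebesgue_integral_eq_integral(1))
    moreover have "exp ` (UNIV::real set) = {0<..}"
      by (auto simp: image_iff) (metis exp_ln)
    ultimately have "(\<lambda>v. \<bar>exp v\<bar> * L (h (exp v))) absolutely_integrable_on UNIV \<and>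
       integral UNIV (\<lambda>v. \<bar>exp v\<bar> * L (h (exp v))) = L (Gamma s)"
      by (subst has_absolute_integral_change_of_variables_1'[where g = exp])
         (auto intro!: derivative_eq_intros simp: inj_on_def)
    moreover have "\<bar>exp v\<bar> * L (h (exp v)) = L (f v)" for v
      using hf[of v] linear_scale[OF bounded_linear.linear[OF L], of "exp v" "h (exp v)"] by simp
    ultimately have *: "(\<lambda>v. L (f v)) absolutely_integrable_on UNIV" "integral UNIV (\<lambda>v. L (f v)) = L (Gamma s)"
      by auto
    have [measurable]: "(\<lambda>v. L (f v)) \<in> borel_measurable borel"
      using meas borel_measurable_continuous_onI[OF linear_continuous_on[OF L]] by simp
    have "integrable lborel (\<lambda>v. L (f v))"
      using *(1) by (simp add: set_integrable_def integrable_completion)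
    thus ?thesis using *(2) integral_lborel by metis
  qed
  have Re: "has_bochner_integral lborel (\<lambda>v. Re (f v)) (Re (Gamma s))"
    using key[OF bounded_linear_Re] by (simp add: has_bochner_integral_iff)
  have Im: "has_bochner_integral lborel (\<lambda>v. Im (f v)) (Im (Gamma s))"
    using key[OF bounded_linear_Im] by (simp add: has_bochner_integral_iff)
  have "has_bochner_integral lborel (\<lambda>v. of_real (Re (f v)) + \<i> * of_real (Im (f v))) 
          (of_real (Re (Gamma s)) + \<i> * of_real (Im (Gamma s)))"
    by (intro has_bochner_integral_add has_bochner_integral_of_real Re has_bochner_integral_mult_right Im)
  hence "has_bochner_integral lborel f (Gamma s)" by (simp only: complex_eq[symmetric])
  thus ?thesis by (simp add: f_def)
qed

lemma has_bochner_integral_Gamma_exp2: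
  assumes s: "Re s > 0"
  shows "has_bochner_integral lborel (\<lambda>v. of_real (exp (- (exp v)\<^sup>2)) * exp (s * of_real v)) (Gamma (s/2) / 2)"
proof -
  have "has_bochner_integral lborel (\<lambda>v. of_real (exp (- exp (0 + 2 * v))) * exp (s/2 * of_real (0 + 2 * v))) (Gamma (s/2) /\<^sub>R \<bar>2\<bar>)"
    using has_bochner_integral_Gamma_exp[of "s/2"] s 
    by (subst lborel_has_bochner_integral_real_affine_iff[of 2 _ _ 0, symmetric]) auto
  moreover have "exp (0 + 2 * v) = (exp v)\<^sup>2" for v :: real by (simp add: exp_double)
  ultimately show ?thesis by (simp add: scaleR_conv_of_real)
qed

lemma norm_Gamma_le:
  assumes s: "Re s > 0"
  shows "norm (Gamma s) \<le> Gamma (Re s)"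
proof -
  have "norm (Gamma s) \<le> (LINT v|lborel. norm (of_real (exp (- exp v)) * exp (s * of_real v)))"
    using has_bochner_integral_Gamma_exp[OF s] integral_norm_bound by (metis has_bochner_integral_integral_eq)
  also have "\<dots> = (LINT v|lborel. norm (of_real (exp (- exp v)) * exp (of_real (Re s) * complex_of_real v)))"
    by (simp add: norm_mult)
  finally have le: "norm (Gamma s) \<le> (LINT v|lborel. norm (of_real (exp (- exp v)) * exp (of_real (Re s) * complex_of_real v)))" .
  have "complex_of_real (LINT v|lborel. norm (of_real (exp (- exp v)) * exp (of_real (Re s) * complex_of_real v)))
     = (LINT v|lborel. of_real (exp (- exp v)) * exp (of_real (Re s) * complex_of_real v))"
    by (subst integral_complex_of_real[symmetric]) (simp add: norm_mult exp_of_real flip: of_real_mult)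
  also have "\<dots> = complex_of_real (Gamma (Re s))"
    using has_bochner_integral_Gamma_exp[of "of_real (Re s)"] s
    by (simp add: has_bochner_integral_iff Gamma_complex_of_real)
  finally show ?thesis using le by (simp only: of_real_eq_iff)
qed

lemma Re_pos_not_nonpos_Int: "Re s > 0 \<Longrightarrow> s \<notin> \<int>\<^sub>\<le>\<^sub>0"
  by (auto elim!: nonpos_Ints_cases)

text \<open>
  The closed form of the Mellin transform of \<open>gauss_cos w\<close>, and half of one factor of the integrand in
  \<open>gen_bessel_K\<close>.
\<close>

definition mellin_gauss_cos :: "complex \<Rightarrow> complex \<Rightarrow> complex" where
  "mellin_gauss_cos w s = Gamma (s / 2) * hyp1F1 (s / 2) (1 / 2) (- (w\<^sup>2 / 4)) / 2"

lemma mellin_gauss_cos_sums: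
  assumes s: "Re s > 0"
  shows "(\<lambda>n. Gamma (s/2 + of_nat n) * (- (w\<^sup>2 / 4)) ^ n / (pochhammer (1/2) n * fact n) / 2) sums mellin_gauss_cos w s"
proof -
  have "(\<lambda>n. Gamma (s/2) * (pochhammer (s/2) n * (- (w\<^sup>2 / 4)) ^ n / (pochhammer (1/2) n * fact n)) / 2) sums mellin_gauss_cos w s"
    unfolding mellin_gauss_cos_def by (intro sums_divide sums_mult hyp1F1_half_sums)
  moreover have "Gamma (s/2) * pochhammer (s/2) n = Gamma (s/2 + of_nat n)" for n
    using pochhammer_Gamma[of "s/2" n] Re_pos_not_nonpos_Int[of "s/2"] s Gamma_eq_zero_iff[of "s/2"] by simp
  ultimately show ?thesis by (simp add: mult_ac flip: mult.assoc)
qed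

lemma Gamma_series_summable:
  fixes c :: real and u :: complex
  assumes c: "c > 0"
  shows "summable (\<lambda>n. Gamma (c + real n) * norm u ^ n / (pochhammer (1/2) n * fact n))"
proof -
  have "summable (\<lambda>n. Gamma c * norm (pochhammer c n * norm u ^ n / (pochhammer (1/2) n * fact n)))"
    by (intro summable_mult hyp1F1_half_summable)
  moreover have "Gamma c * norm (pochhammer c n * norm u ^ n / (pochhammer (1/2) n * fact n)) =
      Gamma (c + real n) * norm u ^ n / (pochhammer (1/2) n * fact n)" for n
  proof -
    have "c \<notin> \<int>\<^sub>\<le>\<^sub>0" using c by (auto elim!: nonpos_Ints_cases)
    hence "Gamma c * pochhammer c n = Gamma (c + real n)"
      using pochhammer_Gamma[of c n] Gamma_eq_zero_iff[of c] by simp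
    moreover have "norm (pochhammer c n * norm u ^ n / (pochhammer (1/2) n * fact n)) = pochhammer c n * norm u ^ n / (pochhammer (1/2) n * fact n)"
      using pochhammer_pos[of c n] pochhammer_pos[of "1/2::real" n] c by (simp add: abs_mult)
    ultimately show ?thesis by (metis mult.assoc times_divide_eq_right)
  qed
  ultimately show ?thesis by simp
qed

text \<open>
  The cosine is expanded in its power series; each term is a Gamma integral, and
  \<open>(2n)! = 4\<^sup>n n! (1/2)\<^sub>n\<close> produces the hypergeometric coefficients.
\<close>

lemma has_bochner_integral_gauss_cos:
  assumes s: "Re s > 0"
  shows "has_bochner_integral lborel (\<lambda>v. gauss_cos w (exp v) * exp (s * of_real v)) (mellin_gauss_cos w s)"
proof -
  define u where "u = - (w\<^sup>2 / 4)"
  define c where "c = (\<lambda>n. u ^ n / (pochhammer (1/2) n * fact n))"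
  define G where "G = (\<lambda>n v. of_real (exp (- (exp v)\<^sup>2)) * exp ((s + 2 * of_nat n) * complex_of_real v))"
  define F where "F = (\<lambda>n v. c n * G n v)"
  have G: "has_bochner_integral lborel (G n) (Gamma (s/2 + of_nat n) / 2)" for n
    using has_bochner_integral_Gamma_exp2[of "s + 2 * of_nat n"] s by (simp add: G_def add_divide_distrib)
  have F: "has_bochner_integral lborel (F n) (c n * (Gamma (s/2 + of_nat n) / 2))" for n
    unfolding F_def by (intro has_bochner_integral_mult_right G)
  hence Fint: "integrable lborel (F n)" for n by (simp add: has_bochner_integral_iff)
  have nG: "has_bochner_integral lborel (\<lambda>v. norm (G n v)) (Gamma (Re s/2 + real n) / 2)" for n
  proof -
    have "has_bochner_integral lborel (\<lambda>v. of_real (exp (- (exp v)\<^sup>2)) * exp ((of_real (Re s) + 2 * of_nat n) * complex_of_real v)) (Gamma (of_real (Re s)/2 + of_nat n) / 2)"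
      using has_bochner_integral_Gamma_exp2[of "of_real (Re s) + 2 * of_nat n"] s by (simp add: add_divide_distrib)
    moreover have "of_real (exp (- (exp v)\<^sup>2)) * exp ((of_real (Re s) + 2 * of_nat n) * complex_of_real v) = of_real (norm (G n v))" for v
      by (simp add: G_def norm_mult exp_of_real[symmetric])
    moreover have "Gamma (of_real (Re s)/2 + of_nat n) / 2 = complex_of_real (Gamma (Re s/2 + real n) / 2)"
      by (simp flip: Gamma_complex_of_real)
    ultimately have "has_bochner_integral lborel (\<lambda>v. Re (of_real (norm (G n v)))) (Re (of_real (Gamma (Re s/2 + real n) / 2)))"
      by (simp only: has_bochner_integral_Re)
    thus ?thesis by simp
  qed
  have cexp: "(\<lambda>n. c n * exp (2 * of_nat n * of_real v)) sums cos (w * of_real (exp v))" for v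
  proof -
    have "(\<lambda>n. ((-1) ^ n / fact (2 * n)) *\<^sub>R (w * of_real (exp v)) ^ (2 * n)) sums cos (w * of_real (exp v))"
      using cos_converges[of "w * of_real (exp v)"]
      by (subst (asm) sums_mono_reindex[of "\<lambda>n. 2*n", symmetric]) (auto simp: strict_mono_def cos_coeff_def elim!: evenE)
    moreover have "((-1) ^ n / fact (2 * n)) *\<^sub>R (w * of_real (exp v)) ^ (2 * n) = c n * exp (2 * of_nat n * of_real v)" for n
    proof -
      have "exp (2 * of_nat n * complex_of_real v) = (of_real (exp v) ^ 2) ^ n"
        using exp_of_nat_mult[of "2 * n" "complex_of_real v"] by (simp add: exp_of_real power_mult)
      moreover have "fact (2 * n) = (2 ^ (2 * n) * pochhammer (1 / 2) n * fact n :: complex)"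
        by (rule fact_double)
      moreover have "u ^ n = (-1)^n * w^(2*n) / 2^(2*n)"
        by (simp add: u_def power_mult power_minus' power_divide)
      ultimately show ?thesis
        by (simp add: c_def scaleR_conv_of_real power_mult_distrib power_mult mult.assoc)
    qed
    ultimately show ?thesis by simp
  qed
  have pt: "(\<Sum>n. F n v) = gauss_cos w (exp v) * exp (s * of_real v)" for v
  proof -
    have "(\<lambda>n. (c n * exp (2 * of_nat n * of_real v)) * (of_real (exp (- (exp v)\<^sup>2)) * exp (s * of_real v))) sums
        (cos (w * of_real (exp v)) * (of_real (exp (- (exp v)\<^sup>2)) * exp (s * of_real v)))"
      by (intro sums_mult2 cexp)
    also have "(\<lambda>n. (c n * exp (2 * of_nat n * of_real v)) * (of_real (exp (- (exp v)\<^sup>2)) * exp (s * of_real v))) = (\<lambda>n. F n v)"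
      by (simp add: F_def G_def mult_ac ring_distribs exp_add)
    finally show ?thesis by (simp add: sums_iff gauss_cos_def mult_ac flip: exp_of_real)
  qed
  have nc: "norm (c n) = norm u ^ n / (pochhammer (1/2) n * fact n)" for n
    by (simp add: c_def norm_divide norm_mult norm_power norm_pochhammer_half)
  have sm: "AE v in lborel. summable (\<lambda>n. norm (F n v))"
  proof (rule AE_I2)
    fix v :: real
    let ?V = "norm (of_real (exp (- (exp v)\<^sup>2)) * exp (s * of_real v))" and ?U = "\<lambda>n. norm (u ^ n * (exp (2 * of_real v)) ^ n / (pochhammer (1/2) n ))"
    have "summable (\<lambda>n. norm (pochhammer 1 n * (u * exp (2 * of_real v)) ^ n / (pochhammer (1/2) n * fact n)) 
             * ?V)"
      by (intro summable_mult2 hyp1F1_half_summable)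
    hence "summable (\<lambda>n. ?U n * ?V)"
      by (simp add: power_mult_distrib flip: pochhammer_fact)
    thus "summable (\<lambda>n. norm (F n v))"
    proof (rule summable_comparison_test'[where N = 0])
      fix n :: nat
      have "norm (F n v) = ?U n * ?V / fact n"
      proof -
        have "exp ((s + 2 * of_nat n) * complex_of_real v) = exp (s * of_real v) * exp (2 * of_real v) ^ n"
          by (simp add: ring_distribs exp_add flip: exp_of_nat_mult) (simp add: mult_ac)
        thus ?thesis by (simp add: F_def G_def c_def norm_mult norm_divide)
      qed
      also have "\<dots> \<le> ?U n * ?V / 1"
        by (rule divide_left_mono) (auto simp: fact_ge_1)
      finally show "norm (norm (F n v)) \<le> ?U n * ?V" by simp
    qed
  qed
  have si: "summable (\<lambda>n. LINT v|lborel. norm (F n v))"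
  proof -
    have "(LINT v|lborel. norm (F n v)) = Gamma (Re s/2 + real n) * norm u ^ n / (pochhammer (1/2) n * fact n) / 2" for n
    proof -
      have "(LINT v|lborel. norm (F n v)) = norm (c n) * (LINT v|lborel. norm (G n v))"
        by (simp add: F_def norm_mult)
      thus ?thesis unfolding nc has_bochner_integral_integral_eq[OF nG[of n]] by simp
    qed
    thus ?thesis using s by (simp only:) (intro summable_divide Gamma_series_summable, simp)
  qed
  have "integrable lborel (\<lambda>v. gauss_cos w (exp v) * exp (s * of_real v))"
    using integrable_suminf[OF Fint sm si] by (simp add: pt)
  moreover have "(LINT v|lborel. gauss_cos w (exp v) * exp (s * of_real v)) = mellin_gauss_cos w s"
  proof -
    have "(\<lambda>n. c n * (Gamma (s/2 + of_nat n) / 2)) sums (LINT v|lborel. gauss_cos w (exp v) * exp (s * of_real v))"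
      using sums_integral[OF Fint sm si] unfolding pt has_bochner_integral_integral_eq[OF F] .
    moreover have "(\<lambda>n. c n * (Gamma (s/2 + of_nat n) / 2)) sums mellin_gauss_cos w s"
      using mellin_gauss_cos_sums[OF s, of w] by (simp add: c_def u_def mult.commute)
    ultimately show ?thesis by (rule sums_unique2)
  qed
  ultimately show ?thesis by (simp add: has_bochner_integral_iff)
qed

text \<open>
  This makes the transform integrable along vertical lines, as Fourier inversion requires. The decay
  comes from every single term of the series: \<open>\<Gamma>(x) = \<Gamma>(x + 2) / (x (x + 1))\<close> with \<open>|\<Gamma>(x + 2)| \<le> \<Gamma>(Re x + 2)\<close>.
\<close>

lemma mellin_gauss_cos_bound:
  assumes c: "c > 0"
  obtains C where "C \<ge> 0" "\<And>s. Re s = c \<Longrightarrow> norm (mellin_gauss_cos w s) \<le> C / (norm s)\<^sup>2"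
proof -
  define u where "u = - (w\<^sup>2 / 4)"
  define g where "g = (\<lambda>n. Gamma (c/2 + 2 + real n) * norm u ^ n / (pochhammer (1/2) n * fact n))"
  define B where "B = (\<Sum>n. g n)"
  have sB: "summable g"
    unfolding g_def using c by (intro Gamma_series_summable) simp
  have pos: "g n \<ge> 0" for n
    using c pochhammer_pos[of "1/2::real" n] Gamma_real_pos[of "c/2 + 2 + real n"] by (simp add: g_def)
  have B0: "B \<ge> 0" unfolding B_def using sB pos by (rule suminf_nonneg)
  have "norm (mellin_gauss_cos w s) \<le> 2 * B / (norm s)\<^sup>2" if s: "Re s = c" for s
  proof -
    define a where "a = (\<lambda>n. Gamma (s/2 + of_nat n) * u ^ n / (pochhammer (1/2) n * fact n) / 2)"
    have a: "a sums mellin_gauss_cos w s" unfolding a_def u_def using c s by (intro mellin_gauss_cos_sums) simp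
    have s0: "s \<noteq> 0" using s c by auto
    have bd: "norm (a n) \<le> 2 / (norm s)\<^sup>2 * g n" for n
    proof -
      let ?x = "s/2 + of_nat n"
      have Rex: "Re ?x > 0" using s c by (simp add: add_pos_nonneg)
      have cm: "norm (s/2) \<le> norm (s/2 + of_nat m)" for m
        unfolding cmod_def using s c by (intro real_sqrt_le_mono add_mono) (auto intro: power_mono)
      have "Gamma (?x + 1 + 1) = (?x + 1) * (?x * Gamma ?x)"
        using Gamma_plus1[of "?x + 1"] Gamma_plus1[of "?x"] Re_pos_not_nonpos_Int[of ?x] Re_pos_not_nonpos_Int[of "?x + 1"] Rex
        by (simp add: add_pos_pos)
      hence "norm (Gamma (?x + 1 + 1)) = norm (s/2 + of_nat (Suc n)) * (norm ?x * norm (Gamma ?x))"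
        by (simp add: norm_mult add_ac)
      also have "\<dots> \<ge> norm (s/2) * (norm (s/2) * norm (Gamma ?x))"
        by (intro mult_mono cm) auto
      finally have "norm (s/2) * (norm (s/2) * norm (Gamma ?x)) \<le> norm (Gamma (?x + 1 + 1))" .
      also have "\<dots> \<le> Gamma (Re (?x + 1 + 1))" by (rule norm_Gamma_le) (use Rex in simp)
      also have "Re (?x + 1 + 1) = c/2 + 2 + real n" using s by simp
      finally have "norm (Gamma ?x) \<le> 4 / (norm s)\<^sup>2 * Gamma (c/2 + 2 + real n)"
        using s0 by (simp add: field_simps power2_eq_square norm_divide)
      hence "norm (Gamma ?x) * (norm u ^ n / (pochhammer (1/2) n * fact n) / 2) 
         \<le> 4 / (norm s)\<^sup>2 * Gamma (c/2 + 2 + real n) * (norm u ^ n / (pochhammer (1/2) n * fact n) / 2)"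
        using pochhammer_pos[of "1/2::real" n] by (intro mult_right_mono) auto
      thus ?thesis by (simp add: a_def g_def norm_mult norm_divide norm_power norm_pochhammer_half mult_ac)
    qed
    have sb: "summable (\<lambda>n. 2 / (norm s)\<^sup>2 * g n)"
      by (intro summable_mult sB)
    have "norm (mellin_gauss_cos w s) = norm (\<Sum>n. a n)" using a by (simp add: sums_iff)
    also have "\<dots> \<le> (\<Sum>n. 2 / (norm s)\<^sup>2 * g n)"
      by (rule norm_suminf_le[OF bd sb])
    also have "\<dots> = 2 / (norm s)\<^sup>2 * B" unfolding B_def by (rule suminf_mult[OF sB])
    finally show ?thesis by simp
  qed
  thus ?thesis using B0 by (intro that[of "2*B"]) auto
qed

section \<open>Gaussian integrals and Fourier inversion\<close>

lemma superexp_decay_gaussian: "superexp_decay (\<lambda>v. of_real (exp (- v\<^sup>2)))"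
  unfolding superexp_decay_def
proof (intro conjI allI impI)
  show "(\<lambda>v. complex_of_real (exp (- v\<^sup>2))) \<in> borel_measurable borel" by measurable
  fix R :: real
  have "norm (complex_of_real (exp (- v\<^sup>2))) \<le> exp (R\<^sup>2/4) * exp (- R * \<bar>v\<bar>)" for v
  proof -
    have "0 \<le> (\<bar>v\<bar> - R/2)\<^sup>2" by simp
    hence "- v\<^sup>2 \<le> R\<^sup>2/4 + (- R * \<bar>v\<bar>)" by (simp add: power2_diff power_divide mult.commute)
    thus ?thesis by (simp flip: exp_add)
  qed
  thus "\<exists>C. \<forall>v. norm (complex_of_real (exp (- v\<^sup>2))) \<le> C * exp (- R * \<bar>v\<bar>)" by blast
qed

lemma has_bochner_integral_gaussian_real:
  "has_bochner_integral lborel (\<lambda>v::real. exp (- v\<^sup>2)) (sqrt pi)"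
  using has_bochner_integral_even_function[OF gaussian_moment_0] by simp

text \<open>
  For real \<open>z\<close> one completes the square. Both sides are entire, so they agree everywhere.
\<close>

lemma gaussian_laplace:
  fixes z :: complex
  shows "(LINT v|lborel. of_real (exp (- v\<^sup>2)) * exp (z * of_real v)) = of_real (sqrt pi) * exp (z\<^sup>2 / 4)"
proof -
  define f where "f = (\<lambda>z. (LINT v|lborel. of_real (exp (- v\<^sup>2)) * exp (z * complex_of_real v)) - of_real (sqrt pi) * exp (z\<^sup>2 / 4))"
  have "f z = 0"
  proof (rule analytic_continuation[of f UNIV "range of_real" 0])
    show "f holomorphic_on UNIV"
      unfolding f_def by (intro holomorphic_intros superexp_decay_laplace_entire superexp_decay_gaussian) auto
    show "(0::complex) islimpt range of_real"
      unfolding islimpt_approachable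
    proof (intro allI impI)
      fix e :: real assume "0 < e"
      thus "\<exists>x'\<in>range of_real. x' \<noteq> (0::complex) \<and> dist x' 0 < e"
        by (intro bexI[of _ "of_real (e/2)"] rangeI) auto
    qed
    fix x :: complex assume "x \<in> range of_real"
    then obtain r where r: "x = of_real r" by auto
    have "has_bochner_integral lborel (\<lambda>v. exp (- (- (r/2) + 1 * v)\<^sup>2)) (sqrt pi /\<^sub>R \<bar>1\<bar>)"
      using has_bochner_integral_gaussian_real by (subst lborel_has_bochner_integral_real_affine_iff[symmetric]) auto
    hence "has_bochner_integral lborel (\<lambda>v. exp (r\<^sup>2/4) * exp (- (- (r/2) + 1 * v)\<^sup>2)) (exp (r\<^sup>2/4) * sqrt pi)"
      by (intro has_bochner_integral_mult_right) simp
    also have "(\<lambda>v. exp (r\<^sup>2/4) * exp (- (- (r/2) + 1 * v)\<^sup>2)) = (\<lambda>v. exp (- v\<^sup>2) * exp (r * v))"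
      by (simp add: power2_eq_square algebra_simps flip: exp_add)
    finally have "(LINT v|lborel. complex_of_real (exp (- v\<^sup>2) * exp (r * v))) = of_real (exp (r\<^sup>2/4) * sqrt pi)"
      by (subst integral_complex_of_real) (simp add: has_bochner_integral_iff)
    thus "f x = 0" by (simp add: f_def r exp_of_real[symmetric])
  qed auto
  thus ?thesis by (simp add: f_def)
qed

lemma has_bochner_integral_gaussian:
  fixes c :: complex
  assumes "\<tau> > 0"
  shows "has_bochner_integral lborel (\<lambda>x. of_real (exp (- (\<tau> * x\<^sup>2))) * exp (c * of_real x))
           (of_real (sqrt (pi / \<tau>)) * exp (c\<^sup>2 / (4 * of_real \<tau>)))"
proof -
  have q: "sqrt \<tau> \<noteq> 0" "(sqrt \<tau>)\<^sup>2 = \<tau>" using assms by auto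
  have q': "(complex_of_real (sqrt \<tau>))\<^sup>2 = of_real \<tau>" using q(2) by (metis of_real_power)
  have "has_bochner_integral lborel (\<lambda>v. of_real (exp (- v\<^sup>2)) * exp (c / of_real (sqrt \<tau>) * of_real v)) (of_real (sqrt pi) * exp ((c / of_real (sqrt \<tau>))\<^sup>2 / 4))"
    using gaussian_laplace superexp_decay_integrable(1)[OF superexp_decay_gaussian] unfolding has_bochner_integral_iff by blast
  hence "has_bochner_integral lborel (\<lambda>v. of_real (exp (- (0 + sqrt \<tau> * v)\<^sup>2)) * exp (c / of_real (sqrt \<tau>) * of_real (0 + sqrt \<tau> * v))) ((of_real (sqrt pi) * exp ((c / of_real (sqrt \<tau>))\<^sup>2 / 4)) /\<^sub>R \<bar>sqrt \<tau>\<bar>)"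
    using q by (subst lborel_has_bochner_integral_real_affine_iff[symmetric]) auto
  moreover have "(of_real (sqrt pi) * exp ((c / of_real (sqrt \<tau>))\<^sup>2 / 4)) /\<^sub>R \<bar>sqrt \<tau>\<bar> = of_real (sqrt (pi / \<tau>)) * exp (c\<^sup>2 / (4 * of_real \<tau>))"
    using assms by (simp add: scaleR_conv_of_real real_sqrt_divide power_divide q' field_simps)
  moreover have "(\<lambda>v. of_real (exp (- (0 + sqrt \<tau> * v)\<^sup>2)) * exp (c / of_real (sqrt \<tau>) * of_real (0 + sqrt \<tau> * v)))
      = (\<lambda>x. of_real (exp (- (\<tau> * x\<^sup>2))) * exp (c * of_real x))"
    using q by (simp add: power_mult_distrib)
  ultimately show ?thesis by simp
qed

text \<open>
  Fubini's theorem for the kernel \<open>exp(i t (v - x))\<close>. It is used twice: with a Gaussian \<open>Q\<close> for the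
  inversion formula, and with a Fourier transform \<open>Q\<close> for the transform of a convolution.
\<close>

lemma fourier_swap:
  fixes A Q :: "real \<Rightarrow> complex"
  assumes A: "integrable lborel A" and Q: "integrable lborel Q"
  shows "(LINT t|lborel. (LINT v|lborel. A v * exp (\<i> * of_real (t * v))) * Q t * exp (- (\<i> * of_real (t * x))))
       = (LINT v|lborel. A v * (LINT t|lborel. Q t * exp (\<i> * of_real (t * (v - x)))))"
proof -
  have [measurable]: "A \<in> borel_measurable lborel" "Q \<in> borel_measurable lborel"
    using A Q by auto
  define K where "K = (\<lambda>v t. A v * Q t * exp (\<i> * of_real (t * (v - x))))"
  have nK: "norm (K v t) = norm (A v) * norm (Q t)" for v t
    by (simp add: K_def norm_mult)
  have "integrable (lborel \<Otimes>\<^sub>M lborel) (case_prod K)"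
  proof (rule lborel_pair.Fubini_integrable)
    show "case_prod K \<in> borel_measurable (lborel \<Otimes>\<^sub>M lborel)"
      unfolding K_def by measurable
    show "integrable lborel (\<lambda>v. LINT t|lborel. norm (case (v, t) of (v, t) \<Rightarrow> K v t))"
      using A by (simp add: nK)
    show "AE v in lborel. integrable lborel (\<lambda>t. case (v, t) of (v, t) \<Rightarrow> K v t)"
    proof (rule AE_I2)
      fix v
      have "integrable lborel (\<lambda>t. norm (A v) * norm (Q t))" using Q by simp
      thus "integrable lborel (\<lambda>t. case (v, t) of (v, t) \<Rightarrow> K v t)"
        by (rule Bochner_Integration.integrable_bound) (simp_all add: nK, simp add: K_def)
    qed
  qed
  hence "(LINT t|lborel. (LINT v|lborel. K v t)) = (LINT v|lborel. (LINT t|lborel. K v t))"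
    by (rule lborel_pair.Fubini_integral)
  moreover have "(LINT v|lborel. K v t) = (LINT v|lborel. A v * exp (\<i> * of_real (t * v))) * Q t * exp (- (\<i> * of_real (t * x)))" for t
  proof -
    have "K v t = A v * exp (\<i> * of_real (t * v)) * (Q t * exp (- (\<i> * of_real (t * x))))" for v
      by (simp add: K_def right_diff_distrib exp_diff exp_minus field_simps)
    hence "(LINT v|lborel. K v t) = (LINT v|lborel. A v * exp (\<i> * of_real (t * v)) * (Q t * exp (- (\<i> * of_real (t * x)))))"
      by (simp only:)
    also have "\<dots> = (LINT v|lborel. A v * exp (\<i> * of_real (t * v))) * (Q t * exp (- (\<i> * of_real (t * x))))"
      by (rule integral_mult_left_zero)
    finally show ?thesis by (simp only: mult.assoc)
  qed
  moreover have "(LINT t|lborel. K v t) = A v * (LINT t|lborel. Q t * exp (\<i> * of_real (t * (v - x))))" for v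
    by (simp add: K_def mult.assoc)
  ultimately show ?thesis by simp
qed

text \<open>
  The integral is regularized by the factor \<open>exp(-(d t)\<^sup>2)\<close>. Exchanging the integrations turns it into
  the average of \<open>F\<close> against a Gaussian of width proportional to \<open>d\<close> about \<open>x\<close>, and both forms converge
  by dominated convergence as \<open>d\<close> tends to \<open>0\<close>.
\<close>

lemma fourier_inversion:
  fixes F :: "real \<Rightarrow> complex"
  assumes cont: "continuous_on UNIV F" and int: "integrable lborel F" and bd: "\<And>v. norm (F v) \<le> B"
    and hat: "integrable lborel (\<lambda>t. LINT v|lborel. F v * exp (\<i> * of_real (t * v)))"
  shows "(LINT t|lborel. (LINT v|lborel. F v * exp (\<i> * of_real (t * v))) * exp (- (\<i> * of_real (t * x)))) = 2 * pi * F x"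
proof -
  define Fh where "Fh = (\<lambda>t. LINT v|lborel. F v * exp (\<i> * complex_of_real (t * v)))"
  have [measurable]: "Fh \<in> borel_measurable borel" using hat by (auto simp: Fh_def dest: borel_measurable_integrable)
  have [measurable]: "F \<in> borel_measurable borel" using cont by (rule borel_measurable_continuous_onI)
  define d where "d = (\<lambda>n. 1 / real (Suc n))"
  have d0: "d n > 0" for n by (simp add: d_def)
  have dlim: "d \<longlonglongrightarrow> 0" unfolding d_def using LIMSEQ_inverse_real_of_nat by (simp add: inverse_eq_divide)
  define I where "I = (\<lambda>n. LINT t|lborel. Fh t * of_real (exp (- ((d n)\<^sup>2 * t\<^sup>2))) * exp (- (\<i> * of_real (t * x))))"
  have lim1: "I \<longlonglongrightarrow> (LINT t|lborel. Fh t * exp (- (\<i> * of_real (t * x))))"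
    unfolding I_def
  proof (rule integral_dominated_convergence[where w = "\<lambda>t. norm (Fh t)"])
    show "integrable lborel (\<lambda>t. norm (Fh t))" using hat by (simp add: Fh_def)
    have "(\<lambda>n. Fh t * of_real (exp (- ((d n)\<^sup>2 * t\<^sup>2))) * exp (- (\<i> * of_real (t * x)))) \<longlonglongrightarrow> Fh t * of_real (exp (- (0\<^sup>2 * t\<^sup>2))) * exp (- (\<i> * of_real (t * x)))" for t
      by (intro tendsto_intros dlim)
    thus "AE t in lborel. (\<lambda>n. Fh t * of_real (exp (- ((d n)\<^sup>2 * t\<^sup>2))) * exp (- (\<i> * of_real (t * x)))) \<longlonglongrightarrow> Fh t * exp (- (\<i> * of_real (t * x)))"
      by simp
    show "AE t in lborel. norm (Fh t * of_real (exp (- ((d n)\<^sup>2 * t\<^sup>2))) * exp (- (\<i> * of_real (t * x)))) \<le> norm (Fh t)" for n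
      by (intro AE_I2) (simp add: norm_mult mult_left_le)
  qed measurable
  have I_eq: "I n = of_real (2 * sqrt pi) * (LINT u|lborel. F (x + 2 * d n * u) * of_real (exp (- u\<^sup>2)))" for n
  proof -
    let ?e = "d n"
    have g: "has_bochner_integral lborel (\<lambda>t. of_real (exp (- (?e\<^sup>2 * t\<^sup>2))) * exp (c * of_real t))
           (of_real (sqrt (pi / ?e\<^sup>2)) * exp (c\<^sup>2 / (4 * of_real (?e\<^sup>2))))" for c :: complex
      using d0[of n] by (intro has_bochner_integral_gaussian) simp
    have "integrable lborel (\<lambda>t. complex_of_real (exp (- (?e\<^sup>2 * t\<^sup>2))))"
      using g[of 0] by (simp add: has_bochner_integral_iff)
    note gint = this
    have inner: "(LINT t|lborel. of_real (exp (- (?e\<^sup>2 * t\<^sup>2))) * exp (\<i> * of_real (t * (v - x)))) = of_real (sqrt pi / ?e) * of_real (exp (- ((v - x)\<^sup>2 / (4 * ?e\<^sup>2))))" for v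
    proof -
      have "(LINT t|lborel. of_real (exp (- (?e\<^sup>2 * t\<^sup>2))) * exp (\<i> * of_real (v - x) * of_real t)) = of_real (sqrt (pi / ?e\<^sup>2)) * exp ((\<i> * of_real (v - x))\<^sup>2 / (4 * of_real (?e\<^sup>2)))"
        using g by (simp add: has_bochner_integral_iff)
      moreover have "exp ((\<i> * of_real (v - x))\<^sup>2 / (4 * of_real (?e\<^sup>2))) = complex_of_real (exp (- ((v - x)\<^sup>2 / (4 * ?e\<^sup>2))))"
        by (simp add: power_mult_distrib flip: exp_of_real)
      ultimately show ?thesis using d0[of n] by (simp add: mult_ac real_sqrt_divide)
    qed
    have "I n = (LINT v|lborel. F v * (LINT t|lborel. of_real (exp (- (?e\<^sup>2 * t\<^sup>2))) * exp (\<i> * of_real (t * (v - x)))))"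
      unfolding I_def Fh_def by (rule fourier_swap[OF int gint])
    also have "\<dots> = (LINT v|lborel. F v * (of_real (sqrt pi / ?e) * of_real (exp (- ((v - x)\<^sup>2 / (4 * ?e\<^sup>2))))))"
      by (simp only: inner)
    also have "\<dots> =
      \<bar>2 * ?e\<bar> *\<^sub>R (LINT u|lborel. F (x + 2 * ?e * u) * (of_real (sqrt pi / ?e) * of_real (exp (- ((x + 2 * ?e * u - x)\<^sup>2 / (4 * ?e\<^sup>2))))))"
      using d0[of n] by (subst lborel_integral_real_affine[where c = "2 * ?e" and t = x]) auto
    also have "\<dots> = \<bar>2 * ?e\<bar> *\<^sub>R (LINT u|lborel. of_real (sqrt pi / ?e) * (F (x + 2 * ?e * u) * of_real (exp (- u\<^sup>2))))"
      using d0[of n] by (simp add: power_mult_distrib mult_ac)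
    also have "\<dots> = of_real (2 * sqrt pi) * (LINT u|lborel. F (x + 2 * d n * u) * of_real (exp (- u\<^sup>2)))"
      using d0[of n] by (subst integral_mult_right_zero) (simp add: scaleR_conv_of_real field_simps)
    finally show ?thesis .
  qed
  have lim2: "(\<lambda>n. LINT u|lborel. F (x + 2 * d n * u) * of_real (exp (- u\<^sup>2))) \<longlonglongrightarrow> (LINT u|lborel. F x * of_real (exp (- u\<^sup>2)))"
  proof (rule integral_dominated_convergence[where w = "\<lambda>u. B * exp (- u\<^sup>2)"])
    show "integrable lborel (\<lambda>u. B * exp (- u\<^sup>2))"
      using has_bochner_integral_gaussian_real by (simp add: has_bochner_integral_iff)
    have "(\<lambda>n. F (x + 2 * d n * u)) \<longlonglongrightarrow> F x" for u
    proof -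
      have "(\<lambda>n. x + 2 * d n * u) \<longlonglongrightarrow> x + 2 * 0 * u" by (intro tendsto_intros dlim)
      hence "(\<lambda>n. x + 2 * d n * u) \<longlonglongrightarrow> x" by simp
      thus ?thesis using cont by (intro isCont_tendsto_compose[of x F]) (auto simp: continuous_on_eq_continuous_at)
    qed
    thus "AE u in lborel. (\<lambda>n. F (x + 2 * d n * u) * of_real (exp (- u\<^sup>2))) \<longlonglongrightarrow> F x * of_real (exp (- u\<^sup>2))"
      by (intro AE_I2 tendsto_intros)
    show "AE u in lborel. norm (F (x + 2 * d n * u) * of_real (exp (- u\<^sup>2))) \<le> B * exp (- u\<^sup>2)" for n
      using bd by (intro AE_I2) (simp add: norm_mult mult_right_mono)
  qed measurable
  have "(LINT u|lborel. F x * of_real (exp (- u\<^sup>2))) = F x * of_real (sqrt pi)"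
    using has_bochner_integral_integral_eq[OF has_bochner_integral_gaussian_real] by simp
  hence "I \<longlonglongrightarrow> of_real (2 * sqrt pi) * (F x * of_real (sqrt pi))"
    unfolding I_eq using lim2 by (intro tendsto_mult tendsto_const) metis
  from LIMSEQ_unique[OF lim1 this] show ?thesis
    by (simp add: Fh_def mult_ac flip: of_real_mult)
qed

section \<open>The generalized Bessel function as a convolution\<close>

lemma gauss_cos_pow_bound: "\<exists>C\<ge>0. \<forall>t\<ge>0. norm (gauss_cos w t) * t ^ N \<le> C"
proof (intro exI[of _ "fact N * exp ((norm w + 1)\<^sup>2 / 4)"] conjI allI impI)
  fix t :: real assume t: "0 \<le> t"
  have 1: "norm (gauss_cos w t) \<le> exp (- t\<^sup>2) * exp (norm w * t)"
  proof -
    have "exp (- (complex_of_real t)\<^sup>2) = of_real (exp (- t\<^sup>2))" by (simp flip: exp_of_real)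
    moreover have "norm (cos (w * of_real t)) \<le> exp (norm w * t)"
      using norm_cos_le[of "w * of_real t"] t by (simp add: norm_mult)
    ultimately show ?thesis by (simp add: gauss_cos_def norm_mult)
  qed
  have 2: "t ^ N \<le> fact N * exp t"
  proof -
    have s: "(\<lambda>n. t ^ n / fact n) sums exp t"
      using exp_converges[of t] by (simp add: scaleR_conv_of_real field_simps)
    have "(\<Sum>k\<in>{N}. t ^ k / fact k) \<le> (\<Sum>k. t ^ k / fact k)"
      using s t by (intro sum_le_suminf) (auto simp: sums_iff)
    thus ?thesis using s by (simp add: sums_iff field_simps)
  qed
  have "norm (gauss_cos w t) * t ^ N \<le> exp (- t\<^sup>2) * exp (norm w * t) * (fact N * exp t)"
    using t by (intro mult_mono 1 2) auto
  also have "\<dots> = fact N * exp (- t\<^sup>2 + norm w * t + t)" by (simp only: exp_add mult_ac)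
  also have "\<dots> \<le> fact N * exp ((norm w + 1)\<^sup>2 / 4)"
  proof -
    have "0 \<le> (t - (norm w + 1)/2)\<^sup>2" by simp
    hence "- t\<^sup>2 + norm w * t + t \<le> (norm w + 1)\<^sup>2 / 4" by (simp add: power2_eq_square field_simps)
    thus ?thesis by simp
  qed
  finally show "norm (gauss_cos w t) * t ^ N \<le> fact N * exp ((norm w + 1)\<^sup>2 / 4)" .
qed auto

text \<open>
  The function is bounded near \<open>t = 0\<close> and decays faster than any power at infinity; a real exponent
  \<open>p\<close> lies between the integer exponents \<open>0\<close> and \<open>N\<close>.
\<close>

lemma gauss_cos_exp_bound:
  assumes "0 \<le> p"
  shows "\<exists>C\<ge>0. \<forall>v. norm (gauss_cos w (exp v)) \<le> C * exp (- p * v)"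
proof -
  obtain N where N: "p \<le> real N" using real_arch_simple by blast
  obtain C0 where C0: "C0 \<ge> 0" "\<And>t. t \<ge> 0 \<Longrightarrow> norm (gauss_cos w t) * t ^ 0 \<le> C0" using gauss_cos_pow_bound[of w 0] by blast
  obtain C1 where C1: "C1 \<ge> 0" "\<And>t. t \<ge> 0 \<Longrightarrow> norm (gauss_cos w t) * t ^ N \<le> C1" using gauss_cos_pow_bound[of w N] by blast
  show ?thesis
  proof (intro exI[of _ "C0 + C1"] conjI allI)
    fix v
    have "exp (p * v) \<le> 1 + exp v ^ N"
    proof (cases "v \<le> 0")
      case True
      hence "exp (p * v) \<le> 1" using assms by (simp add: mult_nonneg_nonpos)
      thus ?thesis by (smt (verit) exp_gt_zero zero_less_power)
    next
      case False
      hence "exp (p * v) \<le> exp (real N * v)" using N by (simp add: mult_right_mono)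
      thus ?thesis by (simp add: exp_of_nat_mult)
    qed
    hence "norm (gauss_cos w (exp v)) * exp (p * v) \<le> norm (gauss_cos w (exp v)) * (1 + exp v ^ N)"
      by (intro mult_left_mono) auto
    also have "\<dots> \<le> C0 + C1" using C0(2)[of "exp v"] C1(2)[of "exp v"] by (simp add: ring_distribs)
    finally show "norm (gauss_cos w (exp v)) \<le> (C0 + C1) * exp (- p * v)"
      by (simp add: exp_minus field_simps)
  qed (use C0 C1 in auto)
qed

lemma integrable_inverse_quadratic:
  assumes "c > (0::real)"
  shows "integrable lborel (\<lambda>t. 1 / (c\<^sup>2 + (t - d)\<^sup>2))"
proof -
  have "integrable lborel (\<lambda>x::real. inverse (1 + x\<^sup>2))"
    using integrable_inverse_1_plus_square by (simp add: set_integrable_def)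
  hence "integrable lborel (\<lambda>x. inverse (1 + (- (d/c) + (1/c) * x)\<^sup>2))"
    by (rule lborel_integrable_real_affine) (use assms in auto)
  hence "integrable lborel (\<lambda>x. inverse (1 + (- (d/c) + (1/c) * x)\<^sup>2) / c\<^sup>2)" by (rule integrable_divide_zero)
  also have "(\<lambda>x. inverse (1 + (- (d/c) + (1/c) * x)\<^sup>2) / c\<^sup>2) = (\<lambda>t. 1 / (c\<^sup>2 + (t - d)\<^sup>2))"
  proof
    fix x
    have "c\<^sup>2 * (1 + (- (d/c) + (1/c) * x)\<^sup>2) = c\<^sup>2 + (x - d)\<^sup>2"
      using assms by (simp add: power2_eq_square field_simps)
    thus "inverse (1 + (- (d/c) + (1/c) * x)\<^sup>2) / c\<^sup>2 = 1 / (c\<^sup>2 + (x - d)\<^sup>2)"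
      by (simp add: inverse_eq_divide mult.commute)
  qed
  finally show ?thesis .
qed

text \<open>
  The function whose Fourier transform is \<open>mellin_gauss_cos w\<close> along the vertical line through \<open>s\<close>.
\<close>

definition gauss_cos_twist :: "complex \<Rightarrow> complex \<Rightarrow> real \<Rightarrow> complex" where
  "gauss_cos_twist w s v = gauss_cos w (exp v) * exp (s * of_real v)"

lemma gauss_cos_twist_continuous: "continuous_on UNIV (gauss_cos_twist w s)"
  unfolding gauss_cos_twist_def gauss_cos_def by (intro continuous_intros)

lemma gauss_cos_twist_integrable: "Re s > 0 \<Longrightarrow> integrable lborel (gauss_cos_twist w s)"
  using has_bochner_integral_gauss_cos[of s w] by (simp add: has_bochner_integral_iff gauss_cos_twist_def[abs_def])

lemma gauss_cos_twist_bounded: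
  assumes "Re s > 0"
  obtains B where "\<And>v. norm (gauss_cos_twist w s v) \<le> B"
proof -
  obtain C where C: "\<And>v. norm (gauss_cos w (exp v)) \<le> C * exp (- Re s * v)"
    using gauss_cos_exp_bound[of "Re s" w] assms by auto
  show ?thesis
  proof (rule that)
    fix v
    have "norm (gauss_cos_twist w s v) \<le> C * exp (- Re s * v) * exp (Re s * v)"
      using C[of v] by (simp add: gauss_cos_twist_def norm_mult)
    also have "\<dots> = C" by (simp add: mult.assoc flip: exp_add)
    finally show "norm (gauss_cos_twist w s v) \<le> C" .
  qed
qed

lemma gauss_cos_twist_fourier:
  assumes "Re s > 0"
  shows "(LINT v|lborel. gauss_cos_twist w s v * exp (\<i> * of_real (t * v))) = mellin_gauss_cos w (s + \<i> * of_real t)"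
proof -
  have "gauss_cos_twist w s v * exp (\<i> * of_real (t * v)) = gauss_cos w (exp v) * exp ((s + \<i> * of_real t) * of_real v)" for v
    by (simp add: gauss_cos_twist_def mult.assoc exp_add ring_distribs)
  thus ?thesis using has_bochner_integral_gauss_cos[of "s + \<i> * of_real t" w] assms by (simp add: has_bochner_integral_iff)
qed

lemma mellin_gauss_cos_vertical_integrable:
  assumes s: "Re s > 0"
  shows "integrable lborel (\<lambda>t. mellin_gauss_cos w (s + \<i> * of_real t))"
proof -
  obtain C where C: "C \<ge> 0" "\<And>z. Re z = Re s \<Longrightarrow> norm (mellin_gauss_cos w z) \<le> C / (norm z)\<^sup>2"
    using mellin_gauss_cos_bound[OF s, of w] by blast
  have [measurable]: "gauss_cos_twist w s \<in> borel_measurable borel"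
    using gauss_cos_twist_continuous by (rule borel_measurable_continuous_onI)
  have "(\<lambda>t. LINT v|lborel. gauss_cos_twist w s v * exp (\<i> * of_real (t * v))) \<in> borel_measurable lborel"
    by measurable
  hence m: "(\<lambda>t. mellin_gauss_cos w (s + \<i> * of_real t)) \<in> borel_measurable lborel"
    unfolding gauss_cos_twist_fourier[OF s] .
  have "integrable lborel (\<lambda>t. C * (1 / ((Re s)\<^sup>2 + (t - (- Im s))\<^sup>2)))"
    by (intro integrable_mult_right integrable_inverse_quadratic s)
  thus ?thesis
  proof (rule Bochner_Integration.integrable_bound[OF _ m], intro AE_I2)
    fix t
    have "norm (mellin_gauss_cos w (s + \<i> * of_real t)) \<le> C / (norm (s + \<i> * of_real t))\<^sup>2" by (rule C(2)) simp
    also have "\<dots> = C * (1 / ((Re s)\<^sup>2 + (t - (- Im s))\<^sup>2))"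
      by (simp add: cmod_power2 add.commute)
    finally show "norm (mellin_gauss_cos w (s + \<i> * of_real t)) \<le> norm (C * (1 / ((Re s)\<^sup>2 + (t - (- Im s))\<^sup>2)))" using C(1) by simp
  qed
qed

text \<open>
  The multiplicative convolution of \<open>gauss_cos w\<close> with itself, twisted by \<open>t\<^sup>2\<^sup>z\<close>, in the variable
  \<open>v = ln t\<close>.
\<close>

definition bessel_conv :: "complex \<Rightarrow> complex \<Rightarrow> real \<Rightarrow> complex" where
  "bessel_conv z w y = (LINT v|lborel. gauss_cos w (exp v) * gauss_cos w (y * exp (- v)) * exp (2 * z * of_real v))"

text \<open>
  One of the two Mellin transforms is written as an integral again, the integrations are exchanged, and
  the other one is inverted.
\<close>

lemma mellin_product_inversion:
  assumes c: "c > \<bar>Re z\<bar>" and y: "y > 0"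
  shows "has_bochner_integral lborel (\<lambda>t. mellin_gauss_cos w (of_real c + z + \<i> * of_real t) * mellin_gauss_cos w (of_real c - z + \<i> * of_real t)
           * of_real y powr (- (of_real c + \<i> * of_real t)))
         (2 * pi * (of_real y powr (- z) * bessel_conv z w y))"
proof -
  define h where "h = ln y"
  have yh: "y = exp h" using y by (simp add: h_def)
  have ypow: "of_real y powr p = exp (p * of_real h)" for p :: complex
    using y by (simp add: powr_def h_def Ln_of_real)
  have sp: "Re (of_real c + z) > 0" "Re (of_real c - z) > 0" using c by auto
  let ?A = "gauss_cos_twist w (of_real c + z)" and ?B = "gauss_cos_twist w (of_real c - z)"
  let ?Bh = "\<lambda>t. mellin_gauss_cos w (of_real c - z + \<i> * of_real t)"
  let ?Ah = "\<lambda>t. mellin_gauss_cos w (of_real c + z + \<i> * of_real t)"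
  have inv: "(LINT t|lborel. ?Bh t * exp (- (\<i> * of_real (t * x)))) = 2 * pi * ?B x" for x
  proof -
    obtain B where "\<And>v. norm (?B v) \<le> B" using gauss_cos_twist_bounded[OF sp(2)] by blast
    from fourier_inversion[OF gauss_cos_twist_continuous gauss_cos_twist_integrable[OF sp(2)] this, of x]
    show ?thesis unfolding gauss_cos_twist_fourier[OF sp(2)]
      using mellin_gauss_cos_vertical_integrable[OF sp(2)] by simp
  qed
  have "(LINT t|lborel. ?Ah t * ?Bh t * exp (- (\<i> * of_real (t * h)))) =
     (LINT v|lborel. ?A v * (LINT t|lborel. ?Bh t * exp (\<i> * of_real (t * (v - h)))))"
    using fourier_swap[OF gauss_cos_twist_integrable[OF sp(1)] mellin_gauss_cos_vertical_integrable[OF sp(2)], of w w h]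
    unfolding gauss_cos_twist_fourier[OF sp(1)] .
  also have "\<dots> = (LINT v|lborel. ?A v * (2 * pi * ?B (h - v)))"
    using inv[of "h - v" for v] by (simp add: right_diff_distrib)
  also have "\<dots> = (LINT v|lborel. 2 * pi * exp ((of_real c - z) * of_real h) * (gauss_cos w (exp v) * gauss_cos w (y * exp (- v)) * exp (2 * z * of_real v)))"
  proof (rule Bochner_Integration.integral_cong[OF refl])
    fix v
    have "exp ((of_real c + z) * of_real v) * exp ((of_real c - z) * of_real (h - v)) = exp ((of_real c - z) * of_real h) * exp (2 * z * of_real v)"
      by (simp add: algebra_simps flip: exp_add)
    thus "?A v * (2 * pi * ?B (h - v)) = 2 * pi * exp ((of_real c - z) * of_real h) * (gauss_cos w (exp v) * gauss_cos w (y * exp (- v)) * exp (2 * z * of_real v))"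
      by (simp add: gauss_cos_twist_def yh exp_diff exp_minus divide_inverse mult_ac)
  qed
  also have "\<dots> = 2 * pi * exp ((of_real c - z) * of_real h) * bessel_conv z w y"
    by (simp add: bessel_conv_def)
  finally have val: "(LINT t|lborel. ?Ah t * ?Bh t * exp (- (\<i> * of_real (t * h)))) = 2 * pi * exp ((of_real c - z) * of_real h) * bessel_conv z w y" .
  have "integrable lborel (\<lambda>t. ?Ah t * ?Bh t * exp (- (\<i> * of_real (t * h))))"
  proof -
    obtain C where C: "C \<ge> 0" "\<And>s. Re s = Re (of_real c + z) \<Longrightarrow> norm (mellin_gauss_cos w s) \<le> C / (norm s)\<^sup>2"
      using mellin_gauss_cos_bound[OF sp(1), of w] by blast
    have [measurable]: "?Ah \<in> borel_measurable lborel" "?Bh \<in> borel_measurable lborel"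
      using mellin_gauss_cos_vertical_integrable sp by (blast intro: borel_measurable_integrable)+
    have "integrable lborel (\<lambda>t. C / (Re (of_real c + z))\<^sup>2 * norm (?Bh t))"
      by (intro integrable_mult_right integrable_norm mellin_gauss_cos_vertical_integrable sp)
    thus ?thesis
    proof (rule Bochner_Integration.integrable_bound, goal_cases)
      case 2
      show ?case
      proof (rule AE_I2)
        fix t
        have "norm (?Ah t) \<le> C / (norm (of_real c + z + \<i> * of_real t))\<^sup>2" by (rule C(2)) simp
        also have "\<dots> \<le> C / (Re (of_real c + z))\<^sup>2"
        proof (rule divide_left_mono)
          have "\<bar>Re (of_real c + z + \<i> * of_real t)\<bar> \<le> norm (of_real c + z + \<i> * of_real t)" by (rule abs_Re_le_cmod)
          thus "(Re (of_real c + z))\<^sup>2 \<le> (norm (of_real c + z + \<i> * of_real t))\<^sup>2"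
            using sp by (intro power_mono) auto
          have "of_real c + z + \<i> * of_real t \<noteq> 0" using sp by (auto simp: complex_eq_iff)
          thus "0 < (norm (of_real c + z + \<i> * of_real t))\<^sup>2 * (Re (of_real c + z))\<^sup>2" using sp by simp
        qed (rule C)
        finally have "norm (?Ah t) * norm (?Bh t) \<le> C / (Re (of_real c + z))\<^sup>2 * norm (?Bh t)"
          by (rule mult_right_mono) simp
        thus "norm (?Ah t * ?Bh t * exp (- (\<i> * of_real (t * h)))) \<le> norm (C / (Re (of_real c + z))\<^sup>2 * norm (?Bh t))"
          using C(1) by (simp add: norm_mult)
      qed
    qed measurable
  qed
  with val have "has_bochner_integral lborel (\<lambda>t. ?Ah t * ?Bh t * exp (- (\<i> * of_real (t * h)))) (2 * pi * exp ((of_real c - z) * of_real h) * bessel_conv z w y)"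
    by (simp add: has_bochner_integral_iff)
  hence "has_bochner_integral lborel (\<lambda>t. ?Ah t * ?Bh t * exp (- (\<i> * of_real (t * h))) * exp (- (of_real c * of_real h))) (2 * pi * exp ((of_real c - z) * of_real h) * bessel_conv z w y * exp (- (of_real c * of_real h)))"
    by (rule has_bochner_integral_mult_left)
  moreover have "?Ah t * ?Bh t * exp (- (\<i> * of_real (t * h))) * exp (- (of_real c * of_real h))
      = ?Ah t * ?Bh t * of_real y powr (- (of_real c + \<i> * of_real t))" for t
  proof -
    have "exp (- (\<i> * of_real (t * h))) * exp (- (of_real c * of_real h)) = of_real y powr (- (of_real c + \<i> * of_real t))"
      unfolding ypow by (simp add: algebra_simps flip: exp_add)
    thus ?thesis by (simp only: mult.assoc)
  qed
  moreover have "2 * pi * exp ((of_real c - z) * of_real h) * bessel_conv z w y * exp (- (of_real c * of_real h))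
      = 2 * pi * (of_real y powr (- z) * bessel_conv z w y)"
  proof -
    have "exp ((of_real c - z) * of_real h) * exp (- (of_real c * of_real h)) = of_real y powr (- z)"
      unfolding ypow by (simp add: algebra_simps flip: exp_add)
    thus ?thesis by (metis mult.assoc mult.commute)
  qed
  ultimately show ?thesis by (simp only:)
qed

text \<open>
  The value on the right does not involve the abscissa \<open>c\<close>, so all vertical lines give the same value
  and the definite description in \<open>gen_bessel_K\<close> denotes it.
\<close>

lemma gen_bessel_K_eq:
  assumes y: "y > 0"
  shows "gen_bessel_K z w (2 * y) = of_real y powr (- z) * bessel_conv z w y"
proof -
  let ?V = "of_real y powr (- z) * bessel_conv z w y"
  have main: "has_vertical_integral (gen_bessel_integrand z w (2 * y)) c (2 * pi * \<i> * ?V)" if c: "c > \<bar>Re z\<bar>" for c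
  proof -
    have eq: "gen_bessel_integrand z w (2 * y) (Complex c t) = mellin_gauss_cos w (of_real c + z + \<i> * of_real t) * mellin_gauss_cos w (of_real c - z + \<i> * of_real t)
           * of_real y powr (- (of_real c + \<i> * of_real t))" for t
    proof -
      define s where "s = Complex c t"
      have s: "of_real c + z + \<i> * of_real t = s + z" "of_real c - z + \<i> * of_real t = s - z" "of_real c + \<i> * of_real t = s"
        by (auto simp: s_def complex_eq_iff)
      have "2 powr (s - 2) * of_real (2 * y) powr (- s) = of_real y powr (- s) / 4"
      proof -
        have "of_real (2 * y) powr (- s) = of_real 2 powr (- s) * of_real y powr (- s)"
          using y by (simp add: powr_times_real)
        moreover have "2 powr (s - 2) * 2 powr (- s) = (1/4 :: complex)"
           by (simp add: powr_def flip: exp_add) (simp add: algebra_simps exp_minus exp_double inverse_eq_divide)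
        ultimately show ?thesis by (simp add: field_simps)
      qed
      thus ?thesis unfolding s unfolding gen_bessel_integrand_def mellin_gauss_cos_def s_def[symmetric]
        by (simp add: mult.assoc)
    qed
    have "has_bochner_integral lborel (\<lambda>t. gen_bessel_integrand z w (2 * y) (Complex c t) * \<i>) (2 * pi * ?V * \<i>)"
      unfolding eq by (intro has_bochner_integral_mult_left mellin_product_inversion c y)
    thus ?thesis by (simp add: has_vertical_integral_def mult_ac)
  qed
  show ?thesis
    unfolding gen_bessel_K_def
  proof (rule the_equality)
    show "\<forall>c>\<bar>Re z\<bar>. \<exists>I. has_vertical_integral (gen_bessel_integrand z w (2 * y)) c I \<and> ?V = 1 / (2 * pi * \<i>) * I"
      using main by (intro allI impI exI[of _ "2 * pi * \<i> * ?V"]) simp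
    fix v assume v: "\<forall>c>\<bar>Re z\<bar>. \<exists>I. has_vertical_integral (gen_bessel_integrand z w (2 * y)) c I \<and> v = 1 / (2 * pi * \<i>) * I"
    define c where "c = \<bar>Re z\<bar> + 1"
    obtain I where I: "has_vertical_integral (gen_bessel_integrand z w (2 * y)) c I" "v = 1 / (2 * pi * \<i>) * I"
      using v by (metis c_def less_add_one)
    have "I = 2 * pi * \<i> * ?V"
      using I(1) main[of c] has_bochner_integral_eq unfolding has_vertical_integral_def by (metis c_def less_add_one)
    thus "v = ?V" using I(2) by simp
  qed
qed

section \<open>Poisson summation for the Gaussian cosine\<close>

definition mode :: "real \<Rightarrow> int \<Rightarrow> complex" where
  "mode x k = exp (2 * pi * \<i> * of_int k * of_real x)"

lemma exp_2pi_of_int: "exp (2 * of_int k * of_real pi * \<i>) = 1"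
  by (auto simp: exp_eq_1)

definition dirichlet_kernel :: "nat \<Rightarrow> real \<Rightarrow> complex" where
  "dirichlet_kernel N x = 1 + (\<Sum>k<N. mode x (int (Suc k)) + mode x (- int (Suc k)))"

lemma mode_add: "mode x (k + l) = mode x k * mode x l"
  by (simp add: mode_def algebra_simps exp_add)

lemma norm_mode [simp]: "norm (mode x k) = 1"
  by (simp add: mode_def)

lemma mode_0 [simp]: "mode x 0 = 1" by (simp add: mode_def)

lemma mode_measurable [measurable]: "(\<lambda>x. mode x k) \<in> borel_measurable borel"
  unfolding mode_def by (intro borel_measurable_continuous_onI continuous_intros)

text \<open>
  Multiplication by \<open>mode x 1\<close> shifts the frequencies by one, so all but the extreme ones cancel.
\<close>

lemma dirichlet_kernel_telescope:
  "(mode x 1 - 1) * dirichlet_kernel N x = mode x (int N + 1) - mode x (- int N)"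
proof (induction N)
  case 0
  show ?case by (simp add: dirichlet_kernel_def)
next
  case (Suc N)
  have 1: "mode x 1 * mode x (int (Suc N)) = mode x (int (Suc N) + 1)"
    by (simp add: add.commute flip: mode_add)
  have 2: "mode x 1 * mode x (- int (Suc N)) = mode x (- int N)"
    by (simp flip: mode_add)
  have "(mode x 1 - 1) * dirichlet_kernel (Suc N) x = (mode x 1 - 1) * dirichlet_kernel N x
      + (mode x 1 - 1) * (mode x (int (Suc N)) + mode x (- int (Suc N)))"
    by (simp add: dirichlet_kernel_def ring_distribs)
  also have "\<dots> = mode x (int (Suc N) + 1) - mode x (- int (Suc N))"
    using 1 2 unfolding Suc by (simp add: algebra_simps)
  finally show ?case .
qed

lemma mode_period_integral:
  "(LINT x|lborel. indicator {of_int n - 1/2..of_int n + 1/2} x *\<^sub>R mode x k) = (if k = 0 then 1 else 0)"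
proof (cases "k = 0")
  case False
  define F where "F = (\<lambda>x. mode x k / (2 * pi * \<i> * of_int k))"
  have "(LINT x|lborel. indicator {of_int n - 1/2..of_int n + 1/2} x *\<^sub>R mode x k) = F (of_int n + 1/2) - F (of_int n - 1/2)"
  proof (rule integral_FTC_atLeastAtMost)
    fix x :: real
    have "((\<lambda>x. exp (2 * pi * \<i> * of_int k * of_real x) / (2 * pi * \<i> * of_int k)) has_vector_derivative 
             exp (2 * pi * \<i> * of_int k * of_real x)) (at x)"
      using False
      by (auto intro!: derivative_eq_intros has_vector_derivative_real_field)
    thus "(F has_vector_derivative mode x k) (at x within {of_int n - 1/2..of_int n + 1/2})"
      unfolding F_def mode_def by (rule has_vector_derivative_at_within)
  qed (auto simp: mode_def intro!: continuous_intros)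
  also have "mode (of_int n + 1/2) k = mode (of_int n - 1/2) k"
  proof -
    have "2 * pi * \<i> * of_int k * of_real (of_int n + 1/2) = 2 * pi * \<i> * of_int k * of_real (of_int n - 1/2) + 2 * of_int k * pi * \<i>"
      by (simp add: algebra_simps)
    thus ?thesis unfolding mode_def by (simp only: exp_add) (simp add: exp_2pi_of_int)
  qed
  hence "F (of_int n + 1/2) - F (of_int n - 1/2) = 0" by (simp add: F_def)
  finally show ?thesis using False by simp
qed (simp add: mode_def)

lemma abs_sin_ge:
  assumes "\<bar>x\<bar> \<le> (2::real)"
  shows "\<bar>x\<bar> / 3 \<le> \<bar>sin x\<bar>"
proof -
  have "\<bar>sin x - x\<bar> \<le> \<bar>x\<bar> ^ 3 / 6"
    using Maclaurin_sin_bound[of x 3] by (simp add: numeral_eq_Suc sin_coeff_def fact_reduce)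
  also have "\<bar>x\<bar> ^ 3 \<le> \<bar>x\<bar> * 4"
  proof -
    have "\<bar>x\<bar> * (\<bar>x\<bar> * \<bar>x\<bar>) \<le> \<bar>x\<bar> * (2 * 2)" using assms by (intro mult_left_mono mult_mono) auto
    thus ?thesis by (simp add: power3_eq_cube mult.assoc del: abs_mult_self_eq)
  qed
  finally show ?thesis by linarith
qed

text \<open>
  The denominator in Chernoff's argument vanishes only to first order at the integers.
\<close>

lemma norm_mode_minus_1_ge:
  "norm (mode x 1 - 1) \<ge> 2 * \<bar>x - of_int (round x)\<bar>"
proof -
  define d where "d = x - of_int (round x)"
  have d: "\<bar>d\<bar> \<le> 1/2" using of_int_round_abs_le[of x] by (simp add: d_def abs_minus_commute)
  have "mode x 1 = mode d 1"
  proof -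
    have "2 * pi * \<i> * of_int 1 * of_real x = 2 * pi * \<i> * of_int 1 * of_real d + 2 * of_int (round x) * pi * \<i>"
      by (simp add: d_def algebra_simps)
    thus ?thesis unfolding mode_def by (simp only: exp_add) (simp add: exp_2pi_of_int)
  qed
  also have "norm (mode d 1 - 1) = 2 * \<bar>sin (pi * d)\<bar>"
    using dist_exp_i_1[of "2 * pi * d"] by (simp add: mode_def mult_ac)
  finally have "norm (mode x 1 - 1) = 2 * \<bar>sin (pi * d)\<bar>" .
  moreover have "\<bar>pi * d\<bar> / 3 \<le> \<bar>sin (pi * d)\<bar>"
  proof (rule abs_sin_ge)
    have "\<bar>pi * d\<bar> \<le> 4 * (1/2)" unfolding abs_mult using d pi_less_4 by (intro mult_mono) auto
    thus "\<bar>pi * d\<bar> \<le> 2" by simp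
  qed
  moreover have "3 * \<bar>d\<bar> \<le> \<bar>pi * d\<bar>"
    unfolding abs_mult using pi_approx by (intro mult_right_mono) auto
  ultimately show ?thesis by (simp add: d_def)
qed

text \<open>
  Averages over the windows from \<open>M\<close> to \<open>2M\<close> rather than over initial segments: all terms that
  enter are then close to the limit.
\<close>

lemma window_average_tendsto:
  fixes A :: "nat \<Rightarrow> complex"
  assumes "A \<longlonglongrightarrow> L"
  shows "(\<lambda>M. (\<Sum>N=M..<2*M. A N) / of_nat M) \<longlonglongrightarrow> L"
proof (rule LIMSEQ_I)
  fix r :: real assume r: "0 < r"
  then obtain no where no: "\<And>n. n \<ge> no \<Longrightarrow> norm (A n - L) < r / 2"
    using LIMSEQ_D[OF assms, of "r/2"] by auto
  have "norm ((\<Sum>N=M..<2*M. A N) / of_nat M - L) < r" if M: "M \<ge> Suc no" for M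
  proof -
    have "(\<Sum>N=M..<2*M. A N) / of_nat M - L = (\<Sum>N=M..<2*M. A N - L) / of_nat M"
      using M by (simp add: sum_subtractf field_simps)
    also have "norm \<dots> \<le> (\<Sum>N=M..<2*M. r/2) / real M"
      unfolding norm_divide norm_of_nat
      using no M by (intro divide_right_mono sum_norm_le) (auto intro: less_imp_le)
    also have "\<dots> = r/2" using M by simp
    finally show ?thesis using r by simp
  qed
  thus "\<exists>no. \<forall>n\<ge>no. norm ((\<Sum>N=n..<2*n. A N) / of_nat n - L) < r" by blast
qed

lemma mode_window_bound:
  "norm ((mode x 1 - 1) * (\<Sum>N=M..<2*M. mode x (int N + 1) - mode x (- int N))) \<le> 4"
proof -
  have 1: "(mode x 1 - 1) * (\<Sum>N=M..<M+K. mode x (int N + 1)) = mode x (int (M + K) + 1) - mode x (int M + 1)" for K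
  proof (induction K)
    case (Suc K)
    have "mode x 1 * mode x (int (M + K) + 1) = mode x (int (M + Suc K) + 1)"
      by (subst mode_add[symmetric]) (simp add: algebra_simps)
    thus ?case using Suc by (simp add: algebra_simps)
  qed simp
  have 2: "(mode x 1 - 1) * (\<Sum>N=M..<M+K. mode x (- int N)) = mode x (1 - int M) - mode x (1 - int (M + K))" for K
  proof (induction K)
    case (Suc K)
    have "mode x 1 * mode x (- int (M + K)) = mode x (1 - int (M + K))"
      by (subst mode_add[symmetric]) (simp add: algebra_simps)
    moreover have "1 - int (M + Suc K) = - int (M + K)" by simp
    ultimately show ?case using Suc by (simp add: algebra_simps)
  qed simp
  have "(mode x 1 - 1) * (\<Sum>N=M..<2*M. mode x (int N + 1) - mode x (- int N)) =
      (mode x (int (M + M) + 1) - mode x (int M + 1)) - (mode x (1 - int M) - mode x (1 - int (M + M)))"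
    unfolding mult_2[of M] sum_subtractf right_diff_distrib[of "mode x 1 - 1"] 1 2 ..
  also have "norm \<dots> \<le> (norm (mode x (int (M + M) + 1)) + norm (mode x (int M + 1))) + (norm (mode x (1 - int M)) + norm (mode x (1 - int (M + M))))"
    by (intro order_trans[OF norm_triangle_ineq4] add_mono norm_triangle_ineq4)
  finally show ?thesis by simp
qed

text \<open>
  Poisson summation by Chernoff's telescoping trick, on the whole line instead of one period. Let \<open>s\<close> be
  the step function with value \<open>f n\<close> near the integer \<open>n\<close>. The Lipschitz condition makes
  \<open>H = (f - s) / (e(x) - 1)\<close> integrable, where \<open>e(x) = exp(2 \<pi> i x)\<close>. Integrating \<open>H (e(x) - 1)\<close> against the
  Dirichlet kernel gives the partial sums of the Fourier side minus the sum of \<open>f\<close> over the integers, since \<open>s\<close>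
  is orthogonal to all nonconstant modes. By telescoping, this is the integral of \<open>H\<close> against two modes of
  high frequency, whose averages tend to \<open>0\<close>. As the partial sums converge by assumption, the limit of the
  difference is \<open>0\<close>.
\<close>

lemma poisson_summation:
  fixes f :: "real \<Rightarrow> complex"
  assumes f_meas [measurable]: "f \<in> borel_measurable borel"
    and f_bd: "\<And>x. norm (f x) \<le> C * exp (- \<bar>x\<bar>)"
    and f_lip: "\<And>x. norm (f x - f (of_int (round x))) \<le> C * exp (- \<bar>x\<bar>) * \<bar>x - of_int (round x)\<bar>"
    and hat: "\<And>k. (LINT x|lborel. f x * mode x k) = h k"
    and lim: "(\<lambda>N. h 0 + (\<Sum>k<N. h (int (Suc k)) + h (- int (Suc k)))) \<longlonglongrightarrow> S"
  shows "(\<lambda>n. f (real (Suc n)) + f (- real (Suc n))) sums (S - f 0)"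
proof -
  define E where "E = (\<lambda>x::real. C * exp (- \<bar>x\<bar>))"
  have E_int: "integrable lborel E"
    using integrable_exp_minus_abs[of 1] by (simp add: E_def)
  have C0: "C \<ge> 0" using order_trans[OF norm_ge_zero f_bd[of 0]] by simp
  have f_int: "integrable lborel f"
    using E_int by (rule Bochner_Integration.integrable_bound) (use f_bd C0 in \<open>auto simp: E_def\<close>)
  define s where "s = (\<lambda>x::real. f (of_int (round x)))"
  \<comment> \<open>Where \<open>e(x) = 1\<close>, \<open>x\<close> is an integer and \<open>f x = s x\<close>; division by zero then gives \<open>H x = 0\<close>, as needed in \<open>H_eq\<close>.\<close>
  define H where "H = (\<lambda>x. (f x - s x) / (mode x 1 - 1))"
  have [measurable]: "s \<in> borel_measurable borel" unfolding s_def round_def by measurable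
  have [measurable]: "H \<in> borel_measurable borel" unfolding H_def by measurable
  have H_bd: "norm (H x) \<le> E x" for x
  proof -
    have "norm (f x - s x) \<le> E x * norm (mode x 1 - 1)"
    proof -
      have "norm (f x - s x) \<le> E x * \<bar>x - of_int (round x)\<bar>"
        using f_lip[of x] by (simp add: s_def E_def)
      also have "\<dots> \<le> E x * norm (mode x 1 - 1)"
      proof (rule mult_left_mono)
        show "\<bar>x - of_int (round x)\<bar> \<le> norm (mode x 1 - 1)"
          by (rule order_trans[OF _ norm_mode_minus_1_ge]) simp
      qed (use C0 in \<open>simp add: E_def\<close>)
      finally show ?thesis .
    qed
    moreover have "norm (mode x 1 - 1) > 0" if "mode x 1 \<noteq> 1" using that by simp
    ultimately show ?thesis using C0
      by (cases "mode x 1 = 1") (simp_all add: H_def norm_divide E_def pos_divide_le_eq)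
  qed
  have H_eq: "H x * (mode x 1 - 1) = f x - s x" for x
  proof (cases "mode x 1 = 1")
    case True
    hence "x = of_int (round x)" using norm_mode_minus_1_ge[of x] by simp
    hence "s x = f x" unfolding s_def by metis
    thus ?thesis by (simp add: True)
  qed (simp add: H_def)
  have H_int: "integrable lborel H"
    using E_int by (rule Bochner_Integration.integrable_bound) (use H_bd in \<open>auto intro: order_trans[OF _ abs_ge_self]\<close>)
  define P where "P = (\<lambda>n. if n = 0 then f 0 else f (real n) + f (- real n))"
  have P_sum: "summable (\<lambda>n. norm (P n))"
  proof (rule summable_comparison_test'[where N = 0])
    show "summable (\<lambda>n. 2 * C * exp (-1) ^ n)" by (intro summable_mult summable_geometric) simp
    fix n :: nat
    have e: "exp (- \<bar>real n\<bar>) = exp (-1) ^ n" by (simp flip: exp_of_nat_mult)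
    have "norm (P n) \<le> C * exp (- \<bar>real n\<bar>) + C * exp (- \<bar>- real n\<bar>)"
      using f_bd[of "real n"] f_bd[of "- real n"] C0 by (auto simp: P_def intro: norm_triangle_le)
    thus "norm (norm (P n)) \<le> 2 * C * exp (-1) ^ n" using e by simp
  qed
  have s_hat: "(LINT x|lborel. s x * mode x k) = (if k = 0 then (\<Sum>n. P n) else 0)"
    and s_int: "integrable lborel s" for k
  proof -
    define B where "B = (\<lambda>(m::int) x. indicator {of_int m - 1/2..<of_int m + 1/2} x *\<^sub>R (f (of_int m) * mode x k))" 
    \<comment> \<open>The step function as a series over \<open>n = |m|\<close>; at each \<open>x\<close> only the term of the nearest integer survives.\<close>
    define F where "F = (\<lambda>n x. if n = 0 then B 0 x else B (int n) x + B (- int n) x)"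
    have B_int: "integrable lborel (B m)" for m
    proof -
      have "integrable lborel (\<lambda>x. norm (f (of_int m)) * indicator {of_int m - 1/2..<of_int m + 1/2} (x :: real) :: real)" by simp
      thus ?thesis by (rule Bochner_Integration.integrable_bound) (auto simp: B_def norm_mult indicator_def)
    qed
    have B_val: "(LINT x|lborel. B m x) = (if k = 0 then f (of_int m) else 0)" for m
    proof -
      have "(LINT x|lborel. B m x) = (LINT x|lborel. f (of_int m) * (indicator {of_int m - 1/2..of_int m + 1/2} x *\<^sub>R mode x k))"
      proof (rule integral_cong_AE)
        show "AE x in lborel. B m x = f (of_int m) * (indicator {of_int m - 1/2..of_int m + 1/2} x *\<^sub>R mode x k)"
          by (rule AE_mp[OF AE_lborel_singleton[of "of_int m + 1/2"]]) (auto simp: B_def indicator_def)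
      qed (auto simp: B_def)
      also have "\<dots> = f (of_int m) * (if k = 0 then 1 else 0)"
        by (subst integral_mult_right_zero) (simp only: mode_period_integral)
      finally show ?thesis by simp
    qed
    have B_norm: "(LINT x|lborel. norm (B m x)) = norm (f (of_int m))" for m
    proof -
      have "norm (B m x) = norm (f (of_int m)) * indicator {of_int m - 1/2..<of_int m + 1/2} x" for x
        by (simp add: B_def norm_mult indicator_def)
      thus ?thesis by simp
    qed
    have F_int: "integrable lborel (F n)" for n using B_int by (cases "n = 0") (simp_all add: F_def)
    have F_val: "(LINT x|lborel. F n x) = (if k = 0 then P n else 0)" for n
      using B_int by (simp add: F_def B_val P_def)
    have B_zero: "B m x = 0" if "m \<noteq> round x" for m x
    proof -
      have "\<not> (of_int m - 1/2 \<le> x \<and> x < of_int m + 1/2)"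
      proof
        assume "of_int m - 1/2 \<le> x \<and> x < of_int m + 1/2"
        hence "\<lfloor>x + 1/2\<rfloor> = m" by (intro floor_unique) auto
        thus False using that by (simp add: round_def)
      qed
      thus ?thesis by (auto simp: B_def indicator_def)
    qed
    have B_round: "B (round x) x = s x * mode x k" for x
    proof -
      have "of_int (round x) - 1/2 \<le> x" "x < of_int (round x) + 1/2"
        unfolding round_def using floor_correct[of "x + 1/2"] by linarith+
      thus ?thesis by (simp add: B_def s_def)
    qed
    have F_zero: "F n x = 0" if "n \<noteq> nat \<bar>round x\<bar>" for n x
    proof -
      have "int n \<noteq> round x" "- int n \<noteq> round x" using that by auto
      hence "B (int n) x = 0" "B (- int n) x = 0" by (auto intro: B_zero)
      thus ?thesis by (cases "n = 0") (simp_all add: F_def)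
    qed
    have F_one: "F (nat \<bar>round x\<bar>) x = s x * mode x k" for x
    proof (cases "round x = 0")
      case True
      thus ?thesis using B_round[of x] by (simp add: F_def)
    next
      case False
      hence "- round x \<noteq> round x" by simp
      hence "B (- round x) x = 0" by (rule B_zero)
      thus ?thesis using B_round[of x] False by (cases "round x > 0") (auto simp: F_def)
    qed
    have Fs: "(\<Sum>n. F n x) = s x * mode x k" for x
      using suminf_finite[of "{nat \<bar>round x\<bar>}" "\<lambda>n. F n x"] F_zero F_one by simp
    have sm: "AE x in lborel. summable (\<lambda>n. norm (F n x))"
    proof (rule AE_I2)
      fix x
      show "summable (\<lambda>n. norm (F n x))"
        by (rule summable_finite[of "{nat \<bar>round x\<bar>}"]) (auto simp: F_zero)
    qed
    have si: "summable (\<lambda>n. LINT x|lborel. norm (F n x))"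
    proof (rule summable_comparison_test'[where N = 0])
      show "summable (\<lambda>n. 2 * C * exp (-1) ^ n)" by (intro summable_mult summable_geometric) simp
      fix n :: nat
      have e: "exp (- \<bar>real n\<bar>) = exp (-1) ^ n" by (simp flip: exp_of_nat_mult)
      have "(LINT x|lborel. norm (F n x)) \<le> (LINT x|lborel. norm (B (int n) x) + norm (B (- int n) x))"
        using B_int F_int by (intro integral_mono) (auto simp: F_def norm_triangle_ineq)
      also have "\<dots> = norm (f (real n)) + norm (f (- real n))"
        using B_int by (simp add: B_norm)
      also have "\<dots> \<le> 2 * C * exp (-1) ^ n"
        using f_bd[of "real n"] f_bd[of "- real n"] e by simp
      finally show "norm (LINT x|lborel. norm (F n x)) \<le> 2 * C * exp (-1) ^ n" by simp
    qed
    have "(LINT x|lborel. s x * mode x k) = (\<Sum>n. if k = 0 then P n else 0)"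
      using integral_suminf[OF F_int sm si] by (simp add: Fs F_val)
    thus "(LINT x|lborel. s x * mode x k) = (if k = 0 then (\<Sum>n. P n) else 0)" by simp
    have i: "integrable lborel (\<lambda>x. s x * mode x k)"
      using integrable_suminf[OF F_int sm si] by (simp add: Fs)
    show "integrable lborel s"
      using i by (rule Bochner_Integration.integrable_bound) (auto simp: norm_mult)
  qed
  have fw_int: "integrable lborel (\<lambda>x. f x * mode x k)" for k
    using f_int by (rule Bochner_Integration.integrable_bound) (auto simp: norm_mult)
  have sw_int: "integrable lborel (\<lambda>x. s x * mode x k)" for k
    using s_int by (rule Bochner_Integration.integrable_bound) (auto simp: norm_mult)
  have Hw_int: "integrable lborel (\<lambda>x. H x * mode x k)" for k
    using H_int by (rule Bochner_Integration.integrable_bound) (auto simp: norm_mult)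
  define A where "A = (\<lambda>N. h 0 + (\<Sum>k<N. h (int (Suc k)) + h (- int (Suc k))) - (\<Sum>n. P n))"
  have A_eq: "A N = (LINT x|lborel. H x * (mode x (int N + 1) - mode x (- int N)))" for N
  proof -
    have "(LINT x|lborel. H x * (mode x (int N + 1) - mode x (- int N))) = (LINT x|lborel. (f x - s x) * dirichlet_kernel N x)"
      by (simp flip: dirichlet_kernel_telescope H_eq add: mult.assoc)
    also have "\<dots> = (LINT x|lborel. (f x * mode x 0 - s x * mode x 0) + (\<Sum>k<N. (f x * mode x (int (Suc k)) - s x * mode x (int (Suc k))) + (f x * mode x (- int (Suc k)) - s x * mode x (- int (Suc k)))))"
      unfolding dirichlet_kernel_def
      by (intro Bochner_Integration.integral_cong refl) (simp add: algebra_simps sum_distrib_left sum.distrib sum_subtractf)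
    also have "\<dots> = A N"
      using fw_int sw_int by (simp add: hat s_hat A_def del: of_nat_Suc mode_0)
    finally show ?thesis by simp
  qed
  define W where "W = (\<lambda>M x. \<Sum>N=M..<2*M. mode x (int N + 1) - mode x (- int N))"
  have [measurable]: "W M \<in> borel_measurable borel" for M unfolding W_def by measurable
  have A_lim: "A \<longlonglongrightarrow> S - (\<Sum>n. P n)"
    unfolding A_def by (intro tendsto_intros lim)
  have "(\<lambda>M. (\<Sum>N=M..<2*M. A N) / of_nat M) \<longlonglongrightarrow> integral\<^sup>L (lborel :: real measure) (\<lambda>x. 0)"
  proof -
    have eq: "(\<Sum>N=M..<2*M. A N) / of_nat M = (LINT x|lborel. H x * W M x / of_nat M)" for M
    proof -
      have "(LINT x|lborel. (\<Sum>N=M..<2*M. H x * mode x (int N + 1) - H x * mode x (- int N))) = (\<Sum>N=M..<2*M. A N)"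
        using Hw_int by (simp add: A_eq right_diff_distrib)
      thus ?thesis by (simp add: W_def sum_distrib_left right_diff_distrib)
    qed
    show ?thesis
      unfolding eq
    proof (rule integral_dominated_convergence[where f = "\<lambda>x. 0" and w = "\<lambda>x. 2 * E x"])
      show "integrable lborel (\<lambda>x. 2 * E x)" using E_int by simp
      show "AE x in lborel. (\<lambda>M. H x * W M x / of_nat M) \<longlonglongrightarrow> 0"
      proof (rule AE_I2)
        fix x
        show "(\<lambda>M. H x * W M x / of_nat M) \<longlonglongrightarrow> 0"
        proof (cases "mode x 1 = 1")
          case True
          thus ?thesis by (simp add: H_def)
        next
          case False
          show ?thesis
          proof (rule Lim_null_comparison)
            show "(\<lambda>M. (norm (H x) * 4 / norm (mode x 1 - 1)) * (1 / real M)) \<longlonglongrightarrow> 0"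
              by (intro tendsto_mult_right_zero lim_1_over_n)
            show "\<forall>\<^sub>F M in sequentially. norm (H x * W M x / of_nat M) \<le> (norm (H x) * 4 / norm (mode x 1 - 1)) * (1 / real M)"
            proof (intro always_eventually allI)
              fix M
              have "norm (W M x) \<le> 4 / norm (mode x 1 - 1)"
                using mode_window_bound[of x M] False unfolding norm_mult W_def by (simp add: pos_le_divide_eq mult.commute)
              hence "norm (H x) * norm (W M x) / real M \<le> norm (H x) * (4 / norm (mode x 1 - 1)) / real M"
                by (intro divide_right_mono mult_left_mono) auto
              thus "norm (H x * W M x / of_nat M) \<le> (norm (H x) * 4 / norm (mode x 1 - 1)) * (1 / real M)"
                by (simp add: norm_mult norm_divide)
            qed
          qed
        qed
      qed
      fix M :: nat
      show "AE x in lborel. norm (H x * W M x / of_nat M) \<le> 2 * E x"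
      proof (rule AE_I2)
        fix x
        have "norm (W M x) \<le> (\<Sum>N=M..<2*M. 2)"
          unfolding W_def
        proof (rule sum_norm_le)
          fix N
          have "norm (mode x (int N + 1) - mode x (- int N)) \<le> norm (mode x (int N + 1)) + norm (mode x (- int N))" 
            by (rule norm_triangle_ineq4)
          thus "norm (mode x (int N + 1) - mode x (- int N)) \<le> 2" by simp
        qed
        hence "norm (W M x) / real M \<le> 2"
          by (simp add: divide_le_eq)
        hence "norm (H x) * (norm (W M x) / real M) \<le> E x * 2"
          using H_bd[of x] by (intro mult_mono) (auto intro: order_trans[OF norm_ge_zero])
        thus "norm (H x * W M x / of_nat M) \<le> 2 * E x"
          by (simp add: norm_mult norm_divide)
      qed
    qed measurable
  qed
  hence "S - (\<Sum>n. P n) = 0"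
    using LIMSEQ_unique[OF window_average_tendsto[OF A_lim]] by simp
  moreover have "P sums (\<Sum>n. P n)" using P_sum by (simp add: summable_norm_cancel summable_sums)
  ultimately have "P sums S" by simp
  hence "(\<lambda>n. P (Suc n)) sums (S - P 0)" by (subst sums_Suc_iff) simp
  thus ?thesis by (simp add: P_def)
qed

text \<open>
  Half of a Jacobi theta series without its constant term: \<open>1 + 2 theta_sum w t\<close> is the sum of
  \<open>exp(-(nt)\<^sup>2 + i w n t)\<close> over all integers \<open>n\<close>.
\<close>

definition theta_sum :: "complex \<Rightarrow> real \<Rightarrow> complex" where
  "theta_sum w t = (\<Sum>n. gauss_cos w (real (Suc n) * t))"

lemma summable_inverse_Suc_power:
  assumes "2 \<le> p"
  shows "summable (\<lambda>n. 1 / real (Suc n) ^ p)"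
proof -
  have "summable (\<lambda>n. inverse (real n ^ p))" using assms by (rule inverse_power_summable)
  hence "summable (\<lambda>n. inverse (real (Suc n) ^ p))" by (subst summable_Suc_iff)
  thus ?thesis by (simp add: inverse_eq_divide)
qed

lemma gauss_cos_scaled_bound:
  obtains C where "C \<ge> 0" "\<And>x. x > 0 \<Longrightarrow> norm (gauss_cos w x) \<le> C / x ^ p"
proof -
  obtain C where C: "C \<ge> 0" "\<And>t. t \<ge> 0 \<Longrightarrow> norm (gauss_cos w t) * t ^ p \<le> C" using gauss_cos_pow_bound[of w p] by blast
  show ?thesis
    by (rule that[OF C(1)]) (use C(2) in \<open>simp add: pos_le_divide_eq\<close>)
qed

lemma theta_sum_summable:
  assumes t: "t > 0"
  shows "summable (\<lambda>n. norm (gauss_cos w (real (Suc n) * t)))"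
proof -
  obtain C where C: "C \<ge> 0" "\<And>x. x > 0 \<Longrightarrow> norm (gauss_cos w x) \<le> C / x ^ 2" using gauss_cos_scaled_bound by blast
  have "summable (\<lambda>n. C / t ^ 2 * (1 / real (Suc n) ^ 2))"
    by (intro summable_mult summable_inverse_Suc_power) simp
  thus ?thesis
  proof (rule summable_comparison_test'[where N = 0])
    fix n :: nat
    have "norm (gauss_cos w (real (Suc n) * t)) \<le> C / (real (Suc n) * t) ^ 2" by (rule C(2)) (use t in simp)
    also have "\<dots> = C / t ^ 2 * (1 / real (Suc n) ^ 2)" by (simp add: power_mult_distrib mult.commute del: of_nat_Suc)
    finally show "norm (norm (gauss_cos w (real (Suc n) * t))) \<le> C / t ^ 2 * (1 / real (Suc n) ^ 2)" by simp
  qed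
qed

lemma theta_sum_sums: "t > 0 \<Longrightarrow> (\<lambda>n. gauss_cos w (real (Suc n) * t)) sums theta_sum w t"
  unfolding theta_sum_def by (rule summable_sums[OF summable_norm_cancel[OF theta_sum_summable]])

lemma theta_sum_bound:
  assumes p: "2 \<le> p"
  obtains C where "C \<ge> 0" "\<And>t. t > 0 \<Longrightarrow> norm (theta_sum w t) \<le> C / t ^ p"
proof -
  obtain C where C: "C \<ge> 0" "\<And>x. x > 0 \<Longrightarrow> norm (gauss_cos w x) \<le> C / x ^ p" using gauss_cos_scaled_bound by blast
  define Z where "Z = (\<Sum>n. 1 / real (Suc n) ^ p)"
  have Z0: "Z \<ge> 0" unfolding Z_def by (intro suminf_nonneg summable_inverse_Suc_power p) simp
  have "norm (theta_sum w t) \<le> C * Z / t ^ p" if t: "t > 0" for t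
  proof -
    have "norm (theta_sum w t) \<le> (\<Sum>n. C / t ^ p * (1 / real (Suc n) ^ p))"
      unfolding theta_sum_def
    proof (rule norm_suminf_le)
      fix n
      have "norm (gauss_cos w (real (Suc n) * t)) \<le> C / (real (Suc n) * t) ^ p" by (rule C(2)) (use t in simp)
      also have "\<dots> = C / t ^ p * (1 / real (Suc n) ^ p)" by (simp add: power_mult_distrib mult.commute del: of_nat_Suc)
      finally show "norm (gauss_cos w (real (Suc n) * t)) \<le> C / t ^ p * (1 / real (Suc n) ^ p)" .
    qed (intro summable_mult summable_inverse_Suc_power p)
    also have "\<dots> = C / t ^ p * Z" unfolding Z_def by (intro suminf_mult summable_inverse_Suc_power p)
    finally show ?thesis by simp
  qed
  thus ?thesis using C(1) Z0 by (intro that[of "C * Z"]) auto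
qed

lemma gauss_cos_eq_exp: "2 * gauss_cos w x = exp (- (of_real x)\<^sup>2) * (exp (\<i> * w * of_real x) + exp (- (\<i> * w * of_real x)))"
  by (simp add: gauss_cos_def cos_exp_eq mult_ac)

text \<open>
  Jacobi's transformation: Poisson summation for \<open>exp(-(t x)\<^sup>2 + i w t x)\<close>. The transform of this
  function at the frequency \<open>k\<close> is a Gaussian centred at a shifted point; pairing \<open>k\<close> with \<open>-k\<close> collects the
  shift in a cosine with parameter \<open>iw\<close>.
\<close>

lemma theta_sum_transform:
  assumes t: "t > 0"
  shows "1 + 2 * theta_sum w t = of_real (sqrt pi / t) * exp (- (w\<^sup>2 / 4)) * (1 + 2 * theta_sum (\<i> * w) (pi / t))"
proof -
  define c where "c = \<i> * w * of_real t"
  define F where "F = (\<lambda>z::complex. exp (- ((of_real t)\<^sup>2 * z\<^sup>2) + c * z))"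
  define f where "f = (\<lambda>x::real. F (of_real x))"
  define h where "h = (\<lambda>k::int. of_real (sqrt (pi / t\<^sup>2)) * exp ((c + 2 * pi * \<i> * of_int k)\<^sup>2 / (4 * of_real (t\<^sup>2))))"
  have quad: "- (t\<^sup>2 * u\<^sup>2) + \<beta> * \<bar>u\<bar> \<le> \<beta>\<^sup>2 / (4 * t\<^sup>2)" for u \<beta> :: real
  proof -
    have "0 \<le> (t * \<bar>u\<bar> - \<beta> / (2 * t))\<^sup>2" by simp
    also have "\<dots> = t\<^sup>2 * u\<^sup>2 - \<beta> * \<bar>u\<bar> + \<beta>\<^sup>2 / (4 * t\<^sup>2)"
      using t by (simp add: power2_diff power_mult_distrib power_divide)
    finally show ?thesis by simp
  qed
  have normF: "norm (F (of_real u)) \<le> exp (- (t\<^sup>2 * u\<^sup>2) + norm c * \<bar>u\<bar>)" for u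
  proof -
    have "F (of_real u) = of_real (exp (- (t\<^sup>2 * u\<^sup>2))) * exp (c * of_real u)"
      unfolding F_def exp_add by (simp flip: exp_of_real)
    moreover have "norm (exp (c * of_real u)) \<le> exp (norm c * \<bar>u\<bar>)"
      using norm_exp[of "c * of_real u"] by (simp add: norm_mult)
    ultimately show ?thesis unfolding exp_add
      by (simp only: norm_mult norm_of_real abs_exp_cancel mult_left_mono exp_ge_zero)
  qed
  define C0 where "C0 = exp ((norm c + 1)\<^sup>2 / (4 * t\<^sup>2))"
  define C1 where "C1 = (norm c + 2 * t\<^sup>2) * exp ((norm c + 2)\<^sup>2 / (4 * t\<^sup>2)) * exp (1/2)"
  have C01: "C0 \<ge> 0" "C1 \<ge> 0" by (auto simp: C0_def C1_def)
  have b0: "norm (f x) \<le> C0 * exp (- \<bar>x\<bar>)" for x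
  proof -
    have "norm (f x) \<le> exp ((- (t\<^sup>2 * x\<^sup>2) + (norm c + 1) * \<bar>x\<bar>) - \<bar>x\<bar>)"
      using normF[of x] by (simp add: f_def algebra_simps)
    also have "\<dots> \<le> exp ((norm c + 1)\<^sup>2 / (4 * t\<^sup>2) - \<bar>x\<bar>)"
      using quad[of x "norm c + 1"] by simp
    finally show ?thesis by (simp add: C0_def flip: exp_add)
  qed
  have b1: "norm (f x - f (of_int (round x))) \<le> C1 * exp (- \<bar>x\<bar>) * \<bar>x - of_int (round x)\<bar>" for x
  proof -
    let ?n = "of_int (round x) :: real"
    have "norm (F (of_real x) - F (of_real ?n)) \<le> (C1 * exp (- \<bar>x\<bar>)) * norm (complex_of_real x - of_real ?n)"
    proof (rule field_differentiable_bound[where S = "closed_segment (of_real x) (of_real ?n)"])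
      fix z :: complex assume "z \<in> closed_segment (of_real x) (of_real ?n)"
      then obtain u where u: "z = of_real u" "u \<in> closed_segment x ?n" unfolding closed_segment_of_real by blast
      show "(F has_field_derivative (F z * (c - 2 * (of_real t)\<^sup>2 * z))) (at z within closed_segment (of_real x) (of_real ?n))"
        unfolding F_def by (auto intro!: derivative_eq_intros)
      \<comment> \<open>Between \<open>x\<close> and the nearest integer \<open>|u|\<close> is at least \<open>|x| - 1/2\<close>; this is the factor \<open>exp(1/2)\<close> in \<open>C1\<close>.\<close>
      have "\<bar>x - u\<bar> \<le> \<bar>x - ?n\<bar>" using u(2) by (auto simp: closed_segment_eq_real_ivl split: if_splits)
      moreover have "\<bar>x - ?n\<bar> \<le> 1/2" using of_int_round_abs_le[of x] by (simp add: abs_minus_commute)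
      ultimately have xu: "\<bar>x\<bar> - \<bar>u\<bar> \<le> 1/2" by linarith
      have e1: "1 \<le> exp \<bar>u\<bar>" "\<bar>u\<bar> \<le> exp \<bar>u\<bar>" using exp_ge_add_one_self[of "\<bar>u\<bar>"] by linarith+
      have "norm (c - 2 * (of_real t)\<^sup>2 * z) \<le> norm c + 2 * t\<^sup>2 * \<bar>u\<bar>"
        using norm_triangle_ineq4[of c "2 * (of_real t)\<^sup>2 * z"] by (simp add: u norm_mult norm_power)
      also have "\<dots> \<le> norm c * exp \<bar>u\<bar> + 2 * t\<^sup>2 * exp \<bar>u\<bar>"
        using e1 mult_left_mono[OF e1(1), of "norm c"] by (intro add_mono mult_left_mono) auto
      finally have "norm (F z) * norm (c - 2 * (of_real t)\<^sup>2 * z) \<le> exp (- (t\<^sup>2 * u\<^sup>2) + norm c * \<bar>u\<bar>) * ((norm c + 2 * t\<^sup>2) * exp \<bar>u\<bar>)"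
        using normF[of u] by (intro mult_mono) (auto simp: u algebra_simps)
      also have "\<dots> = (norm c + 2 * t\<^sup>2) * exp ((- (t\<^sup>2 * u\<^sup>2) + (norm c + 2) * \<bar>u\<bar>) - \<bar>u\<bar>)"
      proof -
        have "exp ((- (t\<^sup>2 * u\<^sup>2) + (norm c + 2) * \<bar>u\<bar>) - \<bar>u\<bar>) = exp (- (t\<^sup>2 * u\<^sup>2) + norm c * \<bar>u\<bar>) * exp \<bar>u\<bar>"
          by (subst exp_add[symmetric]) (simp add: algebra_simps)
        thus ?thesis by simp
      qed
      also have "\<dots> \<le> (norm c + 2 * t\<^sup>2) * exp ((norm c + 2)\<^sup>2 / (4 * t\<^sup>2) + 1/2 - \<bar>x\<bar>)"
      proof (rule mult_left_mono)
        have "- (t\<^sup>2 * u\<^sup>2) + (norm c + 2) * \<bar>u\<bar> - \<bar>u\<bar> \<le> (norm c + 2)\<^sup>2 / (4 * t\<^sup>2) + 1/2 - \<bar>x\<bar>"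
          using quad[of u "norm c + 2"] xu by linarith
        thus "exp (- (t\<^sup>2 * u\<^sup>2) + (norm c + 2) * \<bar>u\<bar> - \<bar>u\<bar>) \<le> exp ((norm c + 2)\<^sup>2 / (4 * t\<^sup>2) + 1/2 - \<bar>x\<bar>)" by simp
      qed simp
      also have "\<dots> = C1 * exp (- \<bar>x\<bar>)" by (simp add: C1_def mult.assoc add.assoc flip: exp_add)
      finally show "norm (F z * (c - 2 * (of_real t)\<^sup>2 * z)) \<le> C1 * exp (- \<bar>x\<bar>)" by (simp add: norm_mult)
    qed auto
    moreover have "norm (complex_of_real x - of_real ?n) = \<bar>x - ?n\<bar>"
      by (metis norm_of_real of_real_diff)
    ultimately show ?thesis by (simp add: f_def)
  qed
  have hat: "(LINT x|lborel. f x * mode x k) = h k" for k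
  proof -
    have "f x * mode x k = of_real (exp (- (t\<^sup>2 * x\<^sup>2))) * exp ((c + 2 * pi * \<i> * of_int k) * of_real x)" for x
      unfolding f_def F_def mode_def exp_add ring_distribs by (simp add: mult.assoc flip: exp_of_real)
    thus ?thesis using has_bochner_integral_gaussian[of "t\<^sup>2" "c + 2 * pi * \<i> * of_int k"] t
      by (simp add: has_bochner_integral_iff h_def)
  qed
  have h0: "h 0 = of_real (sqrt pi / t) * exp (- (w\<^sup>2 / 4))"
    using t by (simp add: h_def c_def power_mult_distrib real_sqrt_divide)
  have hk: "h (int (Suc k)) + h (- int (Suc k)) = h 0 * (2 * gauss_cos (\<i> * w) (real (Suc k) * (pi / t)))" for k
  proof -
    define x where "x = complex_of_real (real (Suc k) * (pi / t))"
    have T: "(complex_of_real t)\<^sup>2 \<noteq> 0" using t by simp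
    have e: "(c + 2 * pi * \<i> * of_int j)\<^sup>2 / (4 * of_real (t\<^sup>2)) = - (w\<^sup>2 / 4) + (- x\<^sup>2 - of_int (sgn j) * w * x)"
      if "j = int (Suc k) \<or> j = - int (Suc k)" for j
    proof -
      have j: "of_int j = of_int (sgn j) * complex_of_real (real (Suc k))" "(of_int (sgn j))\<^sup>2 = (1::complex)" using that by auto
      have x: "complex_of_real (real (Suc k)) * pi = x * t" using t by (simp add: x_def)
      have "c + 2 * pi * \<i> * of_int j = \<i> * of_real t * (w + 2 * of_int (sgn j) * x)"
        using x unfolding j(1) c_def by (simp add: algebra_simps del: of_nat_Suc)
      hence "(c + 2 * pi * \<i> * of_int j)\<^sup>2 = - ((of_real t)\<^sup>2 * (w\<^sup>2 + 4 * of_int (sgn j) * w * x + 4 * x\<^sup>2 * (of_int (sgn j))\<^sup>2))"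
        by (simp add: power2_eq_square algebra_simps)
      hence "(c + 2 * pi * \<i> * of_int j)\<^sup>2 / (4 * of_real (t\<^sup>2)) = - ((w\<^sup>2 + 4 * of_int (sgn j) * w * x + 4 * x\<^sup>2) / 4)"
        using T unfolding j(2) by simp
      thus ?thesis by (simp add: add_divide_distrib)
    qed
    have "h (int (Suc k)) + h (- int (Suc k)) = of_real (sqrt (pi / t\<^sup>2)) * (exp (- (w\<^sup>2 / 4)) * (exp (- x\<^sup>2 - w * x) + exp (- x\<^sup>2 + w * x)))"
    proof -
      have "h (int (Suc k)) = of_real (sqrt (pi / t\<^sup>2)) * (exp (- (w\<^sup>2 / 4)) * exp (- x\<^sup>2 - w * x))"
        unfolding h_def e[OF disjI1[OF refl]] exp_add by simp
      moreover have "h (- int (Suc k)) = of_real (sqrt (pi / t\<^sup>2)) * (exp (- (w\<^sup>2 / 4)) * exp (- x\<^sup>2 + w * x))"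
        unfolding h_def e[OF disjI2[OF refl]] exp_add[of "- (w\<^sup>2 / 4)"] by simp
      ultimately show ?thesis by (simp add: ring_distribs)
    qed
    also have "exp (- x\<^sup>2 - w * x) + exp (- x\<^sup>2 + w * x) = 2 * gauss_cos (\<i> * w) (real (Suc k) * (pi / t))"
    proof -
      have "\<i> * (\<i> * w) * x = - (w * x)" by (simp flip: mult.assoc)
      thus ?thesis unfolding gauss_cos_eq_exp x_def[symmetric] by (simp add: ring_distribs flip: exp_add)
    qed
    finally show ?thesis unfolding h0 using t by (simp add: real_sqrt_divide mult.assoc)
  qed
  have lim: "(\<lambda>N. h 0 + (\<Sum>k<N. h (int (Suc k)) + h (- int (Suc k)))) \<longlonglongrightarrow> h 0 + h 0 * (2 * theta_sum (\<i> * w) (pi / t))"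
  proof -
    have "(\<lambda>k. h 0 * (2 * gauss_cos (\<i> * w) (real (Suc k) * (pi / t)))) sums (h 0 * (2 * theta_sum (\<i> * w) (pi / t)))"
      using t by (intro sums_mult theta_sum_sums) simp
    thus ?thesis unfolding hk sums_def by (intro tendsto_intros)
  qed
  have "(\<lambda>n. f (real (Suc n)) + f (- real (Suc n))) sums (h 0 + h 0 * (2 * theta_sum (\<i> * w) (pi / t)) - f 0)"
  proof (rule poisson_summation[OF _ _ _ hat lim])
    show "f \<in> borel_measurable borel"
      unfolding f_def F_def by (intro borel_measurable_continuous_onI continuous_intros)
    fix x
    show "norm (f x) \<le> (C0 + C1) * exp (- \<bar>x\<bar>)"
      using b0[of x] C01 by (simp add: ring_distribs add_increasing2)
    show "norm (f x - f (of_int (round x))) \<le> (C0 + C1) * exp (- \<bar>x\<bar>) * \<bar>x - of_int (round x)\<bar>"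
      using b1[of x] C01 by (simp add: ring_distribs add_increasing)
  qed
  moreover have "f (real (Suc n)) + f (- real (Suc n)) = 2 * gauss_cos w (real (Suc n) * t)" for n
    unfolding gauss_cos_eq_exp f_def F_def c_def exp_add
    by (simp add: power_mult_distrib ring_distribs mult_ac del: of_nat_Suc)
  moreover have "(\<lambda>n. 2 * gauss_cos w (real (Suc n) * t)) sums (2 * theta_sum w t)"
    using t by (intro sums_mult theta_sum_sums)
  ultimately have "h 0 + h 0 * (2 * theta_sum (\<i> * w) (pi / t)) - f 0 = 2 * theta_sum w t"
    by (simp only: sums_iff)
  moreover have "f 0 = 1" by (simp add: f_def F_def)
  ultimately have "1 + 2 * theta_sum w t = h 0 + h 0 * (2 * theta_sum (\<i> * w) (pi / t))"
    by (simp add: diff_eq_eq add.commute)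
  also have "\<dots> = h 0 * (1 + 2 * theta_sum (\<i> * w) (pi / t))" by (simp only: ring_distribs mult_1_right)
  finally show ?thesis by (simp only: h0)
qed

section \<open>The divisor sums as an integral\<close>

text \<open>
  The pairs of positive integers are grouped by their product.
\<close>

lemma dirichlet_product_sums:
  fixes A B :: "nat \<Rightarrow> complex"
  assumes A: "summable (\<lambda>n. norm (A (Suc n)))" "(\<lambda>n. A (Suc n)) sums SA"
    and B: "summable (\<lambda>n. norm (B (Suc n)))" "(\<lambda>n. B (Suc n)) sums SB"
  shows "(\<lambda>n. \<Sum>d | d dvd Suc n. A d * B (Suc n div d)) sums (SA * SB)"
proof -
  define f where "f = (\<lambda>(i, j). A (Suc i) * B (Suc j))"
  have hA: "((\<lambda>n. A (Suc n)) has_sum SA) UNIV" by (rule norm_summable_imp_has_sum[OF A])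
  have hB: "((\<lambda>n. B (Suc n)) has_sum SB) UNIV" by (rule norm_summable_imp_has_sum[OF B])
  have nA: "(\<lambda>n. norm (A (Suc n))) summable_on UNIV"
    by (rule norm_summable_imp_summable_on) (use A in simp)
  have nB: "(\<lambda>n. norm (B (Suc n))) summable_on UNIV"
    by (rule norm_summable_imp_summable_on) (use B in simp)
  have "Infinite_Sum.abs_summable_on f (UNIV \<times> UNIV)"
    unfolding Infinite_Sum.abs_summable_on_Sigma_iff
  proof (intro conjI ballI)
    show "Infinite_Sum.abs_summable_on (\<lambda>y. f (x, y)) UNIV" for x
      unfolding f_def using nB by (simp add: norm_mult summable_on_cmult_right)
    have "(\<lambda>x. norm (A (Suc x)) * infsum (\<lambda>y. norm (B (Suc y))) UNIV) summable_on UNIV"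
      by (intro summable_on_cmult_left nA)
    thus "Infinite_Sum.abs_summable_on (\<lambda>x. infsum (\<lambda>y. norm (f (x, y))) UNIV) UNIV"
      using infsum_nonneg[of UNIV "\<lambda>y. norm (B (Suc y))"]
      by (simp add: f_def norm_mult infsum_cmult_right' abs_mult)
  qed
  hence "f summable_on (UNIV \<times> UNIV)" by (rule abs_summable_summable)
  hence hf: "(f has_sum (SA * SB)) (UNIV \<times> UNIV)"
  proof (intro has_sum_SigmaI)
    show "((\<lambda>y. f (x, y)) has_sum (A (Suc x) * SB)) UNIV" for x
      unfolding f_def using hB by (simp add: has_sum_cmult_right)
    show "((\<lambda>x. A (Suc x) * SB) has_sum SA * SB) UNIV" by (intro has_sum_cmult_left hA)
  qed
  define g where "g = (\<lambda>(n, d). A d * B (Suc n div d))"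
  have "(g has_sum (SA * SB)) (Sigma UNIV (\<lambda>n. {d. d dvd Suc n})) = (f has_sum (SA * SB)) (UNIV \<times> UNIV)"
  proof (rule has_sum_reindex_bij_witness[where i = "\<lambda>(i, k). (Suc i * Suc k - 1, Suc i)" and j = "\<lambda>(n, d). (d - 1, Suc n div d - 1)"], goal_cases)
    case (1 a)
    obtain n d where a: "a = (n, d)" by force
    with 1 have d: "d dvd Suc n" by simp
    then obtain e where e: "Suc n = d * e" by blast
    have "d > 0" "e > 0" using e by (auto intro: gr0I)
    hence "Suc (d - 1) = d" "Suc (e - 1) = e" "Suc n div d = e" using e by auto
    moreover have "d * e - 1 = n" using e by simp
    ultimately show ?case by (simp only: a prod.case)
  next
    case (3 b)
    obtain i k where b: "b = (i, k)" by force
    have "Suc (Suc i * Suc k - 1) = Suc i * Suc k" by simp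
    thus ?case by (simp add: b del: mult_Suc mult_Suc_right)
  next
    case (4 b)
    obtain i k where b: "b = (i, k)" by force
    have "Suc (Suc i * Suc k - 1) = Suc i * Suc k" by simp
    thus ?case by (simp add: b del: mult_Suc mult_Suc_right)
  next
    case (5 a)
    obtain n d where a: "a = (n, d)" by force
    with 5 have d: "d dvd Suc n" by simp
    then obtain e where e: "Suc n = d * e" by blast
    have "d > 0" "e > 0" using e by (auto intro: gr0I)
    thus ?case using e by (simp add: a f_def g_def)
  qed auto
  with hf have hg: "(g has_sum (SA * SB)) (Sigma UNIV (\<lambda>n. {d. d dvd Suc n}))" by simp
  have "((\<lambda>n. \<Sum>d | d dvd Suc n. A d * B (Suc n div d)) has_sum (SA * SB)) UNIV"
  proof (rule has_sum_SigmaD[OF hg])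
    fix n :: nat
    have "((\<lambda>d. g (n, d)) has_sum (\<Sum>d\<in>{d. d dvd Suc n}. g (n, d))) {d. d dvd Suc n}"
      by (rule has_sum_finite) simp
    thus "((\<lambda>d. g (n, d)) has_sum (\<Sum>d | d dvd Suc n. A d * B (Suc n div d))) {d. d dvd Suc n}"
      by (simp add: g_def)
  qed
  thus ?thesis by (rule has_sum_imp_sums)
qed

text \<open>
  The contribution of the factorization \<open>n = d e\<close> to the series, as an integrand.
\<close>

definition gauss_cos_pair :: "complex \<Rightarrow> real \<Rightarrow> complex \<Rightarrow> nat \<Rightarrow> nat \<Rightarrow> real \<Rightarrow> complex" where
  "gauss_cos_pair w \<beta> z d e v = gauss_cos w (real d * (\<beta> * exp v)) * gauss_cos w (real e * (\<beta> * exp (- v))) * exp (z * of_real v)"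

lemma gauss_cos_pair_measurable [measurable]: "gauss_cos_pair w \<beta> z d e \<in> borel_measurable borel"
  unfolding gauss_cos_pair_def gauss_cos_def by (intro borel_measurable_continuous_onI continuous_intros)

text \<open>
  For \<open>v \<ge> 0\<close> the first factor supplies the decay in \<open>v\<close>: it is bounded by a power \<open>p\<close> of
  \<open>exp(-v)\<close> that is large enough to absorb \<open>exp(R v)\<close> and the growth \<open>exp(3 v)\<close> lost in bounding the
  second factor by an inverse cube.
\<close>

lemma gauss_cos_pair_half_bound:
  assumes \<beta>: "\<beta> > 0" and R: "0 \<le> R"
  obtains C where "C \<ge> 0"
    "\<And>d e v. \<lbrakk>0 < d; 0 < e; 0 \<le> v\<rbrakk> \<Longrightarrow> norm (gauss_cos w (real d * (\<beta> * exp v))) * norm (gauss_cos w (real e * (\<beta> * exp (- v)))) * exp (R * v)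
       \<le> C / (real d ^ 3 * real e ^ 3) * exp (- v)"
proof -
  \<comment> \<open>\<open>R\<close> and \<open>3\<close> are used up below; one more power remains for \<open>exp(-v)\<close>.\<close>
  obtain p :: nat where p0: "real p \<ge> R + 4" using real_arch_simple by blast
  hence p: "3 \<le> p" using R by linarith
  obtain C1 where C1: "C1 \<ge> 0" "\<And>x. x > 0 \<Longrightarrow> norm (gauss_cos w x) \<le> C1 / x ^ p" using gauss_cos_scaled_bound by blast
  obtain C2 where C2: "C2 \<ge> 0" "\<And>x. x > 0 \<Longrightarrow> norm (gauss_cos w x) \<le> C2 / x ^ 3" using gauss_cos_scaled_bound by blast
  define C where "C = C1 * C2 / (\<beta> ^ p * \<beta> ^ 3)"
  show ?thesis
  proof (rule that)
    show "C \<ge> 0" using C1 C2 \<beta> by (simp add: C_def)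
    fix d e :: nat and v :: real
    assume d: "0 < d" and e: "0 < e" and v: "0 \<le> v"
    have "norm (gauss_cos w (real d * (\<beta> * exp v))) \<le> C1 / (real d * (\<beta> * exp v)) ^ p"
      using d \<beta> by (intro C1(2)) simp
    also have "\<dots> = C1 / \<beta> ^ p / real d ^ p * exp (- (real p * v))"
      by (simp add: power_mult_distrib exp_minus divide_inverse mult_ac flip: exp_of_nat_mult)
    also have "\<dots> \<le> C1 / \<beta> ^ p / real d ^ 3 * exp (- (real p * v))"
      using d \<beta> C1 p by (intro mult_right_mono divide_left_mono power_increasing) auto
    finally have 1: "norm (gauss_cos w (real d * (\<beta> * exp v))) \<le> C1 / \<beta> ^ p / real d ^ 3 * exp (- (real p * v))" .
    have "norm (gauss_cos w (real e * (\<beta> * exp (- v)))) \<le> C2 / (real e * (\<beta> * exp (- v))) ^ 3"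
      using e \<beta> by (intro C2(2)) simp
    also have "\<dots> = C2 / \<beta> ^ 3 / real e ^ 3 * exp (3 * v)"
    proof -
      have "exp (- v) ^ 3 = inverse (exp (3 * v))"
        using exp_of_nat_mult[of 3 "- v"] by (simp add: exp_minus)
      thus ?thesis by (simp add: power_mult_distrib divide_inverse mult_ac)
    qed
    finally have 2: "norm (gauss_cos w (real e * (\<beta> * exp (- v)))) \<le> C2 / \<beta> ^ 3 / real e ^ 3 * exp (3 * v)" .
    have "norm (gauss_cos w (real d * (\<beta> * exp v))) * norm (gauss_cos w (real e * (\<beta> * exp (- v)))) * exp (R * v)
       \<le> (C1 / \<beta> ^ p / real d ^ 3 * exp (- (real p * v))) * (C2 / \<beta> ^ 3 / real e ^ 3 * exp (3 * v)) * exp (R * v)"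
      using C1 \<beta> by (intro mult_right_mono mult_mono 1 2) auto
    also have "\<dots> = C / (real d ^ 3 * real e ^ 3) * (exp (- (real p * v)) * exp (3 * v) * exp (R * v))"
      by (simp add: C_def mult_ac)
    also have "exp (- (real p * v)) * exp (3 * v) * exp (R * v) = exp (- ((real p - 3 - R) * v))"
      by (simp add: algebra_simps flip: exp_add)
    also have "C / (real d ^ 3 * real e ^ 3) * exp (- ((real p - 3 - R) * v)) \<le> C / (real d ^ 3 * real e ^ 3) * exp (- v)"
    proof (rule mult_left_mono)
      have "1 * v \<le> (real p - 3 - R) * v" using p0 v by (intro mult_right_mono) auto
      thus "exp (- ((real p - 3 - R) * v)) \<le> exp (- v)" by simp
      show "0 \<le> C / (real d ^ 3 * real e ^ 3)" using \<open>C \<ge> 0\<close> by simp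
    qed
    finally show "norm (gauss_cos w (real d * (\<beta> * exp v))) * norm (gauss_cos w (real e * (\<beta> * exp (- v)))) * exp (R * v)
       \<le> C / (real d ^ 3 * real e ^ 3) * exp (- v)" .
  qed
qed

text \<open>
  Exchanging \<open>d\<close> and \<open>e\<close> reflects \<open>v\<close>, which reduces negative \<open>v\<close> to the previous bound. The inverse
  cubes leave a summable \<open>n\<^sup>-\<^sup>2\<close> after the at most \<open>n\<close> divisors of \<open>n = d e\<close> have been counted.
\<close>

lemma gauss_cos_pair_bound:
  assumes \<beta>: "\<beta> > 0"
  obtains C where "C \<ge> 0"
    "\<And>d e v. \<lbrakk>0 < d; 0 < e\<rbrakk> \<Longrightarrow> norm (gauss_cos_pair w \<beta> z d e v) \<le> C / (real d ^ 3 * real e ^ 3) * exp (- \<bar>v\<bar>)"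
proof -
  obtain C where C: "C \<ge> 0" "\<And>d e v. \<lbrakk>0 < d; 0 < e; 0 \<le> v\<rbrakk> \<Longrightarrow> norm (gauss_cos w (real d * (\<beta> * exp v))) * norm (gauss_cos w (real e * (\<beta> * exp (- v)))) * exp (\<bar>Re z\<bar> * v)
       \<le> C / (real d ^ 3 * real e ^ 3) * exp (- v)"
    using gauss_cos_pair_half_bound[OF \<beta>, of "\<bar>Re z\<bar>" w] by (metis abs_ge_zero)
  have "norm (gauss_cos_pair w \<beta> z d e v) \<le> C / (real d ^ 3 * real e ^ 3) * exp (- \<bar>v\<bar>)" if de: "0 < d" "0 < e" for d e v
  proof -
    have "norm (gauss_cos_pair w \<beta> z d e v) = norm (gauss_cos w (real d * (\<beta> * exp v))) * norm (gauss_cos w (real e * (\<beta> * exp (- v)))) * exp (Re z * v)"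
      by (simp add: gauss_cos_pair_def norm_mult)
    also have "\<dots> \<le> norm (gauss_cos w (real d * (\<beta> * exp v))) * norm (gauss_cos w (real e * (\<beta> * exp (- v)))) * exp (\<bar>Re z\<bar> * \<bar>v\<bar>)"
      by (intro mult_left_mono) (auto simp flip: abs_mult)
    also have "\<dots> \<le> C / (real d ^ 3 * real e ^ 3) * exp (- \<bar>v\<bar>)"
    proof (cases "v \<ge> 0")
      case True
      thus ?thesis using C(2)[OF de, of v] by simp
    next
      case False
      thus ?thesis using C(2)[OF de(2,1), of "- v"] by (simp add: mult_ac)
    qed
    finally show ?thesis .
  qed
  thus ?thesis using C(1) that by blast
qed

text \<open>
  Translating \<open>v\<close> by \<open>ln (d \<surd>b)\<close> makes the two arguments \<open>d \<surd>b exp v\<close> and \<open>e \<surd>b exp(-v)\<close>. The factor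
  \<open>(d \<surd>b)\<^sup>z\<close> that this costs is cancelled by \<open>d\<^sup>-\<^sup>z\<close> from \<open>divisor_sigma\<close> and by \<open>b\<^sup>-\<^sup>z\<^sup>/\<^sup>2\<close>.
\<close>

lemma bessel_conv_rescale:
  assumes b: "b > 0" and d: "d > 0" and n: "n = d * e"
  shows "of_nat d powr (- z) * of_real b powr (- (z / 2)) * bessel_conv (z / 2) w (real n * b)
       = (LINT v|lborel. gauss_cos_pair w (sqrt b) z d e v)"
proof -
  define h where "h = ln (real d * sqrt b)"
  have db: "real d * sqrt b > 0" using b d by simp
  have eh: "exp h = real d * sqrt b" using db by (simp add: h_def)
  have sb: "sqrt b * sqrt b = b" using b by simp
  have "bessel_conv (z / 2) w (real n * b) = (LINT v|lborel. gauss_cos w (exp (h + 1 * v)) * gauss_cos w (real n * b * exp (- (h + 1 * v))) * exp (2 * (z / 2) * of_real (h + 1 * v)))"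
    unfolding bessel_conv_def
    by (subst lborel_integral_real_affine[where c = 1 and t = h]) simp_all
  also have "\<dots> = (LINT v|lborel. exp (z * of_real h) * gauss_cos_pair w (sqrt b) z d e v)"
  proof (rule Bochner_Integration.integral_cong[OF refl])
    fix v
    have 1: "exp (h + 1 * v) = real d * (sqrt b * exp v)" by (simp add: exp_add eh mult.assoc)
    have 2: "real n * b * exp (- (h + 1 * v)) = real e * (sqrt b * exp (- v))"
    proof -
      have "real n * b * exp (- (h + 1 * v)) = real n * b * inverse (exp h) * exp (- v)"
      proof -
        have "exp (- (h + 1 * v)) = exp (- h) * exp (- v)" by (simp flip: exp_add)
        thus ?thesis by (simp add: exp_minus[of h])
      qed
      also have "\<dots> = real n * (sqrt b * sqrt b) * inverse (real d * sqrt b) * exp (- v)" by (simp only: sb eh)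
      also have "\<dots> = real e * (sqrt b * exp (- v))"
      proof -
        have "real n * (sqrt b * sqrt b) = real e * sqrt b * (real d * sqrt b)"
          by (simp only: n of_nat_mult mult_ac)
        moreover have "(real d * sqrt b) * inverse (real d * sqrt b) = 1" by (rule right_inverse[OF not_sym[OF less_imp_neq[OF db]]])
        ultimately show ?thesis by (metis mult.assoc mult.right_neutral)
      qed
      finally show ?thesis .
    qed
    have 3: "exp (2 * (z / 2) * of_real (h + 1 * v)) = exp (z * of_real h) * exp (z * of_real v)"
      by (simp add: ring_distribs exp_add)
    show "gauss_cos w (exp (h + 1 * v)) * gauss_cos w (real n * b * exp (- (h + 1 * v))) * exp (2 * (z / 2) * of_real (h + 1 * v)) = exp (z * of_real h) * gauss_cos_pair w (sqrt b) z d e v"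
      unfolding 1 2 3 gauss_cos_pair_def by simp
  qed
  also have "\<dots> = exp (z * of_real h) * (LINT v|lborel. gauss_cos_pair w (sqrt b) z d e v)" by (rule integral_mult_right_zero)
  finally have conv: "bessel_conv (z / 2) w (real n * b) = exp (z * of_real h) * (LINT v|lborel. gauss_cos_pair w (sqrt b) z d e v)" .
  have "of_nat d powr (- z) * of_real b powr (- (z / 2)) * exp (z * of_real h) = 1"
  proof -
    have 1: "of_nat d powr (- z) = exp (- z * of_real (ln (real d)))"
      using d Ln_of_real[of "real d"] by (simp add: powr_def)
    have 2: "of_real b powr (- (z / 2)) = exp (- (z / 2) * of_real (ln b))"
      using b by (simp add: powr_def Ln_of_real)
    have "h = ln (real d) + ln b / 2" using b d by (simp add: h_def ln_mult ln_sqrt)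
    thus ?thesis unfolding 1 2 by (simp add: algebra_simps flip: exp_add)
  qed
  thus ?thesis unfolding conv by (metis mult.assoc mult_1)
qed

lemma powr_mult_neg_cancel:
  fixes z :: complex
  assumes "b > 0" "n > 0"
  shows "of_nat n powr (z / 2) * of_real (real n * b) powr (- (z / 2)) = of_real b powr (- (z / 2))"
proof -
  have "complex_of_real (real n * b) powr (- (z / 2)) = of_real (real n) powr (- (z / 2)) * of_real b powr (- (z / 2))"
    unfolding of_real_mult using assms by (intro powr_times_real) auto
  moreover have "of_nat n powr (z / 2) * of_real (real n) powr (- (z / 2)) = (1::complex)"
    using assms by (simp add: powr_minus)
  ultimately show ?thesis by (simp flip: mult.assoc)
qed

text \<open>
  After rescaling, the integrand at \<open>n = d e\<close> is a product of a function of \<open>d\<close> and a function of \<open>e\<close>, so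
  summing over all \<open>n\<close> and \<open>d\<close> gives a product of two theta sums.
\<close>

lemma divisor_sum_integral:
  assumes b: "b > 0"
  shows "(\<lambda>n. divisor_sigma (- z) (Suc n) * of_nat (Suc n) powr (z / 2) * gen_bessel_K (z / 2) w (2 * real (Suc n) * b))
           sums (LINT v|lborel. theta_sum w (sqrt b * exp v) * theta_sum w (sqrt b * exp (- v)) * exp (z * of_real v))"
    and "integrable lborel (\<lambda>v. theta_sum w (sqrt b * exp v) * theta_sum w (sqrt b * exp (- v)) * exp (z * of_real v))"
proof -
  define \<beta> where "\<beta> = sqrt b"
  have \<beta>: "\<beta> > 0" using b by (simp add: \<beta>_def)
  define Q where "Q = (\<lambda>n v. \<Sum>d | d dvd Suc n. gauss_cos_pair w \<beta> z d (Suc n div d) v)"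
  obtain C where C: "C \<ge> 0" "\<And>d e v. \<lbrakk>0 < d; 0 < e\<rbrakk> \<Longrightarrow> norm (gauss_cos_pair w \<beta> z d e v) \<le> C / (real d ^ 3 * real e ^ 3) * exp (- \<bar>v\<bar>)"
    using gauss_cos_pair_bound[OF \<beta>] by blast
  define c where "c = (\<lambda>n. C * (1 / real (Suc n) ^ 2))"
  have c: "summable c" unfolding c_def by (intro summable_mult summable_inverse_Suc_power) simp
  have ebd: "integrable lborel (\<lambda>v::real. exp (- \<bar>v\<bar>))" using integrable_exp_minus_abs[of 1] by simp
  have pos: "0 < d" "0 < Suc n div d" "d * (Suc n div d) = Suc n" if "d dvd Suc n" for d n
    using that by (auto intro: Nat.gr0I dest: dvd_imp_le simp: div_greater_zero_iff dvd_mult_div_cancel)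
  have pint: "integrable lborel (gauss_cos_pair w \<beta> z d e)" if "0 < d" "0 < e" for d e
  proof (rule Bochner_Integration.integrable_bound[where f = "\<lambda>v. C / (real d ^ 3 * real e ^ 3) * exp (- \<bar>v\<bar>)"])
    show "integrable lborel (\<lambda>v. C / (real d ^ 3 * real e ^ 3) * exp (- \<bar>v\<bar>))"
      by (intro integrable_mult_right ebd)
    show "AE v in lborel. norm (gauss_cos_pair w \<beta> z d e v) \<le> norm (C / (real d ^ 3 * real e ^ 3) * exp (- \<bar>v\<bar>))"
      by (intro AE_I2 order_trans[OF C(2)[OF that]]) (simp only: real_norm_def abs_ge_self)
  qed simp
  have Qint: "integrable lborel (Q n)" for n
    unfolding Q_def using pos by (intro Bochner_Integration.integrable_sum pint) auto
  have Qbd: "norm (Q n v) \<le> c n * exp (- \<bar>v\<bar>)" for n v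
  proof -
    have "norm (Q n v) \<le> (\<Sum>d | d dvd Suc n. C / real (Suc n) ^ 3 * exp (- \<bar>v\<bar>))"
      unfolding Q_def
    proof (rule sum_norm_le)
      fix d assume "d \<in> {d. d dvd Suc n}"
      hence d: "d dvd Suc n" by simp
      have "real d ^ 3 * real (Suc n div d) ^ 3 = real (Suc n) ^ 3"
        using pos(3)[OF d] by (metis of_nat_mult power_mult_distrib)
      thus "norm (gauss_cos_pair w \<beta> z d (Suc n div d) v) \<le> C / real (Suc n) ^ 3 * exp (- \<bar>v\<bar>)"
        using C(2)[OF pos(1,2)[OF d], of v] by (simp only:)
    qed
    also have "\<dots> = real (card {d. d dvd Suc n}) * (C / real (Suc n) ^ 3 * exp (- \<bar>v\<bar>))" by simp
    also have "\<dots> \<le> real (Suc n) * (C / real (Suc n) ^ 3 * exp (- \<bar>v\<bar>))"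
    proof (rule mult_right_mono)
      have "card {d. d dvd Suc n} \<le> card {1..Suc n}"
        by (rule card_mono) (auto simp: Suc_le_eq dest: pos(1) dvd_imp_le[OF _ zero_less_Suc])
      thus "real (card {d. d dvd Suc n}) \<le> real (Suc n)" by simp
    qed (use C(1) in simp)
    also have "\<dots> = c n * exp (- \<bar>v\<bar>)"
      by (simp add: c_def power2_eq_square power3_eq_cube del: of_nat_Suc)
    finally show ?thesis .
  qed
  have sm: "AE v in lborel. summable (\<lambda>n. norm (Q n v))"
  proof (rule AE_I2)
    fix v :: real
    have "summable (\<lambda>n. c n * exp (- \<bar>v\<bar>))"
      by (intro summable_mult2 c)
    thus "summable (\<lambda>n. norm (Q n v))"
      by (rule summable_comparison_test'[where N = 0]) (use Qbd in simp)
  qed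
  have si: "summable (\<lambda>n. LINT v|lborel. norm (Q n v))"
  proof (rule summable_comparison_test'[where N = 0])
    show "summable (\<lambda>n. c n * (LINT v::real|lborel. exp (- \<bar>v\<bar>)))"
      by (intro summable_mult2 c)
    fix n :: nat
    have "(LINT v|lborel. norm (Q n v)) \<le> (LINT v|lborel. c n * exp (- \<bar>v\<bar>))"
      by (rule integral_mono[OF integrable_norm[OF Qint] integrable_mult_right[OF ebd] Qbd])
    also have "\<dots> = c n * (LINT v::real|lborel. exp (- \<bar>v\<bar>))"
      by (rule integral_mult_right_zero)
    finally show "norm (LINT v|lborel. norm (Q n v)) \<le> c n * (LINT v::real|lborel. exp (- \<bar>v\<bar>))"
      by simp
  qed
  have Qval: "(LINT v|lborel. Q n v) = divisor_sigma (- z) (Suc n) * of_nat (Suc n) powr (z / 2) * gen_bessel_K (z / 2) w (2 * real (Suc n) * b)" for n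
  proof -
    have "(LINT v|lborel. Q n v) = (\<Sum>d | d dvd Suc n. LINT v|lborel. gauss_cos_pair w \<beta> z d (Suc n div d) v)"
      unfolding Q_def using pos by (intro Bochner_Integration.integral_sum pint) auto
    also have "\<dots> = (\<Sum>d | d dvd Suc n. of_nat d powr (- z) * of_real b powr (- (z / 2)) * bessel_conv (z / 2) w (real (Suc n) * b))"
    proof (rule sum.cong[OF refl])
      fix d assume "d \<in> {d. d dvd Suc n}"
      hence d: "d dvd Suc n" by simp
      show "(LINT v|lborel. gauss_cos_pair w \<beta> z d (Suc n div d) v) = of_nat d powr (- z) * of_real b powr (- (z / 2)) * bessel_conv (z / 2) w (real (Suc n) * b)"
        unfolding \<beta>_def using bessel_conv_rescale[OF b pos(1)[OF d] pos(3)[OF d, symmetric]] by (rule sym)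
    qed
    also have "\<dots> = divisor_sigma (- z) (Suc n) * (of_real b powr (- (z / 2)) * bessel_conv (z / 2) w (real (Suc n) * b))"
      by (simp only: divisor_sigma_def sum_distrib_right mult.assoc)
    also have "gen_bessel_K (z / 2) w (2 * (real (Suc n) * b)) = of_real (real (Suc n) * b) powr (- (z / 2)) * bessel_conv (z / 2) w (real (Suc n) * b)"
      by (rule gen_bessel_K_eq) (use b in simp)
    hence "of_real b powr (- (z / 2)) * bessel_conv (z / 2) w (real (Suc n) * b) = of_nat (Suc n) powr (z / 2) * gen_bessel_K (z / 2) w (2 * (real (Suc n) * b))"
      using powr_mult_neg_cancel[OF b, of "Suc n" z] by (simp only: mult.assoc[symmetric])
    finally show ?thesis by (simp only: mult.assoc)
  qed
  have pt: "(\<Sum>n. Q n v) = theta_sum w (sqrt b * exp v) * theta_sum w (sqrt b * exp (- v)) * exp (z * of_real v)" for v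
  proof -
    have e: "\<beta> * exp v > 0" "\<beta> * exp (- v) > 0" using \<beta> by auto
    have "(\<lambda>n. \<Sum>d | d dvd Suc n. gauss_cos w (real d * (\<beta> * exp v)) * gauss_cos w (real (Suc n div d) * (\<beta> * exp (- v)))) sums (theta_sum w (\<beta> * exp v) * theta_sum w (\<beta> * exp (- v)))"
      by (rule dirichlet_product_sums[where A = "\<lambda>d. gauss_cos w (real d * (\<beta> * exp v))" and B = "\<lambda>d. gauss_cos w (real d * (\<beta> * exp (- v)))"])
         (intro theta_sum_summable theta_sum_sums e)+
    hence "(\<lambda>n. (\<Sum>d | d dvd Suc n. gauss_cos w (real d * (\<beta> * exp v)) * gauss_cos w (real (Suc n div d) * (\<beta> * exp (- v)))) * exp (z * of_real v)) sums (theta_sum w (\<beta> * exp v) * theta_sum w (\<beta> * exp (- v)) * exp (z * of_real v))"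
      by (rule sums_mult2)
    hence "(\<lambda>n. Q n v) sums (theta_sum w (\<beta> * exp v) * theta_sum w (\<beta> * exp (- v)) * exp (z * of_real v))"
      by (simp only: Q_def gauss_cos_pair_def sum_distrib_right)
    thus ?thesis by (simp only: sums_iff \<beta>_def)
  qed
  show "(\<lambda>n. divisor_sigma (- z) (Suc n) * of_nat (Suc n) powr (z / 2) * gen_bessel_K (z / 2) w (2 * real (Suc n) * b))
           sums (LINT v|lborel. theta_sum w (sqrt b * exp v) * theta_sum w (sqrt b * exp (- v)) * exp (z * of_real v))"
    using sums_integral[OF Qint sm si] by (simp only: Qval pt)
  show "integrable lborel (\<lambda>v. theta_sum w (sqrt b * exp v) * theta_sum w (sqrt b * exp (- v)) * exp (z * of_real v))"
    using integrable_suminf[OF Qint sm si] by (simp only: pt)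
qed

section \<open>Mellin transforms of the theta sums\<close>

lemma has_bochner_integral_gauss_cos_scaled:
  assumes s: "Re s > 0" and m: "m > 0"
  shows "has_bochner_integral lborel (\<lambda>v. gauss_cos w (m * exp v) * exp (s * of_real v)) (of_real m powr (- s) * mellin_gauss_cos w s)"
    and "has_bochner_integral lborel (\<lambda>v. norm (gauss_cos w (m * exp v) * exp (s * of_real v)))
           (m powr (- Re s) * (LINT v|lborel. norm (gauss_cos w (exp v) * exp (s * of_real v))))"
proof -
  define h where "h = ln m"
  have eh: "exp h = m" using m by (simp add: h_def)
  have base: "has_bochner_integral lborel (\<lambda>v. gauss_cos w (exp v) * exp (s * of_real v)) (mellin_gauss_cos w s)"
    by (rule has_bochner_integral_gauss_cos[OF s])
  have shift: "exp (- s * of_real h) * (gauss_cos w (exp (h + 1 * v)) * exp (s * of_real (h + 1 * v))) = gauss_cos w (m * exp v) * exp (s * of_real v)" for v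
  proof -
    have "exp (- s * of_real h) * exp (s * of_real (h + 1 * v)) = exp (s * of_real v)"
      by (simp add: algebra_simps flip: exp_add)
    moreover have "exp (h + 1 * v) = m * exp v" by (simp add: exp_add eh)
    ultimately show ?thesis by (metis mult.left_commute)
  qed
  have pw: "of_real m powr (- s) = exp (- s * of_real h)" using m by (simp add: powr_def h_def Ln_of_real)
  have "has_bochner_integral lborel (\<lambda>v. gauss_cos w (exp (h + 1 * v)) * exp (s * of_real (h + 1 * v))) (mellin_gauss_cos w s /\<^sub>R \<bar>1\<bar>)"
    using base by (subst lborel_has_bochner_integral_real_affine_iff[where c = 1 and t = h, symmetric]) simp_all
  hence "has_bochner_integral lborel (\<lambda>v. exp (- s * of_real h) * (gauss_cos w (exp (h + 1 * v)) * exp (s * of_real (h + 1 * v)))) (exp (- s * of_real h) * (mellin_gauss_cos w s /\<^sub>R \<bar>1\<bar>))"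
    by (rule has_bochner_integral_mult_right)
  thus "has_bochner_integral lborel (\<lambda>v. gauss_cos w (m * exp v) * exp (s * of_real v)) (of_real m powr (- s) * mellin_gauss_cos w s)"
    unfolding shift pw by simp
  let ?N = "LINT v|lborel. norm (gauss_cos w (exp v) * exp (s * of_real v))"
  have "has_bochner_integral lborel (\<lambda>v. norm (gauss_cos w (exp v) * exp (s * of_real v))) ?N"
    using base by (simp add: has_bochner_integral_iff)
  hence "has_bochner_integral lborel (\<lambda>v. norm (gauss_cos w (exp (h + 1 * v)) * exp (s * of_real (h + 1 * v)))) (?N /\<^sub>R \<bar>1\<bar>)"
    by (subst lborel_has_bochner_integral_real_affine_iff[where c = 1 and t = h, symmetric]) simp_all
  hence "has_bochner_integral lborel (\<lambda>v. norm (exp (- s * of_real h)) * norm (gauss_cos w (exp (h + 1 * v)) * exp (s * of_real (h + 1 * v)))) (norm (exp (- s * of_real h)) * (?N /\<^sub>R \<bar>1\<bar>))"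
    by (rule has_bochner_integral_mult_right)
  moreover have "norm (exp (- s * of_real h)) = m powr (- Re s)"
    using m by (simp add: powr_def h_def)
  ultimately show "has_bochner_integral lborel (\<lambda>v. norm (gauss_cos w (m * exp v) * exp (s * of_real v))) (m powr (- Re s) * ?N)"
    unfolding norm_mult[symmetric] shift by simp
qed

text \<open>
  Scaling the argument by \<open>n\<close> multiplies the Mellin transform by \<open>n\<^sup>-\<^sup>s\<close>; summation over \<open>n\<close> gives the
  Dirichlet series of zeta.
\<close>

lemma has_bochner_integral_theta_sum:
  assumes s: "Re s > 1" and b: "\<beta> > 0" and Z: "(\<lambda>n. of_nat (Suc n) powr (- s)) sums Z"
  shows "has_bochner_integral lborel (\<lambda>v. theta_sum w (\<beta> * exp v) * exp (s * of_real v)) (of_real \<beta> powr (- s) * Z * mellin_gauss_cos w s)"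
proof -
  define F where "F = (\<lambda>n v. gauss_cos w (real (Suc n) * \<beta> * exp v) * exp (s * of_real v))"
  have s0: "Re s > 0" using s by simp
  have m: "real (Suc n) * \<beta> > 0" for n using b by simp
  have F: "has_bochner_integral lborel (F n) (of_real (real (Suc n) * \<beta>) powr (- s) * mellin_gauss_cos w s)" for n
    unfolding F_def by (rule has_bochner_integral_gauss_cos_scaled(1)[OF s0 m])
  have Fint: "integrable lborel (F n)" for n using F by (simp add: has_bochner_integral_iff)
  have pm: "complex_of_real (real (Suc n) * \<beta>) powr (- s) = of_nat (Suc n) powr (- s) * of_real \<beta> powr (- s)" for n
  proof -
    have "complex_of_real (real (Suc n) * \<beta>) powr (- s) = of_real (real (Suc n)) powr (- s) * of_real \<beta> powr (- s)"
      unfolding of_real_mult using b by (intro powr_times_real) auto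
    thus ?thesis by (simp only: of_real_of_nat_eq)
  qed
  have sm: "AE v in lborel. summable (\<lambda>n. norm (F n v))"
  proof (rule AE_I2)
    fix v
    have "summable (\<lambda>n. norm (gauss_cos w (real (Suc n) * (\<beta> * exp v))) * norm (exp (s * of_real v)))"
      using b by (intro summable_mult2 theta_sum_summable) simp
    thus "summable (\<lambda>n. norm (F n v))" by (simp only: F_def norm_mult mult.assoc)
  qed
  have si: "summable (\<lambda>n. LINT v|lborel. norm (F n v))"
  proof -
    define N where "N = (LINT v|lborel. norm (gauss_cos w (exp v) * exp (s * of_real v)))"
    have "(LINT v|lborel. norm (F n v)) = real (Suc n) powr (- Re s) * (\<beta> powr (- Re s) * N)" for n
    proof -
      have "(LINT v|lborel. norm (F n v)) = (real (Suc n) * \<beta>) powr (- Re s) * N"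
        unfolding F_def N_def by (rule has_bochner_integral_integral_eq[OF has_bochner_integral_gauss_cos_scaled(2)[OF s0 m]])
      thus ?thesis using b by (simp only: powr_mult of_nat_0_le_iff less_imp_le mult.assoc)
    qed
    moreover have "summable (\<lambda>n. real (Suc n) powr (- Re s))"
    proof -
      have "summable (\<lambda>n. real n powr (- Re s))" using s by (simp add: summable_real_powr_iff)
      thus ?thesis by (subst summable_Suc_iff)
    qed
    ultimately show ?thesis by (simp only: summable_mult2)
  qed
  have pt: "(\<Sum>n. F n v) = theta_sum w (\<beta> * exp v) * exp (s * of_real v)" for v
  proof -
    have "(\<lambda>n. gauss_cos w (real (Suc n) * (\<beta> * exp v)) * exp (s * of_real v)) sums (theta_sum w (\<beta> * exp v) * exp (s * of_real v))"
      using b by (intro sums_mult2 theta_sum_sums) simp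
    thus ?thesis by (simp only: F_def mult.assoc[of "real (Suc _)"] sums_iff)
  qed
  have "(\<lambda>n. of_real (real (Suc n) * \<beta>) powr (- s) * mellin_gauss_cos w s) sums (LINT v|lborel. theta_sum w (\<beta> * exp v) * exp (s * of_real v))"
    using sums_integral[OF Fint sm si] unfolding pt has_bochner_integral_integral_eq[OF F] .
  moreover have "(\<lambda>n. of_real (real (Suc n) * \<beta>) powr (- s) * mellin_gauss_cos w s) sums (Z * of_real \<beta> powr (- s) * mellin_gauss_cos w s)"
    unfolding pm by (intro sums_mult2 Z)
  ultimately have "(LINT v|lborel. theta_sum w (\<beta> * exp v) * exp (s * of_real v)) = Z * of_real \<beta> powr (- s) * mellin_gauss_cos w s"
    by (rule sums_unique2)
  moreover have "integrable lborel (\<lambda>v. theta_sum w (\<beta> * exp v) * exp (s * of_real v))"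
    using integrable_suminf[OF Fint sm si] unfolding pt .
  ultimately show ?thesis by (simp add: has_bochner_integral_iff mult_ac)
qed

lemma theta_sum_exp_measurable [measurable]: "(\<lambda>v. theta_sum w (\<beta> * exp v)) \<in> borel_measurable borel"
  unfolding theta_sum_def by measurable

lemma theta_sum_exp_bound:
  assumes p: "2 \<le> p" and b: "\<beta> > 0"
  obtains C where "C \<ge> 0" "\<And>v. norm (theta_sum w (\<beta> * exp v)) \<le> C * exp (- (real p * v))"
proof -
  obtain C where C: "C \<ge> 0" "\<And>t. t > 0 \<Longrightarrow> norm (theta_sum w t) \<le> C / t ^ p" using theta_sum_bound[OF p] by blast
  show ?thesis
  proof (rule that)
    show "C / \<beta> ^ p \<ge> 0" using C b by simp
    fix v
    have "norm (theta_sum w (\<beta> * exp v)) \<le> C / (\<beta> * exp v) ^ p" using b by (intro C(2)) simp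
    also have "\<dots> = C / \<beta> ^ p * exp (- (real p * v))"
      by (simp add: power_mult_distrib exp_minus divide_inverse mult_ac flip: exp_of_nat_mult)
    finally show "norm (theta_sum w (\<beta> * exp v)) \<le> C / \<beta> ^ p * exp (- (real p * v))" .
  qed
qed

lemma superexp_decayI:
  assumes f: "f \<in> borel_measurable borel"
    and right: "\<And>p::nat. 2 \<le> p \<Longrightarrow> \<exists>C\<ge>0. \<forall>v\<ge>0. norm (f v) \<le> C * exp (- (real p * v))"
    and left: "\<And>p::nat. 2 \<le> p \<Longrightarrow> \<exists>C\<ge>0. \<forall>v<0. norm (f v) \<le> C * exp (real p * v)"
  shows "superexp_decay f"
  unfolding superexp_decay_def
proof (intro conjI allI impI f)
  fix R :: real assume R: "R \<ge> 0"
  obtain p :: nat where p0: "real p \<ge> R + 2" using real_arch_simple by blast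
  hence p: "2 \<le> p" using R by linarith
  obtain C where C: "C \<ge> 0" "\<forall>v\<ge>0. norm (f v) \<le> C * exp (- (real p * v))" using right[OF p] by blast
  obtain C' where C': "C' \<ge> 0" "\<forall>v<0. norm (f v) \<le> C' * exp (real p * v)" using left[OF p] by blast
  have "norm (f v) \<le> (C + C') * exp (- R * \<bar>v\<bar>)" for v
  proof -
    have "R * \<bar>v\<bar> \<le> real p * \<bar>v\<bar>" using p0 by (intro mult_right_mono) auto
    hence e: "exp (- (real p * \<bar>v\<bar>)) \<le> exp (- R * \<bar>v\<bar>)" by simp
    have "norm (f v) \<le> (C + C') * exp (- (real p * \<bar>v\<bar>))"
    proof (cases "v \<ge> 0")
      case True
      hence "norm (f v) \<le> C * exp (- (real p * v))" using C by blast
      also have "\<dots> \<le> (C + C') * exp (- (real p * v))" using C'(1) by (intro mult_right_mono) auto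
      finally show ?thesis using True by simp
    next
      case False
      hence "norm (f v) \<le> C' * exp (real p * v)" using C' by simp
      also have "\<dots> \<le> (C + C') * exp (real p * v)" using C(1) by (intro mult_right_mono) auto
      finally show ?thesis using False by simp
    qed
    also have "\<dots> \<le> (C + C') * exp (- R * \<bar>v\<bar>)" using C(1) C'(1) e by (intro mult_left_mono) auto
    finally show ?thesis .
  qed
  thus "\<exists>C. \<forall>v. norm (f v) \<le> C * exp (- R * \<bar>v\<bar>)" by blast
qed

lemma has_bochner_integral_exp_left:
  fixes z :: complex
  assumes z: "Re z > 0"
  shows "has_bochner_integral lborel (\<lambda>v. indicator {..<0} v *\<^sub>R exp (z * of_real v)) (1 / z)"
proof -
  define r where "r = Re z"
  have z0: "z \<noteq> 0" using z by auto
  have fin: "(LINT v|lborel. indicator {- real n..0} v *\<^sub>R exp (z * of_real v)) = (1 - exp (- z * of_nat n)) / z" for n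
  proof -
    have "(LINT v|lborel. indicator {- real n..0} v *\<^sub>R exp (z * of_real v)) = exp (z * of_real 0) / z - exp (z * of_real (- real n)) / z"
    proof (rule integral_FTC_atLeastAtMost)
      fix x :: real
      have "((\<lambda>x. exp (z * of_real x) / z) has_vector_derivative exp (z * of_real x)) (at x)"
        using z0 by (auto intro!: derivative_eq_intros has_vector_derivative_real_field)
      thus "((\<lambda>x. exp (z * of_real x) / z) has_vector_derivative exp (z * of_real x)) (at x within {- real n..0})"
        by (rule has_vector_derivative_at_within)
    qed (auto intro!: continuous_intros)
    thus ?thesis by (simp add: diff_divide_distrib)
  qed
  let ?w = "\<lambda>v. exp (- r * \<bar>v\<bar>)"
  have bd: "norm (indicator {- real n..0} v *\<^sub>R exp (z * of_real v)) \<le> ?w v" for n v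
    by (auto simp: indicator_def r_def)
  have lim: "(\<lambda>n. indicator {- real n..0} v *\<^sub>R exp (z * of_real v)) \<longlonglongrightarrow> indicator {..0} v *\<^sub>R exp (z * of_real v)" for v
  proof (rule tendsto_eventually)
    obtain N :: nat where N: "real N \<ge> - v" using real_arch_simple by blast
    show "\<forall>\<^sub>F n in sequentially. indicator {- real n..0} v *\<^sub>R exp (z * of_real v) = indicator {..0} v *\<^sub>R exp (z * of_real v)"
      using eventually_ge_at_top[of N]
    proof eventually_elim
      case (elim n)
      hence "- real n \<le> v" using N by (smt (verit) of_nat_le_iff)
      thus ?case by (simp add: indicator_def)
    qed
  qed
  have w: "integrable lborel ?w" using z by (intro integrable_exp_minus_abs) (simp add: r_def)
  have i: "integrable lborel (\<lambda>v. indicator {..0} v *\<^sub>R exp (z * of_real v))"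
    by (rule integrable_dominated_convergence[OF _ _ w AE_I2[OF lim] AE_I2[OF bd]]) auto
  have "(\<lambda>n. LINT v|lborel. indicator {- real n..0} v *\<^sub>R exp (z * of_real v)) \<longlonglongrightarrow> (LINT v|lborel. indicator {..0} v *\<^sub>R exp (z * of_real v))"
    by (rule integral_dominated_convergence[OF _ _ w AE_I2[OF lim] AE_I2[OF bd]]) auto
  moreover have "(\<lambda>n. (1 - exp (- z * of_nat n)) / z) \<longlonglongrightarrow> (1 - 0) / z"
  proof (intro tendsto_intros z0)
    have "norm (exp (- z)) < 1" using z by simp
    hence "(\<lambda>n. exp (- z) ^ n) \<longlonglongrightarrow> 0" by (rule LIMSEQ_power_zero)
    thus "(\<lambda>n. exp (- z * of_nat n)) \<longlonglongrightarrow> 0" by (simp add: mult.commute flip: exp_of_nat_mult)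
  qed
  ultimately have "(LINT v|lborel. indicator {..0} v *\<^sub>R exp (z * of_real v)) = 1 / z"
    unfolding fin using LIMSEQ_unique by fastforce
  hence "has_bochner_integral lborel (\<lambda>v. indicator {..0} v *\<^sub>R exp (z * of_real v)) (1 / z)"
    using i by (simp add: has_bochner_integral_iff)
  thus ?thesis
  proof (rule has_bochner_integral_cong_AE[THEN iffD1, rotated -1])
    show "AE v in lborel. indicator {..0} v *\<^sub>R exp (z * of_real v) = indicator {..<0} v *\<^sub>R exp (z * of_real v)"
      by (rule AE_mp[OF AE_lborel_singleton[of 0]]) (auto simp: indicator_def)
  qed auto
qed

section \<open>The Riemann zeta function\<close>

lemma hyp1F1_zero: "hyp1F1 a c 0 = 1"
proof -
  have "(\<lambda>n. pochhammer a n * 0 ^ n / (pochhammer c n * fact n)) = (\<lambda>n. if n = 0 then 1 else 0)"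
    by (auto simp: fun_eq_iff)
  thus ?thesis unfolding hyp1F1_def using sums_single[of 0 "\<lambda>_. 1::complex"] by (simp add: sums_iff)
qed

lemma mellin_gauss_cos_zero: "mellin_gauss_cos 0 s = Gamma (s / 2) / 2"
  by (simp add: mellin_gauss_cos_def hyp1F1_zero)

text \<open>
  By \<open>theta_sum_transform\<close>, \<open>theta_sum 0 t\<close> equals \<open>\<surd>\<pi>/(2t) - 1/2\<close> near \<open>t = 0\<close> up to a rapidly decaying
  error. Removing this part for \<open>t < 1\<close> leaves rapid decay at both ends.
\<close>

definition theta_core :: "real \<Rightarrow> complex" where
  "theta_core v = theta_sum 0 (exp v) + (if v < 0 then 1 / 2 - of_real (sqrt pi / 2 * exp (- v)) else 0)"

lemma theta_core_decay: "superexp_decay theta_core"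
proof (rule superexp_decayI)
  have [measurable]: "(\<lambda>v. theta_sum 0 (exp v)) \<in> borel_measurable borel"
    using theta_sum_exp_measurable[of 0 1] by simp
  show "theta_core \<in> borel_measurable borel" unfolding theta_core_def by measurable
  fix p :: nat assume p: "2 \<le> p"
  obtain C where C: "C \<ge> 0" "\<And>v. norm (theta_sum 0 (1 * exp v)) \<le> C * exp (- (real p * v))"
    using theta_sum_exp_bound[OF p, of 1 0] by auto
  show "\<exists>C\<ge>0. \<forall>v\<ge>0. norm (theta_core v) \<le> C * exp (- (real p * v))"
    using C by (intro exI[of _ C]) (simp add: theta_core_def)
  \<comment> \<open>One power more than \<open>p\<close>, to compensate the factor \<open>exp(-v)\<close> of the reflection.\<close>
  obtain D where D: "D \<ge> 0" "\<And>v. norm (theta_sum 0 (pi * exp v)) \<le> D * exp (- (real (p + 1) * v))"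
    using theta_sum_exp_bound[of "p + 1" pi 0] p by auto
  have "norm (theta_core v) \<le> (sqrt pi * D) * exp (real p * v)" if v: "v < 0" for v
  proof -
    have "1 + 2 * theta_sum 0 (exp v) = of_real (sqrt pi / exp v) * exp (- (0\<^sup>2 / 4)) * (1 + 2 * theta_sum (\<i> * 0) (pi / exp v))"
      by (rule theta_sum_transform) simp
    also have "pi / exp v = pi * exp (- v)" by (simp add: exp_minus divide_inverse)
    also have "sqrt pi / exp v = sqrt pi * exp (- v)" by (simp add: exp_minus divide_inverse)
    finally have t: "1 + 2 * theta_sum 0 (exp v) = of_real (sqrt pi * exp (- v)) * (1 + 2 * theta_sum 0 (pi * exp (- v)))" by simp
    have "2 * theta_core v = (1 + 2 * theta_sum 0 (exp v)) - of_real (sqrt pi * exp (- v))"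
      using v by (simp add: theta_core_def)
    also have "\<dots> = 2 * (of_real (sqrt pi * exp (- v)) * theta_sum 0 (pi * exp (- v)))"
      unfolding t by (simp add: ring_distribs)
    finally have "norm (theta_core v) = sqrt pi * exp (- v) * norm (theta_sum 0 (pi * exp (- v)))"
      by (simp add: norm_mult)
    also have "\<dots> \<le> sqrt pi * exp (- v) * (D * exp (- (real (p + 1) * (- v))))"
      by (intro mult_left_mono D) auto
    also have "\<dots> = (sqrt pi * D) * (exp (- v) * exp (- (real (p + 1) * (- v))))" by simp
    also have "exp (- v) * exp (- (real (p + 1) * (- v))) = exp (real p * v)"
      by (simp add: algebra_simps flip: exp_add)
    finally show ?thesis .
  qed
  thus "\<exists>C\<ge>0. \<forall>v<0. norm (theta_core v) \<le> C * exp (real p * v)"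
    using D(1) by (intro exI[of _ "sqrt pi * D"]) simp
qed

definition theta_mellin :: "complex \<Rightarrow> complex" where
  "theta_mellin z = (LINT v|lborel. theta_core v * exp (z * of_real v))"

text \<open>
  The two removed terms contribute the polar parts at \<open>0\<close> and \<open>1\<close>.
\<close>

lemma theta_mellin_eq:
  assumes z: "Re z > 1" and Z: "(\<lambda>n. of_nat (Suc n) powr (- z)) sums Z"
  shows "theta_mellin z = Gamma (z / 2) / 2 * Z + 1 / (2 * z) - of_real (sqrt pi) / (2 * (z - 1))"
proof -
  have z0: "Re z > 0" "Re (z - 1) > 0" using z by auto
  have 1: "has_bochner_integral lborel (\<lambda>v. theta_sum 0 (exp v) * exp (z * of_real v)) (Gamma (z / 2) / 2 * Z)"
    using has_bochner_integral_theta_sum[OF z, of 1 Z 0] Z by (simp add: mellin_gauss_cos_zero mult_ac)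
  have 2: "has_bochner_integral lborel (\<lambda>v. 1 / 2 * (indicator {..<0} v *\<^sub>R exp (z * of_real v))) (1 / 2 * (1 / z))"
    by (intro has_bochner_integral_mult_right has_bochner_integral_exp_left z0)
  have 3: "has_bochner_integral lborel (\<lambda>v. of_real (sqrt pi / 2) * (indicator {..<0} v *\<^sub>R exp ((z - 1) * of_real v))) (of_real (sqrt pi / 2) * (1 / (z - 1)))"
    by (intro has_bochner_integral_mult_right has_bochner_integral_exp_left z0)
  have "theta_core v * exp (z * of_real v) = theta_sum 0 (exp v) * exp (z * of_real v) + 1 / 2 * (indicator {..<0} v *\<^sub>R exp (z * of_real v))
       - of_real (sqrt pi / 2) * (indicator {..<0} v *\<^sub>R exp ((z - 1) * of_real v))" for v
  proof -
    have "complex_of_real (exp (- v)) * exp (z * of_real v) = exp ((z - 1) * of_real v)"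
      by (simp add: algebra_simps flip: exp_add exp_of_real)
    hence "complex_of_real (sqrt pi / 2 * exp (- v)) * exp (z * of_real v) = of_real (sqrt pi / 2) * exp ((z - 1) * of_real v)"
      by (simp only: of_real_mult mult.assoc)
    thus ?thesis by (simp add: theta_core_def indicator_def ring_distribs left_diff_distrib)
  qed
  moreover have "has_bochner_integral lborel (\<lambda>v. theta_sum 0 (exp v) * exp (z * of_real v) + 1 / 2 * (indicator {..<0} v *\<^sub>R exp (z * of_real v))
       - of_real (sqrt pi / 2) * (indicator {..<0} v *\<^sub>R exp ((z - 1) * of_real v))) (Gamma (z / 2) / 2 * Z + 1 / 2 * (1 / z) - of_real (sqrt pi / 2) * (1 / (z - 1)))"
    by (intro has_bochner_integral_diff has_bochner_integral_add 1 2 3)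
  ultimately have "theta_mellin z = Gamma (z / 2) / 2 * Z + 1 / 2 * (1 / z) - of_real (sqrt pi / 2) * (1 / (z - 1))"
    unfolding theta_mellin_def by (simp only: has_bochner_integral_integral_eq)
  thus ?thesis by simp
qed

text \<open>
  The simple pole of \<open>1/z\<close> at \<open>0\<close> is cancelled by the zero of \<open>1/\<Gamma>(z/2)\<close>.
\<close>

lemma rGamma_half_div:
  assumes "z \<noteq> (0::complex)"
  shows "rGamma (z / 2) / z = rGamma (z / 2 + 1) / 2"
  using assms rGamma_plus1[of "z / 2"] by (simp add: field_simps)

lemma zeta_series_summable:
  assumes "Re s > 1"
  shows "summable (\<lambda>n. of_nat (Suc n) powr (- s) :: complex)"
proof (rule summable_norm_cancel)
  have "summable (\<lambda>n. real n powr (- Re s))" using assms by (simp add: summable_real_powr_iff)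
  hence "summable (\<lambda>n. real (Suc n) powr (- Re s))" by (subst summable_Suc_iff)
  moreover have "norm (of_nat (Suc n) powr (- s) :: complex) = real (Suc n) powr (- Re s)" for n
    using norm_powr_real_powr[of "of_nat (Suc n)" "- s"] by simp
  ultimately show "summable (\<lambda>n. norm (of_nat (Suc n) powr (- s) :: complex))" by simp
qed

definition is_zeta_continuation :: "(complex \<Rightarrow> complex) \<Rightarrow> bool" where
  "is_zeta_continuation f \<longleftrightarrow> f holomorphic_on (- {1}) \<and>
      (\<forall>s. 1 < Re s \<longrightarrow> (\<lambda>n. of_nat (Suc n) powr (- s)) sums f s) \<and> f 1 = 0"

lemma connected_minus_1: "connected (- {1 :: complex})"
  by (rule connected_punctured_universe) simp

lemma zeta_continuation_unique:
  assumes "is_zeta_continuation f" "is_zeta_continuation g"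
  shows "f = g"
proof
  fix z
  show "f z = g z"
  proof (cases "z = 1")
    case True
    thus ?thesis using assms by (simp add: is_zeta_continuation_def)
  next
    case False
    show ?thesis
    proof (rule analytic_continuation_open[of "{s. Re s > 1}" "- {1}" f g])
      show "{s. Re s > 1} \<noteq> {}" by (auto intro: exI[of _ 2])
      show "f z = g z" if "z \<in> {s. Re s > 1}" for z
        using assms that unfolding is_zeta_continuation_def by (blast intro: sums_unique2)
    qed (use assms False connected_minus_1 in \<open>auto simp: is_zeta_continuation_def open_halfspace_Re_gt\<close>)
  qed
qed

text \<open>
  Solving \<open>theta_mellin_eq\<close> for the Dirichlet series gives a formula that makes sense on the whole plane
  except for the pole at \<open>1\<close>.
\<close>

lemma zeta_continuation_exists: "\<exists>f. is_zeta_continuation f"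
proof -
  define f where "f = (\<lambda>z. if z = 1 then 0 else rGamma (z / 2) * (2 * theta_mellin z + of_real (sqrt pi) / (z - 1)) - rGamma (z / 2 + 1) / 2)"
  have "theta_mellin holomorphic_on A" for A
    unfolding theta_mellin_def[abs_def] by (rule superexp_decay_laplace_entire[OF theta_core_decay])
  hence "(\<lambda>z. rGamma (z / 2) * (2 * theta_mellin z + of_real (sqrt pi) / (z - 1)) - rGamma (z / 2 + 1) / 2) holomorphic_on (- {1})"
    by (intro holomorphic_intros) auto
  hence 1: "f holomorphic_on (- {1})"
    by (rule holomorphic_transform) (simp add: f_def)
  have "(\<lambda>n. of_nat (Suc n) powr (- s)) sums f s" if s: "1 < Re s" for s
  proof -
    obtain Z where Z: "(\<lambda>n. of_nat (Suc n) powr (- s)) sums Z"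
      using zeta_series_summable[OF s] by (auto simp: summable_def)
    have s0: "s \<noteq> 0" "s \<noteq> 1" using s by auto
    have g: "rGamma (s / 2) * Gamma (s / 2) = 1"
      using Re_pos_not_nonpos_Int[of "s/2"] s by (simp add: rGamma_inverse_Gamma Gamma_eq_zero_iff)
    have "f s = rGamma (s / 2) * (Gamma (s / 2) * Z + 1 / s) - rGamma (s / 2 + 1) / 2"
    proof -
      define d where "d = s - 1"
      have "2 * theta_mellin s + of_real (sqrt pi) / d = Gamma (s / 2) * Z + 1 / s"
        unfolding theta_mellin_eq[OF s Z] d_def[symmetric] by (simp add: ring_distribs right_diff_distrib)
      thus ?thesis using s0 unfolding f_def d_def by (simp only: if_False)
    qed
    also have "\<dots> = rGamma (s / 2) * Gamma (s / 2) * Z + (rGamma (s / 2) / s - rGamma (s / 2 + 1) / 2)"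
      by (simp add: ring_distribs)
    also have "\<dots> = Z" by (simp add: rGamma_half_div[OF s0(1)] g)
    finally show ?thesis using Z by simp
  qed
  thus ?thesis using 1 by (intro exI[of _ f]) (simp add: is_zeta_continuation_def f_def)
qed

lemma riemann_zeta_is_continuation: "is_zeta_continuation riemann_zeta"
proof -
  have "\<exists>!f. is_zeta_continuation f" using zeta_continuation_exists zeta_continuation_unique by blast
  hence "is_zeta_continuation (THE f. is_zeta_continuation f)" by (rule theI')
  moreover have "riemann_zeta = (THE f. is_zeta_continuation f)" unfolding riemann_zeta_def is_zeta_continuation_def ..
  ultimately show ?thesis by (simp only:)
qed

lemma riemann_zeta_holomorphic: "riemann_zeta holomorphic_on (- {1})"
  and riemann_zeta_sums: "1 < Re s \<Longrightarrow> (\<lambda>n. of_nat (Suc n) powr (- s)) sums riemann_zeta s"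
  using riemann_zeta_is_continuation by (auto simp: is_zeta_continuation_def)

section \<open>The transformation formula\<close>

lemma theta_sum_minus: "theta_sum (- w) t = theta_sum w t"
  by (simp add: theta_sum_def gauss_cos_def)

text \<open>
  The weight \<open>\<surd>b exp(w\<^sup>2/4)\<close> normalizes \<open>theta_sum_transform\<close> so that the remaining factor
  \<open>\<surd>\<pi> exp(-v)\<close> does not depend on \<open>a\<close>, \<open>b\<close> and \<open>w\<close>, and \<open>ab = \<pi>\<^sup>2\<close> turns the
  argument \<open>\<pi>/(\<surd>b exp v)\<close> into \<open>\<surd>a exp(-v)\<close>.
\<close>

lemma theta_reflection:
  assumes a: "a > 0" and b: "b > 0" and ab: "a * b = pi\<^sup>2"
  shows "of_real (sqrt b) * exp (w\<^sup>2 / 4) * (1 + 2 * theta_sum w (sqrt b * exp v))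
       = of_real (sqrt pi * exp (- v)) * (1 + 2 * theta_sum (\<i> * w) (sqrt a * exp (- v)))"
proof -
  have sab: "sqrt a * sqrt b = pi" using ab by (simp flip: real_sqrt_mult)
  have 1: "pi / (sqrt b * exp v) = sqrt a * exp (- v)"
    using b by (simp add: exp_minus field_simps flip: sab)
  have 2: "sqrt b * (sqrt pi / (sqrt b * exp v)) = sqrt pi * exp (- v)"
    using b by (simp add: exp_minus field_simps)
  have 3: "exp (w\<^sup>2 / 4) * exp (- (w\<^sup>2 / 4)) = 1" by (simp flip: exp_add)
  have "1 + 2 * theta_sum w (sqrt b * exp v) = of_real (sqrt pi / (sqrt b * exp v)) * exp (- (w\<^sup>2 / 4)) * (1 + 2 * theta_sum (\<i> * w) (pi / (sqrt b * exp v)))"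
    by (rule theta_sum_transform) (use b in simp)
  hence "of_real (sqrt b) * exp (w\<^sup>2 / 4) * (1 + 2 * theta_sum w (sqrt b * exp v)) =
     of_real (sqrt b * (sqrt pi / (sqrt b * exp v))) * (exp (w\<^sup>2 / 4) * exp (- (w\<^sup>2 / 4))) * (1 + 2 * theta_sum (\<i> * w) (pi / (sqrt b * exp v)))"
    by (simp only: of_real_mult mult_ac)
  thus ?thesis unfolding 1 2 3 by simp
qed

text \<open>
  The limit of the difference of the two weighted theta functions as \<open>t\<close> tends to infinity.
\<close>

definition gap_const :: "real \<Rightarrow> real \<Rightarrow> complex \<Rightarrow> complex" where
  "gap_const a b w = of_real (sqrt b) * exp (w\<^sup>2 / 4) - of_real (sqrt a) * exp (- (w\<^sup>2 / 4))"

text \<open>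
  The difference of the two weighted theta functions, minus its limit for \<open>t \<ge> 1\<close>. The difference itself
  already tends to \<open>0\<close> as \<open>t\<close> does.
\<close>

definition gap_core :: "real \<Rightarrow> real \<Rightarrow> complex \<Rightarrow> real \<Rightarrow> complex" where
  "gap_core a b w v =
     of_real (sqrt b) * exp (w\<^sup>2 / 4) * (1 + 2 * theta_sum w (sqrt b * exp v))
     - of_real (sqrt a) * exp (- (w\<^sup>2 / 4)) * (1 + 2 * theta_sum (\<i> * w) (sqrt a * exp v))
     - (if v \<ge> 0 then gap_const a b w else 0)"

definition gap_mellin :: "real \<Rightarrow> real \<Rightarrow> complex \<Rightarrow> complex \<Rightarrow> complex" where
  "gap_mellin a b w z = (LINT v|lborel. gap_core a b w v * exp (z * of_real v))"

lemma theta_reflection':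
  assumes a: "a > 0" and b: "b > 0" and ab: "a * b = pi\<^sup>2"
  shows "of_real (sqrt a) * exp (- (w\<^sup>2 / 4)) * (1 + 2 * theta_sum (\<i> * w) (sqrt a * exp v))
       = of_real (sqrt pi * exp (- v)) * (1 + 2 * theta_sum w (sqrt b * exp (- v)))"
proof -
  have "\<i> * (\<i> * w) = - w" by (simp flip: mult.assoc)
  thus ?thesis
    using theta_reflection[of b a "\<i> * w" v] assms by (simp add: mult.commute power_mult_distrib theta_sum_minus)
qed

text \<open>
  For \<open>v < 0\<close> both theta functions are reflected; their leading terms \<open>\<surd>\<pi> exp(-v)\<close> are the same and
  cancel.
\<close>

lemma gap_core_decay:
  assumes a: "a > 0" and b: "b > 0" and ab: "a * b = pi\<^sup>2"
  shows "superexp_decay (gap_core a b w)"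
proof (rule superexp_decayI)
  show "gap_core a b w \<in> borel_measurable borel" unfolding gap_core_def by measurable
  define A B where "A = of_real (sqrt a) * exp (- (w\<^sup>2 / 4))" and "B = of_real (sqrt b) * exp (w\<^sup>2 / 4)"
  have sq: "sqrt a > 0" "sqrt b > 0" using a b by auto
  fix p :: nat assume p: "2 \<le> p"
  obtain C where C: "C \<ge> 0" "\<And>v. norm (theta_sum w (sqrt b * exp v)) \<le> C * exp (- (real p * v))"
    using theta_sum_exp_bound[OF p sq(2)] by blast
  obtain D where D: "D \<ge> 0" "\<And>v. norm (theta_sum (\<i> * w) (sqrt a * exp v)) \<le> D * exp (- (real p * v))"
    using theta_sum_exp_bound[OF p sq(1)] by blast
  have "norm (gap_core a b w v) \<le> (2 * norm B * C + 2 * norm A * D) * exp (- (real p * v))" if v: "v \<ge> 0" for v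
  proof -
    have "gap_core a b w v = 2 * B * theta_sum w (sqrt b * exp v) - 2 * A * theta_sum (\<i> * w) (sqrt a * exp v)"
      using v unfolding gap_core_def gap_const_def A_def[symmetric] B_def[symmetric] by (simp add: ring_distribs)
    also have "norm \<dots> \<le> 2 * norm B * norm (theta_sum w (sqrt b * exp v)) + 2 * norm A * norm (theta_sum (\<i> * w) (sqrt a * exp v))"
      by (rule order_trans[OF norm_triangle_ineq4]) (simp add: norm_mult)
    also have "\<dots> \<le> 2 * norm B * (C * exp (- (real p * v))) + 2 * norm A * (D * exp (- (real p * v)))"
      by (intro add_mono mult_left_mono C D) auto
    finally show ?thesis by (simp add: ring_distribs mult.assoc)
  qed
  thus "\<exists>C\<ge>0. \<forall>v\<ge>0. norm (gap_core a b w v) \<le> C * exp (- (real p * v))"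
    using C(1) D(1) by (intro exI[of _ "2 * norm B * C + 2 * norm A * D"]) simp
  \<comment> \<open>One power more than \<open>p\<close>, to compensate the factor \<open>exp(-v)\<close> of the reflection.\<close>
  have p1: "2 \<le> p + 1" using p by simp
  obtain C' where C': "C' \<ge> 0" "\<And>v. norm (theta_sum w (sqrt b * exp v)) \<le> C' * exp (- (real (p + 1) * v))"
    using theta_sum_exp_bound[OF p1 sq(2)] by blast
  obtain D' where D': "D' \<ge> 0" "\<And>v. norm (theta_sum (\<i> * w) (sqrt a * exp v)) \<le> D' * exp (- (real (p + 1) * v))"
    using theta_sum_exp_bound[OF p1 sq(1)] by blast
  have "norm (gap_core a b w v) \<le> (2 * sqrt pi * (D' + C')) * exp (real p * v)" if v: "v < 0" for v
  proof -
    have "gap_core a b w v = of_real (2 * sqrt pi * exp (- v)) * (theta_sum (\<i> * w) (sqrt a * exp (- v)) - theta_sum w (sqrt b * exp (- v)))"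
      using v unfolding gap_core_def theta_reflection[OF a b ab] theta_reflection'[OF a b ab]
      by (simp add: ring_distribs right_diff_distrib)
    hence "norm (gap_core a b w v) = 2 * sqrt pi * exp (- v) * norm (theta_sum (\<i> * w) (sqrt a * exp (- v)) - theta_sum w (sqrt b * exp (- v)))"
      by (simp add: norm_mult)
    also have "\<dots> \<le> 2 * sqrt pi * exp (- v) * (D' * exp (- (real (p + 1) * (- v))) + C' * exp (- (real (p + 1) * (- v))))"
      by (intro mult_left_mono order_trans[OF norm_triangle_ineq4] add_mono C' D') auto
    also have "\<dots> = 2 * sqrt pi * (D' + C') * (exp (- v) * exp (- (real (p + 1) * (- v))))"
      by (simp only: ring_distribs mult_ac)
    also have "exp (- v) * exp (- (real (p + 1) * (- v))) = exp (real p * v)"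
      by (simp add: algebra_simps flip: exp_add)
    finally show ?thesis .
  qed
  thus "\<exists>C\<ge>0. \<forall>v<0. norm (gap_core a b w v) \<le> C * exp (real p * v)"
    using C'(1) D'(1) by (intro exI[of _ "2 * sqrt pi * (D' + C')"]) simp
qed

text \<open>
  With \<open>A\<close>, \<open>B\<close> the weights and \<open>1 + 2p, 1 + 2q, 1 + 2r, 1 + 2s\<close> the theta functions at \<open>v\<close> and \<open>-v\<close>,
  reflection gives \<open>B (1 + 2p) (1 + 2q) = A (1 + 2r) (1 + 2s)\<close>. Expanding this expresses \<open>A r s - B p q\<close>
  by the linear terms.
\<close>

lemma theta_product_identity:
  assumes a: "a > 0" and b: "b > 0" and ab: "a * b = pi\<^sup>2" and v: "v \<noteq> 0"
  shows "4 * (of_real (sqrt a) * exp (- (w\<^sup>2 / 4)) * (theta_sum (\<i> * w) (sqrt a * exp v) * theta_sum (\<i> * w) (sqrt a * exp (- v)))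
            - of_real (sqrt b) * exp (w\<^sup>2 / 4) * (theta_sum w (sqrt b * exp v) * theta_sum w (sqrt b * exp (- v))))
       = gap_core a b w v + gap_core a b w (- v)"
proof -
  define A B where "A = of_real (sqrt a) * exp (- (w\<^sup>2 / 4))" and "B = of_real (sqrt b) * exp (w\<^sup>2 / 4)"
  define p q r s where "p = theta_sum w (sqrt b * exp v)" and "q = theta_sum w (sqrt b * exp (- v))"
    and "r = theta_sum (\<i> * w) (sqrt a * exp v)" and "s = theta_sum (\<i> * w) (sqrt a * exp (- v))"
  have 1: "B * (1 + 2 * p) = of_real (sqrt pi * exp (- v)) * (1 + 2 * s)"
    unfolding A_def B_def p_def s_def by (rule theta_reflection[OF a b ab])
  have 2: "A * (1 + 2 * r) = of_real (sqrt pi * exp (- v)) * (1 + 2 * q)"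
    unfolding A_def B_def r_def q_def by (rule theta_reflection'[OF a b ab])
  have 3: "B * (1 + 2 * p) * (1 + 2 * q) = A * (1 + 2 * r) * (1 + 2 * s)"
    unfolding 1 2 by (simp only: mult_ac)
  have "4 * (A * (r * s) - B * (p * q)) = (B * (1 + 2 * p) - A * (1 + 2 * r)) + (B * (1 + 2 * q) - A * (1 + 2 * s)) - (B - A)
      + (A * (1 + 2 * r) * (1 + 2 * s) - B * (1 + 2 * p) * (1 + 2 * q))"
    by (simp add: algebra_simps)
  also have "\<dots> = (B * (1 + 2 * p) - A * (1 + 2 * r)) + (B * (1 + 2 * q) - A * (1 + 2 * s)) - (B - A)"
    using 3 by simp
  also have "\<dots> = gap_core a b w v + gap_core a b w (- v)"
    unfolding gap_core_def gap_const_def A_def[symmetric] B_def[symmetric]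
    using v by (simp add: p_def q_def r_def s_def)
  finally show ?thesis by (simp only: A_def B_def p_def q_def r_def s_def)
qed

lemma gap_mellin_entire:
  assumes "a > 0" "b > 0" "a * b = pi\<^sup>2"
  shows "gap_mellin a b w holomorphic_on S"
  unfolding gap_mellin_def[abs_def] by (rule superexp_decay_laplace_entire[OF gap_core_decay[OF assms]])

text \<open>
  Integrating \<open>theta_product_identity\<close>; reflecting \<open>v\<close> in the second summand turns \<open>z\<close> into \<open>-z\<close>.
\<close>

lemma gap_mellin_symmetrized:
  assumes a: "a > 0" and b: "b > 0" and ab: "a * b = pi\<^sup>2"
  shows "4 * (of_real (sqrt a) * exp (- (w\<^sup>2 / 4)) * (LINT v|lborel. theta_sum (\<i> * w) (sqrt a * exp v) * theta_sum (\<i> * w) (sqrt a * exp (- v)) * exp (z * of_real v))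
            - of_real (sqrt b) * exp (w\<^sup>2 / 4) * (LINT v|lborel. theta_sum w (sqrt b * exp v) * theta_sum w (sqrt b * exp (- v)) * exp (z * of_real v)))
       = gap_mellin a b w z + gap_mellin a b w (- z)"
proof -
  define A B where "A = of_real (sqrt a) * exp (- (w\<^sup>2 / 4))" and "B = of_real (sqrt b) * exp (w\<^sup>2 / 4)"
  let ?g = "gap_core a b w" and ?R = "\<lambda>v. gap_core a b w (0 + (-1) * v) * exp (- z * of_real (0 + (-1) * v))"
  define P where "P = (\<lambda>v. theta_sum (\<i> * w) (sqrt a * exp v) * theta_sum (\<i> * w) (sqrt a * exp (- v)) * exp (z * of_real v))"
  define Q where "Q = (\<lambda>v. theta_sum w (sqrt b * exp v) * theta_sum w (sqrt b * exp (- v)) * exp (z * of_real v))"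
  have P: "integrable lborel P" unfolding P_def by (rule divisor_sum_integral(2)[OF a])
  have Q: "integrable lborel Q" unfolding Q_def by (rule divisor_sum_integral(2)[OF b])
  have dec: "superexp_decay ?g" by (rule gap_core_decay[OF a b ab])
  have g1: "integrable lborel (\<lambda>v. ?g v * exp (z * of_real v))" for z
    by (rule superexp_decay_integrable(1)[OF dec])
  have g2: "integrable lborel (\<lambda>v. ?R v)"
    by (rule lborel_integrable_real_affine[OF g1]) simp
  have g2': "(LINT v|lborel. ?g v * exp (- z * of_real v)) = (LINT v|lborel. ?R v)"
    by (subst lborel_integral_real_affine[where c = "-1" and t = 0]) simp_all
  have "4 * (A * (LINT v|lborel. P v) - B * (LINT v|lborel. Q v)) = (LINT v|lborel. 4 * (A * P v - B * Q v))"
    using P Q by simp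
  also have "\<dots> = (LINT v|lborel. ?g v * exp (z * of_real v) + ?R v)"
  proof (rule integral_cong_AE)
    show "(\<lambda>v. 4 * (A * P v - B * Q v)) \<in> borel_measurable lborel" using P Q by measurable
    show "(\<lambda>v. ?g v * exp (z * of_real v) + ?R v) \<in> borel_measurable lborel"
      by (rule borel_measurable_integrable[OF Bochner_Integration.integrable_add[OF g1 g2]])
    show "AE v in lborel. 4 * (A * P v - B * Q v) = ?g v * exp (z * of_real v) + ?R v"
    proof (rule AE_mp[OF AE_lborel_singleton[of 0]], rule AE_I2, rule impI)
      fix v :: real assume v: "v \<noteq> 0"
      have "4 * (A * P v - B * Q v) = 4 * (A * (theta_sum (\<i> * w) (sqrt a * exp v) * theta_sum (\<i> * w) (sqrt a * exp (- v)))
            - B * (theta_sum w (sqrt b * exp v) * theta_sum w (sqrt b * exp (- v)))) * exp (z * of_real v)"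
        by (simp only: P_def Q_def left_diff_distrib mult.assoc)
      also have "\<dots> = (?g v + ?g (- v)) * exp (z * of_real v)"
        unfolding A_def B_def theta_product_identity[OF a b ab v] ..
      finally show "4 * (A * P v - B * Q v) = ?g v * exp (z * of_real v) + ?R v"
        by (simp add: ring_distribs)
    qed
  qed
  also have "\<dots> = gap_mellin a b w z + gap_mellin a b w (- z)"
    unfolding gap_mellin_def g2' by (rule Bochner_Integration.integral_add[OF g1 g2])
  finally show ?thesis by (simp only: A_def B_def P_def Q_def)
qed

text \<open>
  The first bracket in \<open>rhs_expr\<close>; the second one is its value at \<open>-z\<close>.
\<close>

definition rhs_bracket :: "real \<Rightarrow> real \<Rightarrow> complex \<Rightarrow> complex \<Rightarrow> complex" where
  "rhs_bracket a b w z = of_real b powr ((1 - z) / 2) * hyp1F1 ((1 - z) / 2) (1 / 2) (w\<^sup>2 / 4)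
        - of_real a powr ((1 - z) / 2) * hyp1F1 ((1 - z) / 2) (1 / 2) (- (w\<^sup>2 / 4))"

text \<open>
  The weight \<open>exp(w\<^sup>2/4)\<close> is the exponential in Kummer's transformation, and \<open>\<surd>b\<close> shifts the exponent
  of \<open>b\<close> to \<open>(1 - z)/2\<close>.
\<close>

lemma mellin_gauss_cos_kummer:
  assumes b: "b > 0"
  shows "2 * (of_real (sqrt b) * exp (w\<^sup>2 / 4)) * (of_real (sqrt b) powr (- z) * Z * mellin_gauss_cos w z)
       = Gamma (z / 2) * Z * (of_real b powr ((1 - z) / 2) * hyp1F1 ((1 - z) / 2) (1 / 2) (w\<^sup>2 / 4))"
proof -
  have "exp (w\<^sup>2 / 4) * hyp1F1 (z / 2) (1 / 2) (- (w\<^sup>2 / 4)) = hyp1F1 ((1 - z) / 2) (1 / 2) (w\<^sup>2 / 4)"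
    using kummer_transformation[of "w\<^sup>2 / 4" "z / 2"] by (simp add: diff_divide_distrib)
  moreover have "of_real (sqrt b) * of_real (sqrt b) powr (- z) = complex_of_real b powr ((1 - z) / 2)"
  proof -
    define h where "h = ln b / 2"
    have h: "ln b = 2 * h" "ln (sqrt b) = h" using b by (simp_all add: h_def ln_sqrt)
    have "complex_of_real (sqrt b) = exp (of_real h)"
    proof -
      have "sqrt b = exp h" using b h(2) by (metis exp_ln real_sqrt_gt_zero)
      thus ?thesis by (simp add: exp_of_real)
    qed
    moreover have "complex_of_real (sqrt b) powr (- z) = exp (- z * of_real h)"
      using b h(2) by (simp add: powr_def Ln_of_real)
    moreover have "complex_of_real b powr ((1 - z) / 2) = exp ((1 - z) / 2 * of_real (2 * h))"
      using b h(1) by (simp add: powr_def Ln_of_real)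
    moreover have "(1 - z) / 2 * of_real (2 * h) = of_real h + (- z * of_real h)"
      by (simp add: field_simps)
    ultimately show ?thesis by (simp only: exp_add)
  qed
  moreover have "2 * (of_real (sqrt b) * exp (w\<^sup>2 / 4)) * (of_real (sqrt b) powr (- z) * Z * mellin_gauss_cos w z) =
     Gamma (z / 2) * Z * ((of_real (sqrt b) * of_real (sqrt b) powr (- z)) * (exp (w\<^sup>2 / 4) * hyp1F1 (z / 2) (1 / 2) (- (w\<^sup>2 / 4))))"
    unfolding mellin_gauss_cos_def by simp
  ultimately show ?thesis by (simp only:)
qed

text \<open>
  For \<open>Re z > 1\<close> the theta sums can be integrated separately. Subtracting the constant on \<open>v \<ge> 0\<close> only
  leaves it on \<open>v < 0\<close>, where it integrates to \<open>gap_const / z\<close>.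
\<close>

lemma gap_mellin_half_plane:
  assumes a: "a > 0" and b: "b > 0" and z: "Re z > 1"
  shows "gap_mellin a b w z = Gamma (z / 2) * riemann_zeta z * rhs_bracket a b w z + gap_const a b w / z"
proof -
  define A B where "A = of_real (sqrt a) * exp (- (w\<^sup>2 / 4))" and "B = of_real (sqrt b) * exp (w\<^sup>2 / 4)"
  let ?Z = "riemann_zeta z"
  have sq: "sqrt a > 0" "sqrt b > 0" using a b by auto
  have z0: "Re z > 0" using z by simp
  note Z = riemann_zeta_sums[OF z]
  have "has_bochner_integral lborel (\<lambda>v. 2 * B * (theta_sum w (sqrt b * exp v) * exp (z * of_real v)) - 2 * A * (theta_sum (\<i> * w) (sqrt a * exp v) * exp (z * of_real v))
       + gap_const a b w * (indicator {..<0} v *\<^sub>R exp (z * of_real v)))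
     (2 * B * (of_real (sqrt b) powr (- z) * ?Z * mellin_gauss_cos w z) - 2 * A * (of_real (sqrt a) powr (- z) * ?Z * mellin_gauss_cos (\<i> * w) z) + gap_const a b w * (1 / z))"
    by (intro has_bochner_integral_diff has_bochner_integral_add has_bochner_integral_mult_right
          has_bochner_integral_theta_sum[OF z sq(1) Z] has_bochner_integral_theta_sum[OF z sq(2) Z] has_bochner_integral_exp_left[OF z0])
  moreover have "2 * B * (theta_sum w (sqrt b * exp v) * exp (z * of_real v)) - 2 * A * (theta_sum (\<i> * w) (sqrt a * exp v) * exp (z * of_real v))
       + gap_const a b w * (indicator {..<0} v *\<^sub>R exp (z * of_real v)) = gap_core a b w v * exp (z * of_real v)" for v
    unfolding gap_core_def gap_const_def A_def[symmetric] B_def[symmetric]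
    by (simp add: indicator_def ring_distribs left_diff_distrib)
  ultimately have "gap_mellin a b w z = 2 * B * (of_real (sqrt b) powr (- z) * ?Z * mellin_gauss_cos w z) - 2 * A * (of_real (sqrt a) powr (- z) * ?Z * mellin_gauss_cos (\<i> * w) z) + gap_const a b w * (1 / z)"
    unfolding gap_mellin_def by (simp only: has_bochner_integral_integral_eq)
  moreover have "2 * B * (of_real (sqrt b) powr (- z) * ?Z * mellin_gauss_cos w z) = Gamma (z / 2) * ?Z * (of_real b powr ((1 - z) / 2) * hyp1F1 ((1 - z) / 2) (1 / 2) (w\<^sup>2 / 4))"
    unfolding B_def by (rule mellin_gauss_cos_kummer[OF b])
  moreover have "2 * A * (of_real (sqrt a) powr (- z) * ?Z * mellin_gauss_cos (\<i> * w) z) = Gamma (z / 2) * ?Z * (of_real a powr ((1 - z) / 2) * hyp1F1 ((1 - z) / 2) (1 / 2) (- (w\<^sup>2 / 4)))"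
    using mellin_gauss_cos_kummer[OF a, of "\<i> * w" z ?Z] unfolding A_def by (simp add: power_mult_distrib)
  ultimately show ?thesis by (simp only: rhs_bracket_def right_diff_distrib) simp
qed

lemma rhs_bracket_holomorphic:
  assumes "a > 0" "b > 0"
  shows "rhs_bracket a b w holomorphic_on S"
proof -
  have hyp: "(\<lambda>z. hyp1F1 ((1 - z) / 2) (1 / 2) u) holomorphic_on S" for u
  proof -
    have "(\<lambda>z::complex. (1 - z) / 2) holomorphic_on S" by (intro holomorphic_intros) auto
    from holomorphic_on_compose_gen[OF this hyp1F1_half_holomorphic, of u] show ?thesis by (simp add: o_def)
  qed
  have pw: "(\<lambda>z. of_real c powr ((1 - z) / 2)) holomorphic_on S" if "c > 0" for c :: real
    using that by (auto simp: powr_def intro!: holomorphic_intros)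
  show ?thesis
    unfolding rhs_bracket_def[abs_def] by (intro holomorphic_intros hyp pw assms)
qed

text \<open>
  Dividing by \<open>\<Gamma>(z/2)\<close> removes the poles at the even integers, and \<open>rGamma_half_div\<close> the one of \<open>1/z\<close>;
  the identity theorem then applies on the connected set of all \<open>z \<noteq> 1\<close>.
\<close>

lemma gap_mellin_identity:
  assumes a: "a > 0" and b: "b > 0" and ab: "a * b = pi\<^sup>2" and z: "z \<noteq> 1"
  shows "gap_mellin a b w z * rGamma (z / 2) = riemann_zeta z * rhs_bracket a b w z + gap_const a b w * (rGamma (z / 2 + 1) / 2)"
proof (rule analytic_continuation_open[of "{s. Re s > 1}" "- {1}"
      "\<lambda>z. gap_mellin a b w z * rGamma (z / 2)" "\<lambda>z. riemann_zeta z * rhs_bracket a b w z + gap_const a b w * (rGamma (z / 2 + 1) / 2)"])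
  show "{s. Re s > 1} \<noteq> {}" by (auto intro: exI[of _ 2])
  show "(\<lambda>z. gap_mellin a b w z * rGamma (z / 2)) holomorphic_on - {1}"
    by (intro holomorphic_intros gap_mellin_entire a b ab) auto
  show "(\<lambda>z. riemann_zeta z * rhs_bracket a b w z + gap_const a b w * (rGamma (z / 2 + 1) / 2)) holomorphic_on - {1}"
    by (intro holomorphic_intros riemann_zeta_holomorphic rhs_bracket_holomorphic a b) auto
  fix s assume "s \<in> {s. Re s > 1}"
  hence s: "Re s > 1" by simp
  hence s0: "s \<noteq> 0" by auto
  have g: "Gamma (s / 2) * rGamma (s / 2) = 1"
    using Re_pos_not_nonpos_Int[of "s/2"] s by (simp add: rGamma_inverse_Gamma Gamma_eq_zero_iff)
  have "gap_mellin a b w s * rGamma (s / 2) = riemann_zeta s * rhs_bracket a b w s * (Gamma (s / 2) * rGamma (s / 2)) + gap_const a b w * (rGamma (s / 2) / s)"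
    unfolding gap_mellin_half_plane[OF a b s] by (simp add: ring_distribs)
  thus "gap_mellin a b w s * rGamma (s / 2) = riemann_zeta s * rhs_bracket a b w s + gap_const a b w * (rGamma (s / 2 + 1) / 2)"
    unfolding g rGamma_half_div[OF s0] by simp
qed (use z connected_minus_1 in \<open>auto simp: open_halfspace_Re_gt\<close>)

lemma gap_mellin_regular:
  assumes a: "a > 0" and b: "b > 0" and ab: "a * b = pi\<^sup>2" and z: "z \<notin> rhs_singular_points"
  shows "gap_mellin a b w z = Gamma (z / 2) * riemann_zeta z * rhs_bracket a b w z + gap_const a b w / z"
proof -
  have z1: "z \<noteq> 1" using z by (simp add: rhs_singular_points_def)
  have z0: "z \<noteq> 0"
  proof
    assume "z = 0"
    hence "z = 2 * of_int 0" by simp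
    thus False using z unfolding rhs_singular_points_def by blast
  qed
  have "z / 2 \<notin> \<int>\<^sub>\<le>\<^sub>0"
  proof
    assume "z / 2 \<in> \<int>\<^sub>\<le>\<^sub>0"
    then obtain k :: int where "z / 2 = of_int k" by (auto elim: nonpos_Ints_cases)
    hence "z = 2 * of_int k" by simp
    thus False using z unfolding rhs_singular_points_def by blast
  qed
  hence g: "rGamma (z / 2) * Gamma (z / 2) = 1"
    by (simp add: rGamma_inverse_Gamma Gamma_eq_zero_iff)
  have "gap_mellin a b w z = gap_mellin a b w z * rGamma (z / 2) * Gamma (z / 2)"
    using g by (simp only: mult.assoc mult_1_right)
  also have "\<dots> = Gamma (z / 2) * riemann_zeta z * rhs_bracket a b w z + gap_const a b w * ((rGamma (z / 2) / z) * Gamma (z / 2))"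
    unfolding gap_mellin_identity[OF a b ab z1] rGamma_half_div[OF z0] by (simp only: ring_distribs mult_ac)
  also have "(rGamma (z / 2) / z) * Gamma (z / 2) = 1 / z"
    using g by simp
  finally show ?thesis by simp
qed

lemma rhs_singular_points_minus: "- z \<in> rhs_singular_points \<longleftrightarrow> z \<in> rhs_singular_points"
proof -
  have "- z \<in> rhs_singular_points" if z: "z \<in> rhs_singular_points" for z
  proof -
    consider "z = 1" | "z = -1" | k :: int where "z = 2 * of_int k"
      using z unfolding rhs_singular_points_def by auto
    thus ?thesis
    proof cases
      case (3 k)
      hence "- z = 2 * of_int (- k)" by simp
      thus ?thesis unfolding rhs_singular_points_def by blast
    qed (simp_all add: rhs_singular_points_def)
  qed
  from this[of z] this[of "- z"] show ?thesis by auto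
qed

text \<open>
  The terms \<open>gap_const / z\<close> at \<open>z\<close> and \<open>-z\<close> cancel.
\<close>

lemma rhs_expr_regular:
  assumes a: "a > 0" and b: "b > 0" and ab: "a * b = pi\<^sup>2" and z: "z \<notin> rhs_singular_points"
  shows "rhs_expr a b w z = (gap_mellin a b w z + gap_mellin a b w (- z)) / 4"
proof -
  have mz: "- z \<notin> rhs_singular_points" using z by (simp add: rhs_singular_points_minus)
  show ?thesis
    unfolding gap_mellin_regular[OF a b ab z] gap_mellin_regular[OF a b ab mz] rhs_expr_def rhs_bracket_def
    by (simp add: add_divide_distrib)
qed

text \<open>
  All singular points are integers, hence at mutual distance at least \<open>1\<close>.
\<close>

lemma eventually_rhs_regular:
  assumes z: "z \<in> rhs_singular_points"
  shows "eventually (\<lambda>s. s \<notin> rhs_singular_points) (at z)"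
proof -
  have int: "\<exists>m::int. s = of_int m" if s: "s \<in> rhs_singular_points" for s
  proof -
    consider "s = of_int 1" | "s = of_int (-1)" | k :: int where "s = of_int (2 * k)"
      using s unfolding rhs_singular_points_def by auto
    thus ?thesis by cases blast+
  qed
  obtain m :: int where m: "z = of_int m" using int[OF z] by blast
  show ?thesis
    unfolding eventually_at
  proof (intro exI[of _ 1] conjI ballI impI)
    fix s assume s: "s \<noteq> z \<and> dist s z < 1"
    show "s \<notin> rhs_singular_points"
    proof
      assume "s \<in> rhs_singular_points"
      then obtain n :: int where n: "s = of_int n" using int by blast
      have "norm (complex_of_int (n - m)) < 1" using s by (simp add: m n dist_norm)
      hence "\<bar>n - m\<bar> < 1" unfolding norm_of_int by linarith
      thus False using s by (simp add: m n)
    qed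
  qed simp
qed

theorem theorem1p4:
  fixes z w :: complex and a b :: real
  assumes "a > 0" and "b > 0" and "a * b = pi\<^sup>2"
  defines "S \<equiv> (\<lambda>n::nat. divisor_sigma (- z) n * of_nat n powr (z / 2) *
                  exp (- (w\<^sup>2 / 4)) * gen_bessel_K (z / 2) (\<i> * w) (2 * real n * a))"
    and "T \<equiv> (\<lambda>n::nat. divisor_sigma (- z) n * of_nat n powr (z / 2) *
                  exp (w\<^sup>2 / 4) * gen_bessel_K (z / 2) w (2 * real n * b))"
  defines "L \<equiv> of_real (sqrt a) * (\<Sum>n. S (Suc n)) - of_real (sqrt b) * (\<Sum>n. T (Suc n))"
  shows "summable (\<lambda>n. S (Suc n)) \<and> summable (\<lambda>n. T (Suc n)) \<and>
         (z \<notin> rhs_singular_points \<longrightarrow> L = rhs_expr a b w z) \<and>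
         (z \<in> rhs_singular_points \<longrightarrow> (rhs_expr a b w \<longlongrightarrow> L) (at z))"
proof -
  note abp = assms(1,2,3)
  let ?Ia = "LINT v|lborel. theta_sum (\<i> * w) (sqrt a * exp v) * theta_sum (\<i> * w) (sqrt a * exp (- v)) * exp (z * of_real v)"
  let ?Ib = "LINT v|lborel. theta_sum w (sqrt b * exp v) * theta_sum w (sqrt b * exp (- v)) * exp (z * of_real v)"
  have "(\<lambda>n. exp (- (w\<^sup>2 / 4)) * (divisor_sigma (- z) (Suc n) * of_nat (Suc n) powr (z / 2) * gen_bessel_K (z / 2) (\<i> * w) (2 * real (Suc n) * a))) sums (exp (- (w\<^sup>2 / 4)) * ?Ia)"
    by (intro sums_mult divisor_sum_integral abp)
  hence S: "(\<lambda>n. S (Suc n)) sums (exp (- (w\<^sup>2 / 4)) * ?Ia)"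
    by (simp only: S_def mult_ac)
  have "(\<lambda>n. exp (w\<^sup>2 / 4) * (divisor_sigma (- z) (Suc n) * of_nat (Suc n) powr (z / 2) * gen_bessel_K (z / 2) w (2 * real (Suc n) * b))) sums (exp (w\<^sup>2 / 4) * ?Ib)"
    by (intro sums_mult divisor_sum_integral abp)
  hence T: "(\<lambda>n. T (Suc n)) sums (exp (w\<^sup>2 / 4) * ?Ib)"
    by (simp only: T_def mult_ac)
  have L4: "4 * L = gap_mellin a b w z + gap_mellin a b w (- z)"
    unfolding L_def sums_unique[OF S, symmetric] sums_unique[OF T, symmetric] mult.assoc[symmetric]
    using gap_mellin_symmetrized[OF abp, of w z] by (simp only: mult.assoc)
  hence L: "L = (gap_mellin a b w z + gap_mellin a b w (- z)) / 4" by (simp flip: L4)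
  have "(rhs_expr a b w \<longlongrightarrow> L) (at z)" if z: "z \<in> rhs_singular_points"
  proof -
    have cont: "isCont (gap_mellin a b w) s" for s
      using gap_mellin_entire[OF abp, of w UNIV] holomorphic_on_imp_continuous_on[of "gap_mellin a b w" UNIV]
      by (simp add: continuous_on_eq_continuous_at)
    have "((\<lambda>s. (gap_mellin a b w s + gap_mellin a b w (- s)) / 4) \<longlongrightarrow> L) (at z)"
    proof -
      have "((\<lambda>s. gap_mellin a b w s) \<longlongrightarrow> gap_mellin a b w z) (at z)"
        using cont[of z] by (simp add: isCont_def)
      moreover have "((\<lambda>s. gap_mellin a b w (- s)) \<longlongrightarrow> gap_mellin a b w (- z)) (at z)"
        by (intro isCont_tendsto_compose[OF cont] tendsto_intros)
      ultimately show ?thesis unfolding L by (intro tendsto_intros) auto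
    qed
    thus ?thesis
    proof (rule Lim_transform_eventually)
      show "\<forall>\<^sub>F s in at z. (gap_mellin a b w s + gap_mellin a b w (- s)) / 4 = rhs_expr a b w s"
        using eventually_rhs_regular[OF z] by eventually_elim (simp add: rhs_expr_regular[OF abp])
    qed
  qed
  moreover have "L = rhs_expr a b w z" if "z \<notin> rhs_singular_points"
    unfolding L rhs_expr_regular[OF abp that] ..
  ultimately show ?thesis using sums_summable[OF S] sums_summable[OF T] by blast
qed

end
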